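(* Let $\mathcal A,\mathcal B$ be unital $C^*$-algebras with faithful traces $\tau,\omega$, respectively, and let $\phi:\mathcal D_\tau^{-1}(\mathcal A)\to\mathcal D_\omega^{-1}(\mathcal B)$ be a surjective map. Then \[ S_{BS}^\omega(\phi(A)\|\phi(B))=S_{BS}^\tau(A\|B)\quad\text{for all }A,B\in\mathcal D_\tau^{-1}(\mathcal A) \] holds if and only if $\phi$ is of the standard form.
   Context: All $C^*$-algebras are unital; $\mathcal A_+^{-1}$ is the set of positive invertible elements. A trace $\tau$ is a positive linear functional with $\tau(AB)=\tau(BA)$; faithful means $\tau(A)=0$, $A\ge0$ implies $A=0$. $\mathcal D_\tau^{-1}(\mathcal A)=\{A\in\mathcal A_+^{-1}:\tau(A)=1\}$. The Belavkin–Staszewski relative entropy is $S_{BS}^\tau(A\|B)=\tau\big(A\log(A^{1/2}B^{-1}A^{1/2})\big)$. A Jordan *-isomorphism $J:\mathcal A\to\mathcal B$ is a linear bijection with $J(XY+YX)=J(X)J(Y)+J(Y)J(X)$ and $J(X^* )=J(X)^*$. The map $\phi$ is of the standard form if there are a central $C\in\mathcal B_+^{-1}$ and a Jordan *-isomorphism $J:\mathcal A\to\mathcal B$ with $\phi(A)=CJ(A)$ for all $A\in\mathcal D_\tau^{-1}(\mathcal A)$ and $\omega(CJ(X))=\tau(X)$ for all $X\in\mathcal A$. *)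

theory Defs
  imports Complex_Main
begin

class cstar_algebra = real_normed_algebra_1 + banach +
  fixes cscale :: "complex \<Rightarrow> 'a \<Rightarrow> 'a"
    and adj :: "'a \<Rightarrow> 'a"
  assumes cscale_add_right: "cscale c (x + y) = cscale c x + cscale c y"
    and cscale_add_left: "cscale (c + d) x = cscale c x + cscale d x"
    and cscale_cscale: "cscale c (cscale d x) = cscale (c * d) x"
    and cscale_of_real: "cscale (complex_of_real r) x = scaleR r x"
    and cscale_mult_left: "cscale c x * y = cscale c (x * y)"
    and cscale_mult_right: "x * cscale c y = cscale c (x * y)"
    and norm_cscale: "norm (cscale c x) = cmod c * norm x"
    and adj_adj: "adj (adj x) = x"
    and adj_add: "adj (x + y) = adj x + adj y"
    and adj_cscale: "adj (cscale c x) = cscale (cnj c) (adj x)"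
    and adj_mult: "adj (x * y) = adj y * adj x"
    and cstar_identity: "norm (adj x * x) = (norm x)\<^sup>2"

definition cs_positive :: "'a::cstar_algebra \<Rightarrow> bool" where
  "cs_positive A \<longleftrightarrow> (\<exists>X. A = adj X * X)"

definition cs_invertible :: "'a::cstar_algebra \<Rightarrow> bool" where
  "cs_invertible A \<longleftrightarrow> (\<exists>B. A * B = 1 \<and> B * A = 1)"

definition cs_inv :: "'a::cstar_algebra \<Rightarrow> 'a" where
  "cs_inv A = (THE B. A * B = 1 \<and> B * A = 1)"

definition pos_inv :: "'a::cstar_algebra set" where
  "pos_inv = {A. cs_positive A \<and> cs_invertible A}"

definition central :: "'a::cstar_algebra \<Rightarrow> bool" where
  "central C \<longleftrightarrow> (\<forall>X. C * X = X * C)"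

definition cs_sqrt :: "'a::cstar_algebra \<Rightarrow> 'a" where
  "cs_sqrt A = (THE R. cs_positive R \<and> R * R = A)"

text \<open>Logarithm of a positive invertible element: the unique self-adjoint
element whose exponential is the given element (continuous functional calculus).\<close>
definition cs_log :: "'a::cstar_algebra \<Rightarrow> 'a" where
  "cs_log X = (THE L. adj L = L \<and> exp L = X)"

definition is_trace :: "('a::cstar_algebra \<Rightarrow> complex) \<Rightarrow> bool" where
  "is_trace \<tau> \<longleftrightarrow>
     (\<forall>x y. \<tau> (x + y) = \<tau> x + \<tau> y) \<and>
     (\<forall>c x. \<tau> (cscale c x) = c * \<tau> x) \<and>
     (\<forall>x. cs_positive x \<longrightarrow> Im (\<tau> x) = 0 \<and> Re (\<tau> x) \<ge> 0) \<and>
     (\<forall>x y. \<tau> (x * y) = \<tau> (y * x))"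

definition faithful_trace :: "('a::cstar_algebra \<Rightarrow> complex) \<Rightarrow> bool" where
  "faithful_trace \<tau> \<longleftrightarrow> is_trace \<tau> \<and>
     (\<forall>A. cs_positive A \<and> \<tau> A = 0 \<longrightarrow> A = 0)"

definition density_set :: "('a::cstar_algebra \<Rightarrow> complex) \<Rightarrow> 'a set" where
  "density_set \<tau> = {A \<in> pos_inv. \<tau> A = 1}"

definition S_BS :: "('a::cstar_algebra \<Rightarrow> complex) \<Rightarrow> 'a \<Rightarrow> 'a \<Rightarrow> complex" where
  "S_BS \<tau> A B = \<tau> (A * cs_log (cs_sqrt A * cs_inv B * cs_sqrt A))"

definition jordan_star_iso :: "('a::cstar_algebra \<Rightarrow> 'b::cstar_algebra) \<Rightarrow> bool" where
  "jordan_star_iso J \<longleftrightarrow> bij J \<and>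
     (\<forall>x y. J (x + y) = J x + J y) \<and>
     (\<forall>c x. J (cscale c x) = cscale c (J x)) \<and>
     (\<forall>X Y. J (X * Y + Y * X) = J X * J Y + J Y * J X) \<and>
     (\<forall>X. J (adj X) = adj (J X))"

definition standard_form ::
  "('a::cstar_algebra \<Rightarrow> complex) \<Rightarrow> ('b::cstar_algebra \<Rightarrow> complex) \<Rightarrow> ('a \<Rightarrow> 'b) \<Rightarrow> bool" where
  "standard_form \<tau> \<omega> \<phi> \<longleftrightarrow>
     (\<exists>C J. central C \<and> C \<in> pos_inv \<and> jordan_star_iso J \<and>
        (\<forall>A \<in> density_set \<tau>. \<phi> A = C * J A) \<and>
        (\<forall>X. \<omega> (C * J X) = \<tau> X))"

end

theory Submission
  imports Defs "HOL-Analysis.Analysis"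
begin

text \<open>If \<open>\<phi>\<close> is in the standard form, then all ingredients of the entropy are transported by the
Jordan isomorphism, and the trace property symmetrises the one product it does not preserve.

Conversely, extend \<open>\<phi>\<close> to a positively homogeneous bijection \<open>\<Phi>\<close> of the cones of positive invertible
elements; it still preserves the entropy and the trace. Since \<open>A \<le> B\<close> holds iff
\<open>S(X, B) \<le> S(X, A)\<close> for all \<open>X\<close>, it is an order isomorphism. Hence it preserves the distance
\<open>inf {2 \<tau>(M) - \<tau>(X) - \<tau>(Y) | X \<le> M, Y \<le> M}\<close>, and a Mazur--Ulam argument on order intervals shows that
\<open>\<Phi>\<close> is additive, so it extends to a linear bijection \<open>L\<close>. The second order Taylor
coefficient of \<open>S(A, A + t H)\<close>, differentiated once more in \<open>A\<close> at \<open>1\<close>, gives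
\<open>\<tau>(H G H) = \<omega>(L(H) e L(G) e L(H))\<close> with \<open>e = L(1)\<^sup>-\<^sup>1\<close>. Symmetry of the trace forces \<open>e\<close> to be
central, and then \<open>J = e L\<close> preserves squares.

No Gelfand theory is used: the facts about \<open>C\<^sup>*\<close>-algebras needed below follow from the binomial
series of the square root and an integral formula for the logarithm.\<close>

subsection \<open>The involution and the square root series\<close>

text \<open>The order can be read off from the second argument because the entropy is antitone
  there: inversion reverses the order and the logarithm respects it. Conversely, a test element X
  concentrated where an inequality fails detects the failure. The infimum over upper bounds is the
  trace norm distance tr |X - Y| of self-adjoint elements; in this form it mentions only order and
  trace, so any trace preserving order isomorphism visibly respects it. Mazur-Ulam for whole normed
  spaces does not apply, since \<Phi> lives on an open cone; order intervals are bounded, symmetric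
  about their midpoints and mapped onto order intervals, which is all that the reflection argument
  asks for. The Taylor coefficient is tr(H A^-1 H)/2, from log(1 + P) = P - P^2/2 + ..., and its
  derivative in A is, up to sign, a cubic form. Polarised on the source side it is tr(H G K + K G
  H), symmetric in all three arguments, whereas the image side carries factors e between the
  arguments because \<Phi> need not map 1 to 1; comparing the two constrains e.\<close>

abbreviation self_adj :: "'a::cstar_algebra \<Rightarrow> bool" where
  "self_adj A \<equiv> adj A = A"

lemma adj_scaleR: "adj (r *\<^sub>R x) = r *\<^sub>R adj x"
  using adj_cscale[of "complex_of_real r" x] by (simp add: cscale_of_real)

lemma adj_zero: "adj 0 = (0::'a::cstar_algebra)"
  using adj_scaleR[of 0 "0::'a"] by simp

lemma adj_minus: "adj (- x) = - adj x"
  using adj_scaleR[of "-1" x] by simp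

lemma adj_diff: "adj (x - y) = adj x - adj y"
  using adj_add[of x "- y"] by (simp add: adj_minus)

lemma adj_one: "adj 1 = (1::'a::cstar_algebra)"
  by (metis adj_adj adj_mult mult_1_left mult_1_right)

lemma adj_power: "adj (x ^ n) = adj x ^ n"
  by (induction n) (simp_all add: adj_one adj_mult power_commutes)

lemma adj_of_real: "adj (of_real r) = (of_real r :: 'a::cstar_algebra)"
  by (simp add: of_real_def adj_scaleR adj_one)

lemmas adj_simps = adj_adj adj_add adj_mult adj_diff adj_minus adj_zero adj_one adj_scaleR
  adj_power adj_of_real

lemma norm_adj: "norm (adj x) = norm x"
proof -
  have le: "norm y \<le> norm (adj y)" for y :: 'a
  proof (cases "y = 0")
    case False
    have "(norm y)\<^sup>2 \<le> norm (adj y) * norm y"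
      by (metis cstar_identity norm_mult_ineq)
    then show ?thesis using False by (simp add: power2_eq_square)
  qed (simp add: adj_zero)
  show ?thesis using le[of x] le[of "adj x"] by (simp add: adj_adj)
qed

lemma bounded_linear_adj: "bounded_linear (adj :: 'a::cstar_algebra \<Rightarrow> 'a)"
  by (rule bounded_linear_intro[where K = 1]) (simp_all add: adj_simps norm_adj)

lemma norm_square_self_adj: "self_adj x \<Longrightarrow> norm (x * x) = (norm x)\<^sup>2"
  using cstar_identity[of x] by simp

lemma norm_unitary:
  fixes U :: "'a::cstar_algebra"
  assumes "adj U * U = of_real (c\<^sup>2)" "c \<ge> 0"
  shows "norm U = c"
proof -
  have "(norm U)\<^sup>2 = c\<^sup>2" using cstar_identity[of U] assms by (simp add: norm_of_real del: of_real_power)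
  then show ?thesis using assms(2) by simp
qed

section \<open>Complex scalars, real and imaginary parts\<close>

lemma cscale_0_right: "cscale c 0 = (0::'a::cstar_algebra)"
  using cscale_add_right[of c "0::'a" 0] by simp

lemma cscale_minus: "cscale c (- x) = - cscale c (x::'a::cstar_algebra)"
  using cscale_add_right[of c x "- x"] by (simp add: cscale_0_right eq_neg_iff_add_eq_0 add.commute)

lemma cscale_diff: "cscale c (x - y) = cscale c x - cscale c (y::'a::cstar_algebra)"
  using cscale_add_right[of c x "- y"] by (simp add: cscale_minus)

lemma cscale_one: "cscale 1 x = (x::'a::cstar_algebra)"
  using cscale_of_real[of 1 x] by simp

lemma cscale_neg: "cscale (- c) x = - cscale c (x::'a::cstar_algebra)"
proof -
  have "cscale (- c) x + cscale c x = 0"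
    using cscale_add_left[of "- c" c x] cscale_of_real[of 0 x] by simp
  then show ?thesis by (simp add: eq_neg_iff_add_eq_0)
qed

lemma cscale_ii: "cscale \<i> (cscale \<i> x) = - (x::'a::cstar_algebra)"
  by (simp add: cscale_cscale cscale_neg cscale_one)

lemma cscale_split: "cscale c x = Re c *\<^sub>R x + cscale \<i> (Im c *\<^sub>R (x::'a::cstar_algebra))"
proof -
  have "cscale c x = cscale (complex_of_real (Re c) + \<i> * complex_of_real (Im c)) x"
    by (metis complex_eq)
  then show ?thesis by (simp add: cscale_add_left cscale_of_real flip: cscale_cscale)
qed

definition re_part :: "'a::cstar_algebra \<Rightarrow> 'a" where
  "re_part x = (1/2) *\<^sub>R (x + adj x)"

definition im_part :: "'a::cstar_algebra \<Rightarrow> 'a" where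
  "im_part x = (1/2) *\<^sub>R cscale \<i> (adj x - x)"

lemma self_adj_re_part: "self_adj (re_part x)"
  by (simp add: re_part_def adj_simps add.commute)

lemma self_adj_im_part: "self_adj (im_part x)"
  by (simp add: im_part_def adj_simps adj_cscale cscale_neg flip: cscale_minus)

lemma re_im_part: "x = re_part x + cscale \<i> (im_part x)"
proof -
  have "cscale \<i> (im_part x) = (1/2) *\<^sub>R (x - adj x)"
    by (simp add: im_part_def cscale_ii cscale_diff cscale_cscale cscale_neg cscale_one
        flip: cscale_of_real)
  moreover have "(1/2) *\<^sub>R (x + adj x) + (1/2) *\<^sub>R (x - adj x) = x"
    by (simp flip: scaleR_add_right)
  ultimately show ?thesis by (simp add: re_part_def)
qed

lemma re_part_add: "re_part (x + y) = re_part x + re_part (y::'a::cstar_algebra)"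
  by (simp add: re_part_def adj_add algebra_simps)

lemma im_part_add: "im_part (x + y) = im_part x + im_part (y::'a::cstar_algebra)"
  by (simp add: im_part_def adj_add algebra_simps cscale_add_right cscale_diff)

lemma re_part_self_adj: "self_adj x \<Longrightarrow> re_part x = (x::'a::cstar_algebra)"
  by (simp add: re_part_def flip: scaleR_2)

lemma im_part_self_adj: "self_adj x \<Longrightarrow> im_part x = (0::'a::cstar_algebra)"
  by (simp add: im_part_def cscale_0_right)

lemma parts_unique:
  fixes x :: "'a::cstar_algebra"
  assumes "x = a + cscale \<i> b" "self_adj a" "self_adj b"
  shows "re_part x = a" "im_part x = b"
proof -
  have ax: "adj x = a - cscale \<i> b" using assms by (simp add: adj_add adj_cscale cscale_neg)
  show "re_part x = a" unfolding re_part_def ax unfolding assms(1) by (simp flip: scaleR_2)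
  have "adj x - x = - (2 *\<^sub>R cscale \<i> b)" unfolding ax unfolding assms(1) by (simp add: scaleR_2)
  then have "cscale \<i> (adj x - x) = 2 *\<^sub>R b"
    by (simp add: cscale_minus cscale_diff cscale_ii scaleR_2)
  then show "im_part x = b" by (simp add: im_part_def)
qed

lemma cscale_scaleR: "cscale c (r *\<^sub>R x) = r *\<^sub>R cscale c (x::'a::cstar_algebra)"
  by (simp add: cscale_cscale mult.commute flip: cscale_of_real)

section \<open>The power series of (1 - t)^(1/2)\<close>

definition sqrt_coeff :: "nat \<Rightarrow> real" where
  "sqrt_coeff n = pochhammer (- 1/2) n / fact n"

lemma sqrt_coeff_gbinomial: "sqrt_coeff n = (-1) ^ n * ((1/2) gchoose n)"
  by (simp add: sqrt_coeff_def gbinomial_pochhammer flip: mult.assoc power_mult_distrib)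

lemma sqrt_coeff_0: "sqrt_coeff 0 = 1"
  by (simp add: sqrt_coeff_def)

lemma sqrt_coeff_Suc_nonpos: "sqrt_coeff (Suc n) \<le> 0"
proof -
  have "pochhammer (1/2 :: real) n \<ge> 0" by (rule pochhammer_nonneg) simp
  then show ?thesis by (simp add: sqrt_coeff_def pochhammer_rec divide_nonpos_pos)
qed

text \<open>All coefficients after the first are nonpositive, so this sum is 1 minus a partial sum
  of the series at t = 1. That partial sum is, up to sign, again a binomial coefficient and is
  nonnegative. The series therefore converges absolutely on the closed unit ball, boundary
  included.\<close>

lemma sum_abs_sqrt_coeff: "(\<Sum>n<N. \<bar>sqrt_coeff (Suc n)\<bar>) \<le> 1"
proof -
  have "(\<Sum>n\<le>N. sqrt_coeff n) = (- 1) ^ N * (1/2 - 1 gchoose N)"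
    using gbinomial_sum_lower_neg[of "1/2::real" N] by (simp add: sqrt_coeff_gbinomial mult.commute)
  also have "\<dots> = pochhammer (1/2) N / fact N"
    by (simp add: gbinomial_pochhammer flip: mult.assoc power_mult_distrib)
  also have "\<dots> \<ge> 0" by (intro divide_nonneg_nonneg pochhammer_nonneg) auto
  finally have "(\<Sum>n\<le>N. sqrt_coeff n) \<ge> 0" .
  moreover have "(\<Sum>n\<le>N. sqrt_coeff n) = 1 + (\<Sum>n<N. sqrt_coeff (Suc n))"
    by (simp add: sqrt_coeff_0 sum.atMost_shift)
  moreover have "(\<Sum>n<N. \<bar>sqrt_coeff (Suc n)\<bar>) = - (\<Sum>n<N. sqrt_coeff (Suc n))"
    by (simp add: abs_of_nonpos sqrt_coeff_Suc_nonpos sum_negf)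
  ultimately show ?thesis by linarith
qed

lemma summable_abs_sqrt_coeff: "summable (\<lambda>n. \<bar>sqrt_coeff n\<bar>)"
  and suminf_abs_sqrt_coeff: "(\<Sum>n. \<bar>sqrt_coeff (Suc n)\<bar>) \<le> 1"
proof -
  have s: "summable (\<lambda>n. \<bar>sqrt_coeff (Suc n)\<bar>)"
    by (rule summableI_nonneg_bounded[of _ 1]) (auto intro: sum_abs_sqrt_coeff)
  then show "summable (\<lambda>n. \<bar>sqrt_coeff n\<bar>)" by (subst (asm) summable_Suc_iff)
  show "(\<Sum>n. \<bar>sqrt_coeff (Suc n)\<bar>) \<le> 1"
    by (rule suminf_le_const[OF s]) (rule sum_abs_sqrt_coeff)
qed

text \<open>Vandermonde for 1/2 + 1/2 = 1: the square of the series is 1 - t.\<close>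

lemma sqrt_coeff_convolution:
  "(\<Sum>i\<le>n. sqrt_coeff i * sqrt_coeff (n - i)) = (if n = 0 then 1 else if n = 1 then - 1 else 0)"
proof -
  have "(\<Sum>i\<le>n. sqrt_coeff i * sqrt_coeff (n - i))
      = (\<Sum>i\<le>n. (-1) ^ n * (((1/2) gchoose i) * ((1/2) gchoose (n - i))))"
    by (rule sum.cong) (auto simp: sqrt_coeff_gbinomial simp flip: power_add)
  also have "\<dots> = (-1) ^ n * (1 gchoose n)"
    using gbinomial_Vandermonde[of "1/2::real" "1/2" n] by (simp add: atLeast0AtMost flip: sum_distrib_left)
  also have "\<dots> = (if n = 0 then 1 else if n = 1 then - 1 else 0)"
  proof -
    have "(1::real) gchoose n = of_nat (1 choose n)" by (metis binomial_gbinomial of_nat_1)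
    then show ?thesis by (cases n) (auto simp: binomial_eq_0)
  qed
  finally show ?thesis .
qed

definition sqrt_one_minus :: "'a::cstar_algebra \<Rightarrow> 'a" where
  "sqrt_one_minus T = (\<Sum>n. sqrt_coeff n *\<^sub>R T ^ n)"

context
  fixes T :: "'a::cstar_algebra"
  assumes T: "norm T \<le> 1"
begin

lemma sqrt_series_norm_le: "norm (sqrt_coeff n *\<^sub>R T ^ n) \<le> \<bar>sqrt_coeff n\<bar>"
proof -
  have "norm (T ^ n) \<le> 1" using T norm_power_ineq[of T n] power_le_one[of "norm T" n] norm_ge_zero[of T] by linarith
  then show ?thesis by (simp add: mult_left_le)
qed

lemma summable_norm_sqrt_series: "summable (\<lambda>n. norm (sqrt_coeff n *\<^sub>R T ^ n))"
  by (rule summable_comparison_test'[OF summable_abs_sqrt_coeff, of 0]) (use sqrt_series_norm_le in simp)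

lemma summable_sqrt_series: "summable (\<lambda>n. sqrt_coeff n *\<^sub>R T ^ n)"
  using summable_norm_sqrt_series by (rule summable_norm_cancel)

lemma sqrt_one_minus_square: "sqrt_one_minus T * sqrt_one_minus T = 1 - T"
proof -
  let ?d = "\<lambda>n::nat. if n = 0 then 1 else if n = 1 then - 1 else (0::real)"
  have "sqrt_one_minus T * sqrt_one_minus T
      = (\<Sum>k. \<Sum>i\<le>k. (sqrt_coeff i *\<^sub>R T ^ i) * (sqrt_coeff (k - i) *\<^sub>R T ^ (k - i)))"
    unfolding sqrt_one_minus_def
    by (rule Cauchy_product; rule summable_norm_sqrt_series)
  also have "\<dots> = (\<Sum>k. ?d k *\<^sub>R T ^ k)"
  proof (rule suminf_cong)
    fix k
    have "(\<Sum>i\<le>k. (sqrt_coeff i *\<^sub>R T ^ i) * (sqrt_coeff (k - i) *\<^sub>R T ^ (k - i)))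
        = (\<Sum>i\<le>k. (sqrt_coeff i * sqrt_coeff (k - i)) *\<^sub>R T ^ k)"
      by (rule sum.cong) (auto simp flip: power_add)
    then show "(\<Sum>i\<le>k. (sqrt_coeff i *\<^sub>R T ^ i) * (sqrt_coeff (k - i) *\<^sub>R T ^ (k - i)))
        = ?d k *\<^sub>R T ^ k"
      by (simp only: sqrt_coeff_convolution flip: scaleR_sum_left)
  qed
  also have "\<dots> = (\<Sum>k\<in>{0,1}. ?d k *\<^sub>R T ^ k)" by (rule suminf_finite) auto
  also have "\<dots> = 1 - T" by simp
  finally show ?thesis .
qed

text \<open>This puts the root in the unit ball around 1, which is exactly what makes it positive in
  the sense of \<open>npos\<close> below.\<close>

lemma norm_one_minus_sqrt: "norm (1 - sqrt_one_minus T) \<le> 1"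
proof -
  have s: "summable (\<lambda>n. sqrt_coeff (Suc n) *\<^sub>R T ^ Suc n)"
    using summable_sqrt_series by (subst summable_Suc_iff)
  have "sqrt_one_minus T = 1 + (\<Sum>n. sqrt_coeff (Suc n) *\<^sub>R T ^ Suc n)"
    using suminf_split_head[OF summable_sqrt_series]
    by (simp add: sqrt_one_minus_def sqrt_coeff_0 algebra_simps)
  then have "norm (1 - sqrt_one_minus T) = norm (\<Sum>n. sqrt_coeff (Suc n) *\<^sub>R T ^ Suc n)"
    by simp
  also have "\<dots> \<le> (\<Sum>n. \<bar>sqrt_coeff (Suc n)\<bar>)"
  proof (rule norm_suminf_le)
    show "norm (sqrt_coeff (Suc n) *\<^sub>R T ^ Suc n) \<le> \<bar>sqrt_coeff (Suc n)\<bar>" for n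
      by (rule sqrt_series_norm_le)
    show "summable (\<lambda>n. \<bar>sqrt_coeff (Suc n)\<bar>)"
      using summable_abs_sqrt_coeff by (subst summable_Suc_iff)
  qed
  also have "\<dots> \<le> 1" by (rule suminf_abs_sqrt_coeff)
  finally show ?thesis .
qed

lemma sqrt_one_minus_commute:
  assumes "x * T = T * x"
  shows "x * sqrt_one_minus T = sqrt_one_minus T * x"
proof -
  have p: "x * T ^ n = T ^ n * x" for n
    by (induction n) (simp_all add: assms, metis assms mult.assoc)
  show ?thesis unfolding sqrt_one_minus_def
    by (simp add: p suminf_mult[OF summable_sqrt_series, symmetric]
        suminf_mult2[OF summable_sqrt_series])
qed

lemma sqrt_one_minus_self_adj:
  assumes "self_adj T"
  shows "self_adj (sqrt_one_minus T)"
  unfolding sqrt_one_minus_def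
  by (simp add: bounded_linear.suminf[OF bounded_linear_adj summable_sqrt_series] adj_simps assms)

end

subsection \<open>Positive elements\<close>

text \<open>In U = K + iR the cross terms of \<open>adj U * U\<close> cancel by commutation, so U
  has norm c by the C*-identity; K and R are averages of U and its adjoint up to a unimodular
  scalar. This replaces a spectral argument for K^2 + R^2 = c^2.\<close>

lemma commuting_parts_norm_le:
  fixes K R :: "'a::cstar_algebra"
  assumes "self_adj K" "self_adj R" "K * R = R * K" "K * K + R * R = of_real (c\<^sup>2)" "c \<ge> 0"
  shows "norm K \<le> c" "norm R \<le> c"
proof -
  define U where "U = K + cscale \<i> R"
  have aU: "adj U = K - cscale \<i> R"
    by (simp add: U_def adj_simps adj_cscale assms cscale_neg)
  have "adj U * U = K * K + R * R"
    unfolding aU unfolding U_def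
    by (simp add: algebra_simps cscale_mult_left cscale_mult_right cscale_ii cscale_add_right cscale_diff
        assms(3))
  then have n: "norm U = c" "norm (adj U) = c"
    using norm_unitary[of U c] assms by (simp_all add: norm_adj)
  have "2 *\<^sub>R K = U + adj U" by (simp add: aU scaleR_2) (simp add: U_def)
  then have "norm (2 *\<^sub>R K) \<le> c + c" using norm_triangle_ineq[of U "adj U"] n by simp
  then show "norm K \<le> c" by simp
  have "cscale \<i> (2 *\<^sub>R R) = U - adj U" by (simp add: aU scaleR_2 cscale_add_right) (simp add: U_def)
  then have "norm (cscale \<i> (2 *\<^sub>R R)) \<le> c + c" using norm_triangle_ineq4[of U "adj U"] n by simp
  then show "norm R \<le> c" by (simp add: norm_cscale)
qed

text \<open>The series gives a root R of 1 - K^2 that commutes with K, so K^2 + R^2 = 1 bounds R,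
  and with it R^2.\<close>

lemma norm_one_minus_square:
  fixes K :: "'a::cstar_algebra"
  assumes "self_adj K" "norm K \<le> 1"
  shows "norm (1 - K * K) \<le> 1"
proof -
  have T: "norm (K * K) \<le> 1" using assms by (simp add: norm_square_self_adj power_le_one)
  define R where "R = sqrt_one_minus (K * K)"
  have sR: "self_adj R" unfolding R_def
    by (rule sqrt_one_minus_self_adj[OF T]) (simp add: adj_simps assms)
  have "K * R = R * K" unfolding R_def
    by (rule sqrt_one_minus_commute[OF T]) (simp add: mult.assoc)
  moreover have RR: "R * R = 1 - K * K" unfolding R_def by (rule sqrt_one_minus_square[OF T])
  ultimately have "norm R \<le> 1"
    using commuting_parts_norm_le(2)[of K R 1] assms sR by simp
  then have "norm (R * R) \<le> 1" using sR by (simp add: norm_square_self_adj power_le_one)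
  then show ?thesis by (simp add: RR)
qed

text \<open>A norm description of the positive cone, from which closure under addition and limits is
immediate; it is identified with \<^const>\<open>cs_positive\<close> in \<open>cs_positive_iff_npos\<close>.\<close>

definition npos :: "'a::cstar_algebra \<Rightarrow> bool" where
  "npos A \<longleftrightarrow> self_adj A \<and> (\<exists>c. norm (of_real c - A) \<le> c)"

lemma nposI: "self_adj A \<Longrightarrow> norm (of_real c - A) \<le> c \<Longrightarrow> npos A"
  unfolding npos_def by blast

lemma npos_self_adj: "npos A \<Longrightarrow> self_adj A"
  by (simp add: npos_def)

lemma npos_square:
  fixes K :: "'a::cstar_algebra"
  assumes "self_adj K"
  shows "norm (of_real ((norm K)\<^sup>2) - K * K) \<le> (norm K)\<^sup>2" "npos (K * K)"
proof -
  show n: "norm (of_real ((norm K)\<^sup>2) - K * K) \<le> (norm K)\<^sup>2"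
  proof (cases "K = 0")
    case False
    define r where "r = norm K"
    have r: "r > 0" using False by (simp add: r_def)
    define k where "k = (1/r) *\<^sub>R K"
    have "norm (1 - k * k) \<le> 1"
      by (rule norm_one_minus_square) (use r in \<open>simp_all add: k_def adj_simps assms, simp add: r_def\<close>)
    moreover have "of_real (r\<^sup>2) - K * K = r\<^sup>2 *\<^sub>R (1 - k * k)"
      using r by (simp add: k_def algebra_simps power2_eq_square of_real_def)
    ultimately show ?thesis using r by (simp add: mult_left_le flip: r_def)
  qed simp
  show "npos (K * K)" by (rule nposI[OF _ n]) (simp add: adj_simps assms)
qed

text \<open>Writing A = c (1 - T) turns the norm condition into norm T \<le> 1, where the series
  applies. The last conclusion is the substitute for functional calculus: the root commutes with
  everything that commutes with A.\<close>

lemma npos_root: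
  fixes A :: "'a::cstar_algebra"
  assumes "npos A"
  obtains K where "npos K" "self_adj K" "K * K = A" "\<And>x. x * A = A * x \<Longrightarrow> x * K = K * x"
proof -
  from assms obtain c where sA: "self_adj A" and c: "norm (of_real c - A) \<le> c"
    unfolding npos_def by auto
  have c0: "c \<ge> 0" using c norm_ge_zero order_trans by blast
  show ?thesis
  proof (cases "c = 0")
    case True
    then have "A = 0" using c by simp
    then show ?thesis using that[of 0] npos_square(2)[of "0::'a"] by (simp add: adj_zero)
  next
    case False
    with c0 have c0: "c > 0" by simp
    define T where "T = 1 - (1/c) *\<^sub>R A"
    have "of_real c - A = c *\<^sub>R T" using c0 by (simp add: T_def algebra_simps of_real_def)
    then have T: "norm T \<le> 1" using c c0 by simp
    define K where "K = sqrt c *\<^sub>R sqrt_one_minus T"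
    have sT: "self_adj T" by (simp add: T_def adj_simps sA)
    have sK: "self_adj K" by (simp add: K_def adj_simps sqrt_one_minus_self_adj[OF T sT])
    have "of_real (sqrt c) - K = sqrt c *\<^sub>R (1 - sqrt_one_minus T)"
      by (simp add: K_def algebra_simps of_real_def)
    then have "norm (of_real (sqrt c) - K) \<le> sqrt c"
      using norm_one_minus_sqrt[OF T] c0 by (simp add: mult_left_le)
    then have nK: "npos K" using sK unfolding npos_def by auto
    have "K * K = c *\<^sub>R (sqrt_one_minus T * sqrt_one_minus T)" using c0 by (simp add: K_def)
    then have KK: "K * K = A" using c0 by (simp only: sqrt_one_minus_square[OF T]) (simp add: T_def)
    have com: "x * K = K * x" if "x * A = A * x" for x
    proof -
      have "x * T = T * x" by (simp add: T_def algebra_simps that)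
      then show ?thesis by (simp add: K_def sqrt_one_minus_commute[OF T])
    qed
    show ?thesis using that[OF nK sK KK com] .
  qed
qed

text \<open>The existential radius can always be taken to be the norm, because A is the square of a
  self-adjoint element. With this canonical radius, sums and limits are handled by the triangle
  inequality and continuity.\<close>

lemma npos_norm:
  fixes A :: "'a::cstar_algebra"
  assumes "npos A"
  shows "norm (of_real (norm A) - A) \<le> norm A"
  by (metis assms npos_root npos_square(1) norm_square_self_adj)

lemma npos_zero: "npos (0::'a::cstar_algebra)"
  using npos_square(2)[of "0::'a"] by (simp add: adj_zero)

lemma npos_add:
  fixes A B :: "'a::cstar_algebra"
  assumes "npos A" "npos B"
  shows "npos (A + B)"
proof -
  have "norm (of_real (norm A + norm B) - (A + B)) \<le> norm (of_real (norm A) - A) + norm (of_real (norm B) - B)"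
    using norm_triangle_ineq[of "of_real (norm A) - A" "of_real (norm B) - B"] by (simp add: algebra_simps)
  then have "norm (of_real (norm A + norm B) - (A + B)) \<le> norm A + norm B"
    using npos_norm[OF assms(1)] npos_norm[OF assms(2)] by linarith
  then show ?thesis by (rule nposI[rotated]) (simp add: adj_simps npos_self_adj assms)
qed

lemma npos_scaleR:
  fixes A :: "'a::cstar_algebra"
  assumes "npos A" "r \<ge> 0"
  shows "npos (r *\<^sub>R A)"
proof -
  have "norm (of_real (r * norm A) - r *\<^sub>R A) = r * norm (of_real (norm A) - A)"
  proof -
    have "of_real (r * norm A) - r *\<^sub>R A = r *\<^sub>R (of_real (norm A) - A)"
      by (simp add: algebra_simps of_real_def)
    then show ?thesis using assms(2) by simp
  qed
  also have "\<dots> \<le> r * norm A" using npos_norm[OF assms(1)] assms(2) by (simp add: mult_left_mono)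
  finally show ?thesis by (rule nposI[rotated]) (simp add: adj_simps npos_self_adj assms)
qed

lemma npos_one: "npos (1::'a::cstar_algebra)"
  using npos_square(2)[of "1::'a"] by (simp add: adj_simps)

lemma npos_of_real: "r \<ge> 0 \<Longrightarrow> npos (of_real r :: 'a::cstar_algebra)"
  unfolding of_real_def by (intro npos_scaleR npos_one)

lemma npos_of_real_iff: "npos (of_real r :: 'a::cstar_algebra) \<longleftrightarrow> r \<ge> 0"
proof
  assume "npos (of_real r :: 'a)"
  then obtain c where "norm (of_real c - of_real r :: 'a) \<le> c" unfolding npos_def by auto
  then have "\<bar>c - r\<bar> \<le> c" by (metis norm_of_real of_real_diff)
  then show "r \<ge> 0" by linarith
qed (rule npos_of_real)

lemma npos_norm_minus:
  fixes K :: "'a::cstar_algebra"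
  assumes "self_adj K"
  shows "npos (of_real (norm K) - K)"
  unfolding npos_def using assms by (intro conjI exI[of _ "norm K"]) (simp_all add: adj_simps)

lemma npos_limit:
  fixes f :: "nat \<Rightarrow> 'a::cstar_algebra"
  assumes "f \<longlonglongrightarrow> A" "\<And>n. npos (f n)"
  shows "npos A"
proof -
  have "(\<lambda>n. adj (f n)) \<longlonglongrightarrow> adj A" by (rule bounded_linear.tendsto[OF bounded_linear_adj assms(1)])
  moreover have "(\<lambda>n. adj (f n)) = f" using assms(2) npos_self_adj by auto
  ultimately have "self_adj A" using assms(1) LIMSEQ_unique by metis
  moreover have "norm (of_real (norm A) - A) \<le> norm A"
  proof (rule LIMSEQ_le)
    show "(\<lambda>n. norm (of_real (norm (f n)) - f n)) \<longlonglongrightarrow> norm (of_real (norm A) - A)"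
      by (intro tendsto_intros assms)
    show "(\<lambda>n. norm (f n)) \<longlonglongrightarrow> norm A" by (intro tendsto_intros assms)
  qed (use npos_norm assms(2) in auto)
  ultimately show ?thesis unfolding npos_def by auto
qed

text \<open>The roots p and q commute as well, so the product is the square of the self-adjoint
  element pq.\<close>

lemma npos_commute_mult:
  fixes A B :: "'a::cstar_algebra"
  assumes "npos A" "npos B" "A * B = B * A"
  shows "npos (A * B)"
proof -
  obtain p where p: "self_adj p" "p * p = A" "\<And>x. x * A = A * x \<Longrightarrow> x * p = p * x"
    using npos_root[OF assms(1)] by metis
  obtain q where q: "self_adj q" "q * q = B" "\<And>x. x * B = B * x \<Longrightarrow> x * q = q * x"
    using npos_root[OF assms(2)] by metis
  have "p * q = q * p" using p(3) q(3) assms(3) by metis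
  then have "A * B = (p * q) * (p * q)" by (metis p(2) q(2) mult.assoc)
  moreover have "self_adj (p * q)" using p(1) q(1) \<open>p * q = q * p\<close> by (simp add: adj_mult)
  ultimately show ?thesis using npos_square(2) by metis
qed

text \<open>The product (c - K)(c + K) = c^2 - K^2 is positive; its root m commutes with K, and K^2
  + m^2 = c^2 bounds K.\<close>

lemma norm_le_npos:
  fixes K :: "'a::cstar_algebra"
  assumes "self_adj K" "npos (of_real c - K)" "npos (of_real c + K)"
  shows "norm K \<le> c"
proof -
  have "(x - K) + (x + K) = x + x" for x :: 'a by simp
  then have "npos (of_real (c + c) :: 'a)" using npos_add[OF assms(2,3)] by (simp only: of_real_add)
  then have c: "c \<ge> 0" by (simp only: npos_of_real_iff)
  have com: "of_real c * K = K * of_real c" by (simp flip: scaleR_conv_of_real) (simp add: of_real_def)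
  have e: "(of_real c - K) * (of_real c + K) = of_real (c\<^sup>2) - K * K"
    by (simp add: algebra_simps com power2_eq_square)
  have "npos (of_real (c\<^sup>2) - K * K)"
    using npos_commute_mult[OF assms(2,3)] e com by (simp add: algebra_simps)
  then obtain m where m: "self_adj m" "m * m = of_real (c\<^sup>2) - K * K"
      "\<And>x. x * (of_real (c\<^sup>2) - K * K) = (of_real (c\<^sup>2) - K * K) * x \<Longrightarrow> x * m = m * x"
    using npos_root by metis
  have "K * m = m * K"
    by (rule m(3)) (simp add: algebra_simps flip: scaleR_conv_of_real, simp add: of_real_def)
  then show ?thesis using commuting_parts_norm_le(1)[of K m c] assms(1) m(1,2) c by simp
qed

lemma npos_antisym:
  fixes A :: "'a::cstar_algebra"
  assumes "npos A" "npos (- A)"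
  shows "A = 0"
  using norm_le_npos[of A 0] assms npos_self_adj by auto

lemma self_adj_cube_zero:
  fixes f :: "'a::cstar_algebra"
  assumes "self_adj f" "f * f * f = 0"
  shows "f = 0"
proof -
  have "(f * f) * (f * f) = 0" using assms(2) by (metis mult.assoc mult_zero_left)
  moreover have "self_adj (f * f)" using assms by (simp add: adj_mult)
  ultimately have "(norm (f * f))\<^sup>2 = 0" using norm_square_self_adj by (metis norm_zero)
  then show ?thesis using norm_square_self_adj[OF assms(1)] by simp
qed

text \<open>The element \<open>f\<close> below is the positive part \<open>(\<bar>K\<bar> + K) / 2\<close>; its positivity is never needed.\<close>

lemma positive_part:
  fixes K :: "'a::cstar_algebra"
  assumes "self_adj K"
  obtains f where "self_adj f" "f * f = K * f" "f * K = K * f" "npos (f * K * f)"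
    "f = 0 \<Longrightarrow> npos (- K)"
proof -
  obtain P where P: "npos P" "self_adj P" "P * P = K * K" "\<And>x. x * (K * K) = K * K * x \<Longrightarrow> x * P = P * x"
    using npos_root[OF npos_square(2)[OF assms]] by metis
  obtain p where p: "self_adj p" "p * p = P" "\<And>x. x * P = P * x \<Longrightarrow> x * p = p * x"
    using npos_root[OF P(1)] by metis
  have KP: "K * P = P * K" by (rule P(4)) (simp add: mult.assoc)
  define f where "f = (1/2) *\<^sub>R (P + K)"
  have sf: "self_adj f" by (simp add: f_def adj_simps P assms)
  have "(P + K) * (P + K) = 2 *\<^sub>R (K * (P + K))" by (simp add: algebra_simps KP P(3) scaleR_2)
  then have ff: "f * f = K * f" by (simp add: f_def)
  have "(P + K) * (P + K) = 2 *\<^sub>R (P * (P + K))" by (simp add: algebra_simps KP P(3) scaleR_2)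
  then have ffP: "f * f = P * f" by (simp add: f_def)
  have fK: "f * K = K * f" by (simp add: f_def algebra_simps KP)
  have fP: "f * P = P * f" by (simp add: f_def algebra_simps KP)
  have fp: "f * p = p * f" by (rule p(3)) (rule fP)
  \<comment> \<open>Since f^2 = P f and p is a root of P commuting with f, the cube f^3 is the
    square of the self-adjoint element p f.\<close>
  have "f * K * f = f * (f * f)" by (simp add: ff mult.assoc)
  also have "\<dots> = f * (p * p * f)" by (simp add: ffP p(2))
  also have "\<dots> = (p * f) * (p * f)" by (metis fp mult.assoc)
  finally have "npos (f * K * f)"
    using npos_square(2)[of "p * f"] sf p(1) fp by (simp add: adj_mult)
  moreover have "npos (- K)" if "f = 0"
    using that P(1) by (simp add: f_def eq_neg_iff_add_eq_0)
      (metis P(1) add_eq_0_iff2 eq_neg_iff_add_eq_0)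
  ultimately show ?thesis using that sf ff fK by blast
qed

section \<open>Invertibility and lower bounds\<close>

lemma neumann_inverse:
  fixes T :: "'a::cstar_algebra"
  assumes "norm T < 1"
  shows "\<exists>B. (1 - T) * B = 1 \<and> B * (1 - T) = 1"
proof -
  have s: "summable (\<lambda>n. T ^ n)"
    by (rule summable_norm_cancel, rule summable_comparison_test'[of "\<lambda>n. norm T ^ n" 0])
       (use assms norm_power_ineq in \<open>auto intro: summable_geometric\<close>)
  define B where "B = (\<Sum>n. T ^ n)"
  have "(\<Sum>n. T ^ Suc n) = B - 1" unfolding B_def using suminf_split_head[OF s] by simp
  moreover have "(\<Sum>n. T ^ Suc n) = T * B" unfolding B_def by (simp add: suminf_mult[OF s])
  moreover have "(\<Sum>n. T ^ Suc n) = B * T" unfolding B_def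
    by (simp add: suminf_mult2[OF s] power_commutes)
  ultimately show ?thesis by (intro exI[of _ B]) (simp add: algebra_simps)
qed

text \<open>With M = A - \<delta> and c = norm M, A equals (c + \<delta>)(1 - T) where norm T \<le>
  c / (c + \<delta>) < 1, so the Neumann series applies.\<close>

lemma npos_invertible:
  fixes A :: "'a::cstar_algebra"
  assumes "npos (A - of_real \<delta>)" "\<delta> > 0"
  shows "cs_invertible A"
proof -
  define M where "M = A - of_real \<delta>"
  define c where "c = norm M"
  have M: "norm (of_real c - M) \<le> c" using npos_norm assms(1) unfolding M_def c_def by blast
  define T where "T = (1/(c+\<delta>)) *\<^sub>R (of_real c - M)"
  have c: "c \<ge> 0" by (simp add: c_def)
  have "norm T \<le> c / (c + \<delta>)" using M c assms(2) by (simp add: T_def divide_right_mono)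
  also have "\<dots> < 1" using c assms(2) by simp
  finally obtain B where B: "(1 - T) * B = 1" "B * (1 - T) = 1" using neumann_inverse by metis
  have "(c + \<delta>) *\<^sub>R (1 - T) = of_real (c + \<delta>) - (of_real c - M)"
    using c assms(2) by (simp add: T_def scaleR_diff_right of_real_def)
  then have A: "(c + \<delta>) *\<^sub>R (1 - T) = A" by (simp add: M_def)
  then have "A * ((1/(c+\<delta>)) *\<^sub>R B) = 1" "((1/(c+\<delta>)) *\<^sub>R B) * A = 1"
    using B c assms(2) by (auto simp flip: A)
  then show ?thesis unfolding cs_invertible_def by blast
qed

lemma inverse_commute:
  fixes A :: "'a::cstar_algebra"
  assumes "A * B = 1" "B * A = 1" "x * A = A * x"
  shows "x * B = B * x"
  by (metis assms mult.assoc mult_1_left mult_1_right)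

text \<open>If k is the root of A, then B = B A B is the square of the self-adjoint element k
  B.\<close>

lemma npos_inverse:
  fixes A :: "'a::cstar_algebra"
  assumes "npos A" "A * B = 1" "B * A = 1"
  shows "npos B"
proof -
  have sA: "self_adj A" using assms(1) by (rule npos_self_adj)
  have "adj B * A = 1" by (metis adj_mult adj_one assms(2) sA)
  then have sB: "self_adj B" by (metis assms(2) mult.assoc mult_1_left mult_1_right)
  obtain k where k: "self_adj k" "k * k = A" "\<And>x. x * A = A * x \<Longrightarrow> x * k = k * x"
    using npos_root[OF assms(1)] by metis
  have kB: "B * k = k * B" by (rule k(3)) (simp add: assms)
  then have "(k * B) * (k * B) = B"
    by (metis (no_types, lifting) assms(2,3) k(2) mult.assoc mult_1_left mult_1_right)
  moreover have "self_adj (k * B)" using k(1) sB kB by (simp add: adj_mult)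
  ultimately show ?thesis using npos_square(2) by metis
qed

lemma npos_lower_bound:
  fixes A :: "'a::cstar_algebra"
  assumes "npos A" "cs_invertible A"
  obtains \<delta> where "\<delta> > 0" "npos (A - of_real \<delta>)"
proof -
  obtain B where B: "A * B = 1" "B * A = 1" using assms(2) unfolding cs_invertible_def by auto
  have nB: "npos B" using npos_inverse[OF assms(1) B] .
  define M where "M = norm B"
  have M: "M > 0" using B by (auto simp: M_def)
  \<comment> \<open>Because A B = 1, this product is M A - 1; dividing by M yields the lower bound
    1/M for A.\<close>
  have "npos (A * (of_real M - B))"
  proof (rule npos_commute_mult[OF assms(1)])
    show "npos (of_real M - B)" unfolding M_def by (rule npos_norm_minus) (rule npos_self_adj[OF nB])
    show "A * (of_real M - B) = (of_real M - B) * A"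
      by (simp add: algebra_simps B flip: scaleR_conv_of_real) (simp add: of_real_def)
  qed
  then have "npos ((1/M) *\<^sub>R (A * (of_real M - B)))" using M by (intro npos_scaleR) auto
  moreover have "(1/M) *\<^sub>R (A * (of_real M - B)) = A - of_real (1/M)"
    using M by (simp add: algebra_simps B of_real_def)
  ultimately show ?thesis using that[of "1/M"] M by simp
qed

text \<open>If \<open>N = - Y\<^sup>* Y \<ge> 0\<close> then \<open>Y Y\<^sup>* \<ge> 0\<close>, so \<open>1 + t Y Y\<^sup>*\<close>, hence also \<open>1 - t N\<close>, is invertible
for all \<open>t \<ge> 0\<close>, which is impossible at \<open>t = 1 / norm N\<close>.\<close>

lemma npos_minus_adj_mult:
  fixes Y :: "'a::cstar_algebra"
  assumes "npos (- (adj Y * Y))"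
  shows "Y = 0"
proof (rule ccontr)
  assume Y: "Y \<noteq> 0"
  define N where "N = - (adj Y * Y)"
  define G where "G = Y * adj Y"
  define a b where "a = re_part Y" and "b = im_part Y"
  have sa: "self_adj a" "self_adj b" by (simp_all add: a_def b_def self_adj_re_part self_adj_im_part)
  have Yab: "Y = a + cscale \<i> b" unfolding a_def b_def by (rule re_im_part)
  then have aY: "adj Y = a - cscale \<i> b" by (simp add: adj_simps adj_cscale sa cscale_neg)
  \<comment> \<open>This expresses the product in the other order, \<open>Y * adj Y\<close>, as a
    sum of squares and the positive element N.\<close>
  have "adj Y * Y + Y * adj Y = 2 *\<^sub>R (a * a) + 2 *\<^sub>R (b * b)"
    unfolding aY unfolding Yab
    by (simp add: algebra_simps cscale_mult_left cscale_mult_right cscale_ii cscale_add_right cscale_diff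
        scaleR_2)
  then have G: "G = 2 *\<^sub>R (a * a) + 2 *\<^sub>R (b * b) + N" by (simp add: G_def N_def algebra_simps)
  have nN: "npos N" using assms by (simp add: N_def)
  have nG: "npos G" unfolding G by (intro npos_add npos_scaleR npos_square nN sa) auto
  define c where "c = norm N"
  have "norm (adj Y * Y) \<noteq> 0" using Y by (simp add: cstar_identity)
  then have c: "c > 0" by (simp add: c_def N_def)
  define t where "t = 1/c"
  have t: "t > 0" using c by (simp add: t_def)
  have "npos ((1 + t *\<^sub>R G) - of_real 1)" using nG t by (simp add: npos_scaleR)
  then have "cs_invertible (1 + t *\<^sub>R G)" by (rule npos_invertible) simp
  then obtain R where R: "(1 + t *\<^sub>R G) * R = 1" "R * (1 + t *\<^sub>R G) = 1"
    unfolding cs_invertible_def by auto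
  \<comment> \<open>The push-through formula for the inverse of
    \<open>1 + t *\<^sub>R (adj Y * Y)\<close>, which is \<open>1 - t *\<^sub>R N\<close>, from the
    inverse R of \<open>1 + t *\<^sub>R (Y * adj Y)\<close>.\<close>
  define Q where "Q = 1 - t *\<^sub>R (adj Y * R * Y)"
  have "(1 - t *\<^sub>R N) * Q = 1 + t *\<^sub>R (adj Y * Y) - t *\<^sub>R (adj Y * ((1 + t *\<^sub>R G) * R) * Y)"
    by (simp add: Q_def N_def G_def algebra_simps)
  then have 1: "(1 - t *\<^sub>R N) * Q = 1" by (simp add: R)
  have "Q * (1 - t *\<^sub>R N) = 1 + t *\<^sub>R (adj Y * Y) - t *\<^sub>R (adj Y * (R * (1 + t *\<^sub>R G)) * Y)"
    by (simp add: Q_def N_def G_def algebra_simps)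
  then have 2: "Q * (1 - t *\<^sub>R N) = 1" by (simp add: R)
  have cN: "c *\<^sub>R (1 - t *\<^sub>R N) = of_real c - N" using c by (simp add: t_def algebra_simps of_real_def)
  have "(of_real c - N) * (t *\<^sub>R Q) = 1" "(t *\<^sub>R Q) * (of_real c - N) = 1"
    using 1 2 c by (simp_all add: t_def flip: cN)
  then have "cs_invertible (of_real c - N)" unfolding cs_invertible_def by blast
  moreover have "npos (of_real c - N)" unfolding c_def by (rule npos_norm_minus[OF npos_self_adj[OF nN]])
  \<comment> \<open>Invertibility of c - N leaves a gap, N \<le> c - \<delta>, so norm N would be
    smaller than c.\<close>
  ultimately obtain \<delta> where \<delta>: "\<delta> > 0" "npos (of_real c - N - of_real \<delta>)" using npos_lower_bound by metis
  then have 3: "npos (of_real (c - \<delta>) - N)" by (simp add: algebra_simps)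
  have "npos (of_real (c - \<delta>) :: 'a)" using npos_add[OF 3 nN] by simp
  then have "npos (of_real (c - \<delta>) + N)" by (rule npos_add[OF _ nN])
  then have "norm N \<le> c - \<delta>" using norm_le_npos[OF npos_self_adj[OF nN] 3] by simp
  then show False using \<delta> by (simp add: c_def)
qed

text \<open>Compress h = \<open>adj X * X\<close> by the negative part f of h: then Xf is an element
  whose \<open>adj (X * f) * (X * f)\<close> is negative, so Xf = 0 by the preceding lemma. Then hf
  = 0, which makes f nilpotent and hence zero.\<close>

lemma npos_adj_mult: "npos (adj X * X)"
proof -
  define h where "h = adj X * X"
  have sh: "self_adj (- h)" by (simp add: h_def adj_simps)
  obtain f where f: "self_adj f" "f * f = - h * f" "f * - h = - h * f" "npos (f * - h * f)"
    "f = 0 \<Longrightarrow> npos (- (- h))" using positive_part[OF sh] by metis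
  have "- (adj (X * f) * (X * f)) = f * - h * f"
    by (simp add: adj_mult f(1) h_def mult.assoc)
  then have "X * f = 0" using npos_minus_adj_mult f(4) by metis
  then have "h * f = 0" by (simp add: h_def mult.assoc)
  then have "f * f * f = 0" using f(2) by simp
  then have "f = 0" using self_adj_cube_zero f(1) by blast
  then show ?thesis using f(5) by (simp add: h_def)
qed

lemma cs_positive_iff_npos: "cs_positive A \<longleftrightarrow> npos A"
proof
  assume "npos A"
  then show "cs_positive A" unfolding cs_positive_def by (metis npos_root)
qed (auto simp: cs_positive_def npos_adj_mult)

subsection \<open>Order, inverses and square roots\<close>

lemma npos_eq_cs_positive: "npos = cs_positive"
  by (rule ext) (simp add: cs_positive_iff_npos)

lemmas pos_self_adj = npos_self_adj[unfolded npos_eq_cs_positive]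
  and pos_zero = npos_zero[unfolded npos_eq_cs_positive]
  and pos_add = npos_add[unfolded npos_eq_cs_positive]
  and pos_scaleR = npos_scaleR[unfolded npos_eq_cs_positive]
  and pos_one = npos_one[unfolded npos_eq_cs_positive]
  and pos_of_real = npos_of_real[unfolded npos_eq_cs_positive]
  and pos_limit = npos_limit[unfolded npos_eq_cs_positive]
  and pos_commute_mult = npos_commute_mult[unfolded npos_eq_cs_positive]
  and pos_antisym = npos_antisym[unfolded npos_eq_cs_positive]
  and pos_square = npos_square(2)[unfolded npos_eq_cs_positive]
  and pos_root = npos_root[unfolded npos_eq_cs_positive]
  and pos_norm_minus = npos_norm_minus[unfolded npos_eq_cs_positive]
  and norm_le_pos = norm_le_npos[unfolded npos_eq_cs_positive]
  and pos_part = positive_part[unfolded npos_eq_cs_positive]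

lemma pos_conj: "cs_positive A \<Longrightarrow> cs_positive (adj X * A * X)"
  unfolding cs_positive_def by (metis adj_mult mult.assoc)

lemma pos_conj_self_adj: "cs_positive A \<Longrightarrow> self_adj X \<Longrightarrow> cs_positive (X * A * X)"
  using pos_conj[of A X] by simp

definition cle :: "'a::cstar_algebra \<Rightarrow> 'a \<Rightarrow> bool" (infix "\<preceq>" 50) where
  "A \<preceq> B \<longleftrightarrow> cs_positive (B - A)"

lemma cle_refl: "A \<preceq> A"
  by (simp add: cle_def pos_zero)

lemma cle_trans [trans]: "A \<preceq> B \<Longrightarrow> B \<preceq> C \<Longrightarrow> A \<preceq> C"
  unfolding cle_def using pos_add[of "B - A" "C - B"] by simp

lemma cle_antisym: "A \<preceq> B \<Longrightarrow> B \<preceq> A \<Longrightarrow> A = B"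
  unfolding cle_def using pos_antisym[of "B - A"] by simp

lemma cle_add: "A \<preceq> B \<Longrightarrow> C \<preceq> D \<Longrightarrow> A + C \<preceq> B + D"
  unfolding cle_def using pos_add[of "B - A" "D - C"] by (simp add: algebra_simps)

lemma cle_scaleR: "A \<preceq> B \<Longrightarrow> r \<ge> 0 \<Longrightarrow> r *\<^sub>R A \<preceq> r *\<^sub>R B"
  unfolding cle_def using pos_scaleR[of "B - A" r] by (simp add: algebra_simps)

lemma cle_conj: "A \<preceq> B \<Longrightarrow> self_adj X \<Longrightarrow> X * A * X \<preceq> X * B * X"
  unfolding cle_def using pos_conj_self_adj[of "B - A" X] by (simp add: algebra_simps)

lemma pos_cle: "cs_positive A \<Longrightarrow> A \<preceq> B \<Longrightarrow> cs_positive B"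
  unfolding cle_def using pos_add[of A "B - A"] by simp

lemma cle_norm: "self_adj K \<Longrightarrow> K \<preceq> of_real (norm K)"
  unfolding cle_def by (rule pos_norm_minus)

lemma minus_norm_cle: "self_adj K \<Longrightarrow> - of_real (norm K) \<preceq> K"
  unfolding cle_def using pos_norm_minus[of "- K"] by (simp add: adj_simps add.commute)

lemma of_real_cle: "r \<le> s \<Longrightarrow> of_real r \<preceq> of_real s"
  unfolding cle_def using pos_of_real[of "s - r"] by simp

lemma norm_le_cle: "cs_positive A \<Longrightarrow> A \<preceq> of_real c \<Longrightarrow> norm A \<le> c"
proof -
  assume a: "cs_positive A" "A \<preceq> of_real c"
  then have "cs_positive (of_real c :: 'a)" by (rule pos_cle)
  then show "norm A \<le> c"
    using a pos_self_adj[OF a(1)] by (intro norm_le_pos) (auto simp: cle_def intro: pos_add)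
qed

section \<open>Inverses and the cone of positive invertible elements\<close>

lemma cs_inv_eqI: "A * B = 1 \<Longrightarrow> B * A = 1 \<Longrightarrow> cs_inv A = (B::'a::cstar_algebra)"
  unfolding cs_inv_def
proof (rule the_equality)
  assume B: "A * B = 1" "B * A = 1"
  show "C = B" if C: "A * C = 1 \<and> C * A = 1" for C
  proof -
    have "C = B * A * C" by (simp add: B)
    also have "\<dots> = B" using C by (simp add: mult.assoc)
    finally show ?thesis .
  qed
qed blast

lemma cs_inv_right: "cs_invertible A \<Longrightarrow> A * cs_inv A = 1"
  and cs_inv_left: "cs_invertible A \<Longrightarrow> cs_inv A * A = 1"
  unfolding cs_invertible_def using cs_inv_eqI by metis+

lemma pos_invD:
  assumes "A \<in> pos_inv"
  shows "cs_positive A" "cs_invertible A" "self_adj A" "A * cs_inv A = 1" "cs_inv A * A = 1"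
  using assms cs_inv_right cs_inv_left pos_self_adj unfolding pos_inv_def by auto

lemma pos_inv_assoc:
  assumes "A \<in> pos_inv"
  shows "A * (cs_inv A * x) = x" "cs_inv A * (A * x) = x"
  using pos_invD(4,5)[OF assms] by (simp_all flip: mult.assoc)

lemma pos_inv_iff: "A \<in> pos_inv \<longleftrightarrow> (\<exists>\<delta>>0. of_real \<delta> \<preceq> A)"
proof
  assume "A \<in> pos_inv"
  then show "\<exists>\<delta>>0. of_real \<delta> \<preceq> A"
    unfolding pos_inv_def cle_def using npos_lower_bound by (auto simp: npos_eq_cs_positive)
next
  assume "\<exists>\<delta>>0. of_real \<delta> \<preceq> A"
  then obtain \<delta> where d: "\<delta> > 0" "of_real \<delta> \<preceq> A" by auto
  have "cs_invertible A"
    using npos_invertible[of A \<delta>] d by (simp add: cle_def npos_eq_cs_positive)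
  moreover have "cs_positive A" using pos_cle[OF pos_of_real d(2)] d(1) by simp
  ultimately show "A \<in> pos_inv" by (simp add: pos_inv_def)
qed

lemma pos_inv_cle: "A \<in> pos_inv \<Longrightarrow> A \<preceq> B \<Longrightarrow> B \<in> pos_inv"
  unfolding pos_inv_iff using cle_trans by blast

lemma pos_inv_add_pos: "A \<in> pos_inv \<Longrightarrow> cs_positive B \<Longrightarrow> A + B \<in> pos_inv"
  by (erule pos_inv_cle) (simp add: cle_def)

lemma pos_inv_add: "A \<in> pos_inv \<Longrightarrow> B \<in> pos_inv \<Longrightarrow> A + B \<in> pos_inv"
  by (simp add: pos_inv_add_pos pos_invD)

lemma pos_inv_of_real: "r > 0 \<Longrightarrow> of_real r \<in> pos_inv"
  unfolding pos_inv_iff using cle_refl by blast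

lemma pos_inv_one: "1 \<in> pos_inv"
  using pos_inv_of_real[of 1] by simp

lemma pos_inv_scaleR: "A \<in> pos_inv \<Longrightarrow> r > 0 \<Longrightarrow> r *\<^sub>R A \<in> pos_inv"
proof -
  assume "A \<in> pos_inv" "r > 0"
  then obtain \<delta> where d: "\<delta> > 0" "of_real \<delta> \<preceq> A" unfolding pos_inv_iff by auto
  then have "of_real (r * \<delta>) \<preceq> r *\<^sub>R A"
    using cle_scaleR[OF d(2), of r] \<open>r > 0\<close> by (simp add: scaleR_conv_of_real)
  then show "r *\<^sub>R A \<in> pos_inv" unfolding pos_inv_iff using d(1) \<open>r > 0\<close> by (intro exI[of _ "r * \<delta>"]) auto
qed

lemma pos_inv_cs_inv: "A \<in> pos_inv \<Longrightarrow> cs_inv A \<in> pos_inv"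
  using npos_inverse[of A "cs_inv A"] pos_invD[of A]
  by (auto simp: npos_eq_cs_positive pos_inv_def cs_invertible_def)

lemma cs_inv_cs_inv: "A \<in> pos_inv \<Longrightarrow> cs_inv (cs_inv A) = A"
  by (rule cs_inv_eqI) (simp_all add: pos_invD)

lemma cs_inv_of_real: "r > 0 \<Longrightarrow> cs_inv (of_real r) = of_real (1 / r)"
  by (rule cs_inv_eqI) (simp_all flip: of_real_mult)

lemma cs_inv_scaleR: "A \<in> pos_inv \<Longrightarrow> r > 0 \<Longrightarrow> cs_inv (r *\<^sub>R A) = (1/r) *\<^sub>R cs_inv A"
  by (rule cs_inv_eqI) (simp_all add: pos_invD)

lemma cs_inv_commute: "A \<in> pos_inv \<Longrightarrow> x * A = A * x \<Longrightarrow> x * cs_inv A = cs_inv A * x"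
  using inverse_commute pos_invD(4,5) by metis

lemma cs_inv_mult:
  assumes "cs_invertible A" "cs_invertible B"
  shows "cs_inv (A * B) = cs_inv B * cs_inv A" "cs_invertible (A * B)"
proof -
  have "B * (cs_inv B * x) = x" "cs_inv A * (A * x) = x" for x
    by (simp_all add: cs_inv_right cs_inv_left assms flip: mult.assoc)
  then have 1: "A * B * (cs_inv B * cs_inv A) = 1" "cs_inv B * cs_inv A * (A * B) = 1"
    by (simp_all add: mult.assoc cs_inv_right cs_inv_left assms)
  then show "cs_inv (A * B) = cs_inv B * cs_inv A" by (rule cs_inv_eqI)
  show "cs_invertible (A * B)" using 1 unfolding cs_invertible_def by blast
qed

lemma pos_inv_commute_mult:
  assumes "A \<in> pos_inv" "B \<in> pos_inv" "A * B = B * A"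
  shows "A * B \<in> pos_inv"
  using assms cs_inv_mult(2)[of A B] pos_commute_mult[of A B] unfolding pos_inv_def by blast

lemma pos_inv_conj:
  assumes "A \<in> pos_inv" "x \<in> pos_inv"
  shows "x * A * x \<in> pos_inv" "cs_inv (x * A * x) = cs_inv x * cs_inv A * cs_inv x"
proof -
  note i = pos_invD(2)[OF assms(1)] pos_invD(2)[OF assms(2)]
  show "x * A * x \<in> pos_inv"
    using cs_inv_mult(2)[OF cs_inv_mult(2)[OF i(2,1)] i(2)]
      pos_conj_self_adj[OF pos_invD(1)[OF assms(1)] pos_invD(3)[OF assms(2)]]
    by (simp add: pos_inv_def)
  show "cs_inv (x * A * x) = cs_inv x * cs_inv A * cs_inv x"
    using cs_inv_mult[OF i(2,1)] cs_inv_mult(1)[OF cs_inv_mult(2)[OF i(2,1)] i(2)] by (simp add: mult.assoc)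
qed

lemma pos_root_unique:
  fixes R S :: "'a::cstar_algebra"
  assumes "cs_positive R" "cs_positive S" "R * R = S * S"
  shows "R = S"
proof -
  obtain Q where Q: "cs_positive Q" "Q * Q = R * R" "\<And>x. x * (R * R) = R * R * x \<Longrightarrow> x * Q = Q * x"
    using pos_root[OF pos_square[OF pos_self_adj[OF assms(1)]]] by metis
  have unique: "P = Q" if P: "cs_positive P" "P * P = R * R" for P
  proof -
    have com: "P * Q = Q * P" by (rule Q(3)) (metis P(2) mult.assoc)
    define D where "D = P - Q"
    have sD: "self_adj D" by (simp add: D_def adj_simps pos_self_adj P(1) Q(1))
    have z: "D * (P + Q) = 0" using P(2) Q(2) com by (simp add: D_def algebra_simps)
    then have "D * P * D + D * Q * D = 0" by (simp flip: distrib_left distrib_right)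
    moreover have p: "cs_positive (D * P * D)" "cs_positive (D * Q * D)"
      using pos_conj_self_adj sD P(1) Q(1) by blast+
    ultimately have "D * P * D = 0"
      using pos_antisym[of "D * P * D"] by (metis add.commute eq_neg_iff_add_eq_0)
    moreover from this \<open>D * P * D + D * Q * D = 0\<close> have "D * Q * D = 0" by simp
    ultimately have "D * (P - Q) * D = 0" by (simp add: algebra_simps)
    then have "D = 0" using self_adj_cube_zero[OF sD] by (simp add: D_def)
    then show "P = Q" by (simp add: D_def)
  qed
  show ?thesis using unique[OF assms(1)] unique[OF assms(2)] assms(3) by simp
qed

lemma cs_sqrt_unique: "cs_positive R \<Longrightarrow> R * R = A \<Longrightarrow> cs_sqrt A = R"
  unfolding cs_sqrt_def using pos_root_unique by (intro the_equality) auto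

lemma cs_sqrt:
  assumes "cs_positive A"
  shows "cs_positive (cs_sqrt A)" "cs_sqrt A * cs_sqrt A = A"
    "x * A = A * x \<Longrightarrow> x * cs_sqrt A = cs_sqrt A * x"
proof -
  obtain K where K: "cs_positive K" "K * K = A" "\<And>x. x * A = A * x \<Longrightarrow> x * K = K * x"
    using pos_root[OF assms] by metis
  have e: "cs_sqrt A = K" using cs_sqrt_unique K(1,2) by blast
  show "cs_positive (cs_sqrt A)" "cs_sqrt A * cs_sqrt A = A" using K(1,2) e by simp_all
  show "x * cs_sqrt A = cs_sqrt A * x" if "x * A = A * x" unfolding e using that by (rule K(3))
qed

lemma pos_inv_cs_sqrt:
  assumes "A \<in> pos_inv"
  shows "cs_sqrt A \<in> pos_inv" "self_adj (cs_sqrt A)" "cs_sqrt A * cs_sqrt A = A"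
    "cs_inv A = cs_inv (cs_sqrt A) * cs_inv (cs_sqrt A)"
proof -
  note s = cs_sqrt[OF pos_invD(1)[OF assms]]
  have "cs_sqrt A * (cs_sqrt A * cs_inv A) = 1"
    using pos_invD(4)[OF assms] s(2) by (simp flip: mult.assoc)
  moreover have "cs_sqrt A * cs_inv A = cs_inv A * cs_sqrt A"
    by (rule cs_inv_commute[OF assms]) (metis s(2) mult.assoc)
  ultimately have "cs_invertible (cs_sqrt A)"
    unfolding cs_invertible_def using pos_invD(5)[OF assms] s(2)
    by (intro exI[of _ "cs_inv A * cs_sqrt A"]) (simp add: mult.assoc)
  then show p: "cs_sqrt A \<in> pos_inv" using s(1) by (simp add: pos_inv_def)
  show "self_adj (cs_sqrt A)" "cs_sqrt A * cs_sqrt A = A" using s(1,2) pos_self_adj by auto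
  show "cs_inv A = cs_inv (cs_sqrt A) * cs_inv (cs_sqrt A)"
    using cs_inv_mult(1) pos_invD(2)[OF p] s(2) by metis
qed

lemma cs_inv_one_cle:
  assumes "Z \<in> pos_inv" "Z \<preceq> 1"
  shows "1 \<preceq> cs_inv Z"
proof -
  have "cs_positive (cs_inv Z * (1 - Z))"
  proof (rule pos_commute_mult)
    show "cs_positive (cs_inv Z)" using pos_inv_cs_inv assms pos_invD by blast
    show "cs_positive (1 - Z)" using assms(2) by (simp add: cle_def)
    show "cs_inv Z * (1 - Z) = (1 - Z) * cs_inv Z" by (simp add: algebra_simps pos_invD assms)
  qed
  then show ?thesis by (simp add: cle_def algebra_simps pos_invD assms)
qed

text \<open>Conjugating by the inverse root of B reduces the claim to the case of an element below
  1, where everything commutes; conjugating once more undoes it.\<close>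

lemma cs_inv_antimono:
  assumes "A \<in> pos_inv" "A \<preceq> B"
  shows "cs_inv B \<preceq> cs_inv A"
proof -
  have B: "B \<in> pos_inv" using pos_inv_cle assms by blast
  define b where "b = cs_sqrt B"
  define c where "c = cs_inv b"
  have b: "b \<in> pos_inv" "self_adj b" "b * b = B" "cs_inv B = c * c"
    using pos_inv_cs_sqrt[OF B] by (simp_all add: b_def c_def)
  have c: "c \<in> pos_inv" "self_adj c" using pos_inv_cs_inv b(1) pos_invD by (auto simp: c_def)
  have cb: "c * b = 1" "b * c = 1" using pos_invD[OF b(1)] by (simp_all add: c_def)
  have cb': "c * (b * x) = x" "b * (c * x) = x" for x by (simp_all add: cb flip: mult.assoc)
  have "c * A * c \<preceq> c * B * c" using cle_conj[OF assms(2) c(2)] .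
  then have le: "c * A * c \<preceq> 1" by (simp add: cb cb' mult.assoc flip: b(3))
  have "1 \<preceq> cs_inv (c * A * c)" using cs_inv_one_cle[OF pos_inv_conj(1)[OF assms(1) c(1)] le] .
  also have "cs_inv (c * A * c) = b * cs_inv A * b"
    using pos_inv_conj(2)[OF assms(1) c(1)] cs_inv_cs_inv[OF b(1)] by (simp add: c_def)
  finally have "c * 1 * c \<preceq> c * (b * cs_inv A * b) * c" using cle_conj c(2) by blast
  then show ?thesis by (simp add: cb cb' mult.assoc b(4))
qed

lemma norm_cs_inv_le:
  assumes "of_real \<delta> \<preceq> A" "\<delta> > 0"
  shows "norm (cs_inv A) \<le> 1 / \<delta>"
proof (rule norm_le_cle)
  have "A \<in> pos_inv" using assms pos_inv_iff by blast
  then show "cs_positive (cs_inv A)" using pos_inv_cs_inv pos_invD by blast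
  show "cs_inv A \<preceq> of_real (1 / \<delta>)"
    using cs_inv_antimono[OF pos_inv_of_real[OF assms(2)] assms(1)] cs_inv_of_real[OF assms(2), where 'a='a] by simp
qed

lemma pos_inv_dominates:
  assumes "B \<in> pos_inv" "self_adj X"
  obtains s where "s > 0" "X \<preceq> s *\<^sub>R B"
proof -
  obtain d where d: "d > 0" "of_real d \<preceq> B" using assms(1) pos_inv_iff by blast
  define s where "s = (norm X + 1) / d"
  have s: "s > 0" using d(1) by (simp add: s_def add_nonneg_pos)
  have "X \<preceq> of_real (norm X)" by (rule cle_norm[OF assms(2)])
  also have "\<dots> \<preceq> of_real (s * d)" by (rule of_real_cle) (use d in \<open>simp add: s_def\<close>)
  also have "of_real (s * d) = s *\<^sub>R of_real d" by (simp add: scaleR_conv_of_real)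
  also have "\<dots> \<preceq> s *\<^sub>R B" by (rule cle_scaleR[OF d(2)]) (use s in simp)
  finally show ?thesis using that s by blast
qed

lemma pos_inv_add_norm: "self_adj X \<Longrightarrow> c > norm X \<Longrightarrow> X + of_real c \<in> pos_inv"
proof -
  assume "self_adj X" "c > norm X"
  then have "of_real (c - norm X) \<preceq> X + of_real c"
    using minus_norm_cle[of X] by (simp add: cle_def algebra_simps)
  then show ?thesis using pos_inv_iff \<open>c > norm X\<close> by (metis diff_gt_0_iff_gt)
qed

lemma pos_inv_perturb:
  fixes A :: "'a::cstar_algebra"
  assumes "A \<in> pos_inv" "self_adj G"
  shows "\<exists>\<delta>>0. \<forall>\<^sub>F t in at_right 0. of_real \<delta> \<preceq> A + t *\<^sub>R G"
proof -
  obtain d where d: "d > 0" "of_real d \<preceq> A" using assms(1) pos_inv_iff by blast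
  define m where "m = norm G + 1"
  have m: "m > 0" "norm G \<le> m" by (simp_all add: m_def add_nonneg_pos)
  define r where "r = d / (2 * m)"
  have r: "r > 0" using d m by (simp add: r_def)
  have "of_real (d / 2) \<preceq> A + t *\<^sub>R G" if t: "0 < t" "t < r" for t
  proof -
    have "t * norm G \<le> r * m" using t m by (intro mult_mono) auto
    also have "\<dots> = d / 2" using m by (simp add: r_def)
    finally have "of_real (d / 2) \<preceq> of_real d + t *\<^sub>R (- of_real (norm G) :: 'a)"
      using of_real_cle[of "d/2" "d - t * norm G"] by (simp add: scaleR_conv_of_real)
    also have "\<dots> \<preceq> A + t *\<^sub>R G" using t by (intro cle_add d cle_scaleR minus_norm_cle assms) auto
    finally show ?thesis .
  qed
  then show ?thesis using d(1) r
    by (intro exI[of _ "d / 2"]) (auto simp: eventually_at_right_field)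
qed

subsection \<open>The logarithm\<close>

lemma norm_exp_minus_linear_le:
  fixes h :: "'a::{real_normed_algebra_1,banach}"
  shows "norm (exp h - 1 - h) \<le> (norm h)\<^sup>2 * exp (norm h)"
proof -
  have "exp h - 1 - h = (\<Sum>n. inverse (fact (n + 2)) *\<^sub>R (h ^ (n + 2)))"
    by (subst exp_first_two_terms) simp
  also have "norm \<dots> \<le> (\<Sum>n. (norm h)\<^sup>2 * (inverse (fact n) *\<^sub>R norm h ^ n))"
  proof (rule norm_suminf_le)
    fix n
    have "norm (h ^ (n + 2)) \<le> norm h ^ (n + 2)" by (rule norm_power_ineq)
    moreover have "inverse (fact (n + 2)) \<le> (inverse (fact n) :: real)"
      by (intro le_imp_inverse_le fact_mono) auto
    ultimately have "inverse (fact (n + 2)) * norm (h ^ (n + 2)) \<le> inverse (fact n) * norm h ^ (n + 2)"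
      by (intro mult_mono) auto
    then show "norm (inverse (fact (n + 2)) *\<^sub>R h ^ (n + 2)) \<le> (norm h)\<^sup>2 * (inverse (fact n) *\<^sub>R norm h ^ n)"
      by (simp add: power_add mult_ac power2_eq_square)
  next
    show "summable (\<lambda>n. (norm h)\<^sup>2 * (inverse (fact n) *\<^sub>R norm h ^ n))"
      by (intro summable_mult summable_exp_generic)
  qed
  also have "\<dots> = (norm h)\<^sup>2 * exp (norm h)"
    unfolding exp_def by (rule suminf_mult) (rule summable_exp_generic)
  finally show ?thesis .
qed

lemma has_derivative_exp_0:
  "(exp has_derivative (\<lambda>h. h)) (at (0::'a::{real_normed_algebra_1,banach}))"
proof (rule has_derivativeI_sandwich[of 1])
  show "bounded_linear (\<lambda>h::'a. h)" by (rule bounded_linear_ident)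
  fix y :: 'a assume y: "y \<noteq> 0" "dist y 0 < 1"
  have "norm ((exp y - exp 0) - (y - 0)) \<le> (norm y)\<^sup>2 * exp (norm y)"
    using norm_exp_minus_linear_le[of y] by simp
  then show "norm ((exp y - exp 0) - (y - 0)) / norm (y - 0) \<le> norm y * exp (norm y)"
    using y by (simp add: divide_simps power2_eq_square mult_ac)
next
  have "((\<lambda>y::'a. norm y * exp (norm y)) \<longlongrightarrow> norm (0::'a) * exp (norm (0::'a))) (at 0)"
    by (intro tendsto_intros)
  then show "((\<lambda>y::'a. norm y * exp (norm y)) \<longlongrightarrow> 0) (at 0)" by simp
qed simp

text \<open>Commutation allows exp(v r) = exp(v r - v s) exp(v s), so only the derivative of exp at
  0 enters.\<close>

lemma has_vector_derivative_exp_commuting: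
  fixes v :: "real \<Rightarrow> 'a::{real_normed_algebra_1,banach}"
  assumes v: "(v has_vector_derivative v') (at s within S)" and "s \<in> S"
    and com: "\<And>r. r \<in> S \<Longrightarrow> v r * v s = v s * v r"
  shows "((\<lambda>r. exp (v r)) has_vector_derivative v' * exp (v s)) (at s within S)"
proof -
  have "((\<lambda>r. v r - v s) has_derivative (\<lambda>x. x *\<^sub>R v')) (at s within S)"
    using v unfolding has_vector_derivative_def by (auto intro!: derivative_eq_intros)
  moreover have "(exp has_derivative (\<lambda>h. h)) (at (v s - v s) within (\<lambda>r. v r - v s) ` S)"
    using has_derivative_exp_0 by (auto intro: has_derivative_at_withinI)
  ultimately have "((\<lambda>r. exp (v r - v s)) has_vector_derivative v') (at s within S)"
    unfolding has_vector_derivative_def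
    using has_derivative_in_compose[of "\<lambda>r. v r - v s" _ s S exp "\<lambda>h. h"] by simp
  then have "((\<lambda>r. exp (v r - v s) * exp (v s)) has_vector_derivative v' * exp (v s)) (at s within S)"
    by (rule bounded_linear.has_vector_derivative[OF bounded_linear_mult_left])
  then show ?thesis
  proof (rule has_vector_derivative_transform_within[OF _ zero_less_one \<open>s \<in> S\<close>])
    fix r assume "r \<in> S"
    then have "(v r - v s) * v s = v s * (v r - v s)" by (simp add: algebra_simps com)
    then show "exp (v r - v s) * exp (v s) = exp (v r)"
      using exp_add_commuting[of "v r - v s" "v s"] by simp
  qed
qed

lemma exp_commute:
  fixes a x :: "'a::{real_normed_algebra_1,banach}"
  assumes "x * a = a * x"
  shows "x * exp a = exp a * x"
proof -
  have p: "x * a ^ n = a ^ n * x" for n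
    by (induction n) (simp_all add: assms, metis assms mult.assoc)
  show ?thesis unfolding exp_def
    by (simp add: p suminf_mult[OF summable_exp_generic, symmetric] suminf_mult2[OF summable_exp_generic])
qed

lemma adj_exp: "adj (exp a) = exp (adj a)"
  unfolding exp_def
  by (simp add: bounded_linear.suminf[OF bounded_linear_adj summable_exp_generic] adj_simps)

lemma exp_mult_minus: "exp a * exp (- a) = (1::'a::{real_normed_algebra_1,banach})"
  using exp_add_commuting[of a "- a"] by simp

lemma pos_exp: "self_adj a \<Longrightarrow> cs_positive (exp a)"
proof -
  assume a: "self_adj a"
  have "exp a = exp ((1/2) *\<^sub>R a) * exp ((1/2) *\<^sub>R a)"
    using exp_add_commuting[of "(1/2) *\<^sub>R a" "(1/2) *\<^sub>R a"] by (simp flip: scaleR_add_left)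
  then show ?thesis using pos_square[of "exp ((1/2) *\<^sub>R a)"] a by (simp add: adj_exp adj_simps)
qed

text \<open>Exponentials of self-adjoint elements are positive, so uniqueness of positive roots lets
  the exponent be halved indefinitely. Near 0 this contradicts that exp h - 1 - h is quadratically
  small.\<close>

lemma exp_self_adj_eq_one:
  fixes N :: "'a::cstar_algebra"
  assumes "self_adj N" "exp N = 1"
  shows "N = 0"
proof (rule ccontr)
  assume N: "N \<noteq> 0"
  have e: "exp ((1/2^k) *\<^sub>R N) = 1" for k :: nat
  proof (induction k)
    case (Suc k)
    define a where "a = (1/2^Suc k) *\<^sub>R N"
    have "exp a * exp a = exp (a + a)" by (rule exp_add_commuting[symmetric]) simp
    also have "a + a = (1/2^k) *\<^sub>R N" by (simp add: a_def flip: scaleR_add_left)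
    finally have "exp a * exp a = 1 * 1" using Suc.IH by simp
    then have "exp a = 1"
      by (rule pos_root_unique[rotated 2]) (simp_all add: pos_exp pos_one a_def adj_simps assms)
    then show ?case by (simp add: a_def)
  qed (simp add: assms)
  obtain k :: nat where k: "4 * norm N < 2 ^ k" using real_arch_pow[of 2 "4 * norm N"] by auto
  define h where "h = (1/2^k) *\<^sub>R N"
  have h: "h \<noteq> 0" "norm h < 1/4" using N k by (simp_all add: h_def divide_simps)
  have "norm h \<le> (norm h)\<^sup>2 * exp (norm h)"
    using norm_exp_minus_linear_le[of h] e[of k] by (simp add: h_def[symmetric])
  then have "norm h * 1 \<le> norm h * (norm h * exp (norm h))" by (simp add: power2_eq_square mult_ac)
  then have "1 \<le> norm h * exp (norm h)" using h(1) by (subst (asm) mult_le_cancel_left_pos) auto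
  also have "\<dots> \<le> 1/4 * exp 1" using h by (intro mult_mono) auto
  also have "\<dots> < 1" using exp_le by simp
  finally show False by simp
qed

section \<open>Inverses along the segment from 1 to X\<close>

context
  fixes X :: "'a::cstar_algebra" and \<delta> :: real
  assumes \<delta>: "\<delta> > 0" "\<delta> \<le> 1" "of_real \<delta> \<preceq> X"
begin

lemma segment_lower_bound:
  assumes "s \<in> {0..1}"
  shows "of_real \<delta> \<preceq> 1 + s *\<^sub>R (X - 1)"
proof -
  have "(1 - s) *\<^sub>R of_real \<delta> + s *\<^sub>R of_real \<delta> \<preceq> (1 - s) *\<^sub>R of_real 1 + s *\<^sub>R X"
    using assms \<delta> by (intro cle_add cle_scaleR of_real_cle) auto
  then show ?thesis by (simp add: algebra_simps)
qed

lemma segment_pos_inv: "s \<in> {0..1} \<Longrightarrow> 1 + s *\<^sub>R (X - 1) \<in> pos_inv"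
  using segment_lower_bound \<delta> pos_inv_iff by blast

lemma norm_segment_inv_le: "s \<in> {0..1} \<Longrightarrow> norm (cs_inv (1 + s *\<^sub>R (X - 1))) \<le> 1 / \<delta>"
  using segment_lower_bound \<delta> norm_cs_inv_le by blast

lemma continuous_segment_inv: "continuous_on {0..1} (\<lambda>s. cs_inv (1 + s *\<^sub>R (X - 1)))"
proof (rule continuous_on_iff[THEN iffD2], intro ballI allI impI)
  fix s e :: real assume s: "s \<in> {0..1}" and e: "e > 0"
  define K where "K = norm (X - 1) / \<delta>\<^sup>2 + 1"
  have K: "K > 0" using \<delta> by (simp add: K_def add_nonneg_pos)
  show "\<exists>d>0. \<forall>t\<in>{0..1}. dist t s < d \<longrightarrow>
      dist (cs_inv (1 + t *\<^sub>R (X - 1))) (cs_inv (1 + s *\<^sub>R (X - 1))) < e"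
  proof (intro exI conjI ballI impI)
    show "e / K > 0" using e K by simp
    fix t assume t: "t \<in> {0..1}" "dist t s < e / K"
    let ?S = "1 + s *\<^sub>R (X - 1)" and ?T = "1 + t *\<^sub>R (X - 1)"
    have "cs_inv ?T - cs_inv ?S = cs_inv ?T * (?S - ?T) * cs_inv ?S"
      using pos_inv_assoc[OF segment_pos_inv[OF t(1)]] pos_invD(4,5)[OF segment_pos_inv[OF t(1)]]
        pos_invD(4,5)[OF segment_pos_inv[OF s]]
      by (simp only: left_diff_distrib right_diff_distrib mult.assoc mult_1_left mult_1_right)
    also have "?S - ?T = (s - t) *\<^sub>R (X - 1)" by (simp add: scaleR_diff_left)
    finally have "norm (cs_inv ?T - cs_inv ?S) \<le> norm (cs_inv ?T) * norm ((s - t) *\<^sub>R (X - 1)) * norm (cs_inv ?S)"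
      by (metis (no_types, lifting) mult_right_mono norm_ge_zero norm_mult_ineq order_trans)
    also have "\<dots> \<le> 1/\<delta> * (\<bar>s - t\<bar> * norm (X - 1)) * (1/\<delta>)"
      using norm_segment_inv_le[OF t(1)] norm_segment_inv_le[OF s] \<delta> by (intro mult_mono) auto
    also have "\<dots> \<le> \<bar>s - t\<bar> * K"
      by (simp add: K_def power2_eq_square algebra_simps)
    also have "\<dots> < e" using t(2) K by (simp add: dist_real_def divide_simps abs_minus_commute)
    finally show "dist (cs_inv ?T) (cs_inv ?S) < e" by (simp add: dist_norm)
  qed
qed

end

text \<open>The integrand of log x = integral over s in [0,1] of (x - 1) / (1 + s(x - 1)). The
  integral is proper: for invertible positive X the integrand is continuous on the whole compact
  interval.\<close>

definition log_kernel :: "'a::cstar_algebra \<Rightarrow> real \<Rightarrow> 'a" where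
  "log_kernel X s = (X - 1) * cs_inv (1 + s *\<^sub>R (X - 1))"

lemma pos_inv_bound_le_one:
  assumes "X \<in> pos_inv"
  obtains \<delta> where "\<delta> > 0" "\<delta> \<le> 1" "of_real \<delta> \<preceq> X"
proof -
  obtain d where d: "d > 0" "of_real d \<preceq> X" using assms pos_inv_iff by blast
  have "of_real (min d 1) \<preceq> X" using cle_trans[OF of_real_cle d(2), of "min d 1"] by simp
  then show ?thesis using that[of "min d 1"] d(1) by simp
qed

lemma log_segment_pos_inv: "X \<in> pos_inv \<Longrightarrow> s \<in> {0..1} \<Longrightarrow> 1 + s *\<^sub>R (X - 1) \<in> pos_inv"
  using pos_inv_bound_le_one segment_pos_inv by metis

lemma continuous_log_kernel:
  assumes "X \<in> pos_inv"
  shows "continuous_on {0..1} (log_kernel X)"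
proof -
  obtain d where "d > 0" "d \<le> 1" "of_real d \<preceq> X" using pos_inv_bound_le_one[OF assms] .
  then show ?thesis unfolding log_kernel_def
    by (intro continuous_intros continuous_segment_inv)
qed

lemma integrable_log_kernel: "X \<in> pos_inv \<Longrightarrow> s \<le> 1 \<Longrightarrow> log_kernel X integrable_on {0..s}"
  by (rule integrable_continuous_real, rule continuous_on_subset[OF continuous_log_kernel]) auto

lemma segment_inv_commute:
  assumes "X \<in> pos_inv" "s \<in> {0..1}" "x * X = X * x"
  shows "x * cs_inv (1 + s *\<^sub>R (X - 1)) = cs_inv (1 + s *\<^sub>R (X - 1)) * x"
  by (rule cs_inv_commute[OF log_segment_pos_inv[OF assms(1,2)]]) (simp add: algebra_simps assms(3))

lemma log_kernel_commute:
  assumes "X \<in> pos_inv" "s \<in> {0..1}" "x * X = X * x"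
  shows "x * log_kernel X s = log_kernel X s * x"
proof -
  have "x * (X - 1) = (X - 1) * x" by (simp add: algebra_simps assms(3))
  then show ?thesis unfolding log_kernel_def
    using segment_inv_commute[OF assms] by (metis mult.assoc)
qed

lemma log_integral_commute:
  assumes "X \<in> pos_inv" "s \<in> {0..1}" "x * X = X * x"
  shows "x * integral {0..s} (log_kernel X) = integral {0..s} (log_kernel X) * x"
proof -
  have i: "log_kernel X integrable_on {0..s}" using assms(2) by (intro integrable_log_kernel[OF assms(1)]) simp
  have "x * integral {0..s} (log_kernel X) = integral {0..s} (\<lambda>t. x * log_kernel X t)"
    using integral_linear[OF i bounded_linear_mult_right[of x]] by (simp add: o_def)
  also have "\<dots> = integral {0..s} (\<lambda>t. log_kernel X t * x)"
    by (rule integral_cong, rule log_kernel_commute[OF assms(1) _ assms(3)]) (use assms(2) in auto)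
  also have "\<dots> = integral {0..s} (log_kernel X) * x"
    using integral_linear[OF i bounded_linear_mult_left[of x]] by (simp add: o_def)
  finally show ?thesis .
qed

lemma exp_log_integral:
  assumes X: "X \<in> pos_inv"
  shows "exp (integral {0..1} (log_kernel X)) = X"
proof -
  define v where "v s = integral {0..s} (log_kernel X)" for s
  \<comment> \<open>The primitive v should be the logarithm of the segment, so E should be constant;
    comparing s = 0 with s = 1 then gives the claim.\<close>
  define E where "E s = exp (- v s) * (1 + s *\<^sub>R (X - 1))" for s
  have vX: "v s * X = X * v s" if "s \<in> {0..1}" for s
    unfolding v_def by (rule log_integral_commute[symmetric]) (use X that in auto)
  have vv: "v r * v s = v s * v r" if "r \<in> {0..1}" "s \<in> {0..1}" for r s
    unfolding v_def[of s] by (rule log_integral_commute) (use X that vX in auto)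
  have "(E has_vector_derivative 0) (at s within {0..1})" if s: "s \<in> {0..1}" for s
  proof -
    let ?Z = "1 + s *\<^sub>R (X - 1)"
    have "(v has_vector_derivative log_kernel X s) (at s within {0..1})"
      unfolding v_def using integral_has_vector_derivative[OF continuous_log_kernel[OF X] s] .
    then have "((\<lambda>s. - v s) has_vector_derivative - log_kernel X s) (at s within {0..1})"
      by (rule has_vector_derivative_minus)
    then have "((\<lambda>s. exp (- v s)) has_vector_derivative - log_kernel X s * exp (- v s)) (at s within {0..1})"
      by (rule has_vector_derivative_exp_commuting) (use s vv in auto)
    moreover have "((\<lambda>s. 1 + s *\<^sub>R (X - 1)) has_vector_derivative (X - 1)) (at s within {0..1})"
      by (auto intro!: derivative_eq_intros)
    ultimately have "(E has_vector_derivative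
        exp (- v s) * (X - 1) + (- log_kernel X s * exp (- v s)) * ?Z) (at s within {0..1})"
      unfolding E_def by (rule has_vector_derivative_mult)
    moreover have "log_kernel X s * exp (- v s) * ?Z = exp (- v s) * (X - 1)"
    proof -
      have "X * (- v s) = (- v s) * X" using vX[OF s] by simp
      then have eX: "X * exp (- v s) = exp (- v s) * X" by (rule exp_commute)
      have "log_kernel X s * exp (- v s) = exp (- v s) * log_kernel X s"
        by (rule log_kernel_commute[symmetric]) (use X s eX in auto)
      then have "log_kernel X s * exp (- v s) * ?Z = exp (- v s) * ((X - 1) * (cs_inv ?Z * ?Z))"
        by (simp add: log_kernel_def mult.assoc)
      also have "cs_inv ?Z * ?Z = 1" using pos_invD(5)[OF log_segment_pos_inv[OF X s]] .
      finally show ?thesis by simp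
    qed
    ultimately show ?thesis by simp
  qed
  then obtain c where c: "\<And>s. s \<in> {0..1} \<Longrightarrow> E s = c"
    using has_vector_derivative_zero_constant[of "{0..1::real}" E] by auto
  have "E 1 = E 0" using c by simp
  then have 1: "exp (- v 1) * X = 1" by (simp add: E_def v_def)
  have "exp (v 1) * (exp (- v 1) * X) = exp (v 1)" using 1 by simp
  then show ?thesis by (simp add: exp_mult_minus v_def flip: mult.assoc)
qed

lemma self_adj_segment_inv:
  "X \<in> pos_inv \<Longrightarrow> s \<in> {0..1} \<Longrightarrow> self_adj (cs_inv (1 + s *\<^sub>R (X - 1)))"
  using pos_inv_cs_inv log_segment_pos_inv pos_invD(3) by blast

lemma self_adj_log_kernel:
  assumes "X \<in> pos_inv" "s \<in> {0..1}"
  shows "self_adj (log_kernel X s)"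
proof -
  have "adj (log_kernel X s) = cs_inv (1 + s *\<^sub>R (X - 1)) * (X - 1)"
    by (simp only: log_kernel_def adj_mult adj_diff adj_one self_adj_segment_inv[OF assms] pos_invD(3)[OF assms(1)])
  also have "\<dots> = log_kernel X s"
    using segment_inv_commute[OF assms, of "X - 1"] by (simp add: log_kernel_def algebra_simps)
  finally show ?thesis .
qed

lemma self_adj_log_integral:
  assumes "X \<in> pos_inv"
  shows "self_adj (integral {0..1} (log_kernel X))"
proof -
  have "adj (integral {0..1} (log_kernel X)) = integral {0..1} (\<lambda>s. adj (log_kernel X s))"
    using integral_linear[OF integrable_log_kernel[OF assms order_refl] bounded_linear_adj] by (simp add: o_def)
  also have "\<dots> = integral {0..1} (log_kernel X)"
    by (rule integral_cong) (use self_adj_log_kernel assms in auto)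
  finally show ?thesis .
qed

text \<open>L commutes with its exponential X, hence with the integral M, so exp(L - M) = 1 and the
  kernel result for self-adjoint elements applies.\<close>

lemma exp_self_adj_inj:
  fixes X :: "'a::cstar_algebra"
  assumes "X \<in> pos_inv" "self_adj L" "exp L = X"
  shows "L = integral {0..1} (log_kernel X)"
proof -
  define M where "M = integral {0..1} (log_kernel X)"
  have "L * X = X * L" unfolding assms(3)[symmetric] by (rule exp_times_arg_commute[symmetric])
  then have LM: "L * M = M * L" unfolding M_def by (intro log_integral_commute assms) auto
  have eM: "exp M = X" unfolding M_def by (rule exp_log_integral[OF assms(1)])
  have "exp (L - M) = exp L * exp (- M)" using exp_add_commuting[of L "- M"] LM by simp
  also have "\<dots> = 1" using exp_mult_minus[of M] eM assms(3) by simp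
  finally have "L - M = 0"
    by (intro exp_self_adj_eq_one) (simp_all add: adj_simps assms M_def self_adj_log_integral)
  then show ?thesis by (simp add: M_def)
qed

lemma cs_log_eq_integral:
  assumes "X \<in> pos_inv"
  shows "cs_log X = integral {0..1} (log_kernel X)"
  unfolding cs_log_def
  by (rule the_equality) (use assms self_adj_log_integral exp_log_integral exp_self_adj_inj in blast)+

lemma cs_log:
  assumes "X \<in> pos_inv"
  shows "self_adj (cs_log X)" "exp (cs_log X) = X" "x * X = X * x \<Longrightarrow> x * cs_log X = cs_log X * x"
  using assms self_adj_log_integral exp_log_integral log_integral_commute[of X 1]
  by (simp_all add: cs_log_eq_integral)

lemma cs_log_unique: "X \<in> pos_inv \<Longrightarrow> self_adj L \<Longrightarrow> exp L = X \<Longrightarrow> cs_log X = L"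
  using exp_self_adj_inj cs_log_eq_integral by metis

lemma cs_log_mult:
  assumes "X \<in> pos_inv" "Y \<in> pos_inv" "X * Y = Y * X"
  shows "cs_log (X * Y) = cs_log X + cs_log Y"
proof (rule cs_log_unique)
  show "X * Y \<in> pos_inv" by (rule pos_inv_commute_mult[OF assms])
  show "self_adj (cs_log X + cs_log Y)" by (simp add: adj_add cs_log(1) assms)
  have "Y * cs_log X = cs_log X * Y" by (rule cs_log(3)) (use assms in auto)
  then have "cs_log X * cs_log Y = cs_log Y * cs_log X" by (intro cs_log(3)) (use assms in auto)
  then show "exp (cs_log X + cs_log Y) = X * Y" using exp_add_commuting cs_log(2) assms by metis
qed

lemma cs_log_of_real: "r > 0 \<Longrightarrow> cs_log (of_real r) = of_real (ln r)"
  by (rule cs_log_unique) (simp_all add: pos_inv_of_real adj_simps exp_of_real)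

lemma cs_log_scaleR:
  assumes "X \<in> pos_inv" "r > 0"
  shows "cs_log (r *\<^sub>R X) = of_real (ln r) + cs_log X"
  using cs_log_mult[OF pos_inv_of_real[OF assms(2)] assms(1)] cs_log_of_real[OF assms(2), where 'a='a]
  by (simp add: scaleR_conv_of_real) (simp add: of_real_def)

lemma cs_log_cs_inv:
  assumes "X \<in> pos_inv"
  shows "cs_log (cs_inv X) = - cs_log X"
proof -
  have "cs_log (X * cs_inv X) = cs_log X + cs_log (cs_inv X)"
    by (rule cs_log_mult) (simp_all add: assms pos_inv_cs_inv pos_invD(4,5))
  moreover have "cs_log (1::'a) = 0" using cs_log_of_real[of 1, where 'a='a] by simp
  ultimately show ?thesis using pos_invD(4)[OF assms] by (simp add: eq_neg_iff_add_eq_0 add.commute)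
qed

lemma scaleR_log_kernel:
  assumes "X \<in> pos_inv" "s \<in> {0..1}"
  shows "s *\<^sub>R log_kernel X s = 1 - cs_inv (1 + s *\<^sub>R (X - 1))"
proof -
  let ?Z = "1 + s *\<^sub>R (X - 1)"
  have "s *\<^sub>R log_kernel X s = (?Z - 1) * cs_inv ?Z" by (simp add: log_kernel_def)
  also have "\<dots> = 1 - cs_inv ?Z"
    unfolding left_diff_distrib[of ?Z] by (simp only: pos_invD(4)[OF log_segment_pos_inv[OF assms]] mult_1_left)
  finally show ?thesis .
qed

text \<open>For s > 0 the kernel is (1 - inverse) / s, so its monotonicity is antitonicity of the
  inverse; at s = 0 the kernel is just X - 1.\<close>

lemma log_kernel_mono:
  assumes "X \<in> pos_inv" "X \<preceq> Y" "s \<in> {0..1}"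
  shows "log_kernel X s \<preceq> log_kernel Y s"
proof (cases "s = 0")
  case True
  have "cs_inv (1::'a) = 1" by (rule cs_inv_eqI) simp_all
  then show ?thesis using True assms(2) by (simp add: log_kernel_def cle_def)
next
  case False
  then have s: "s > 0" using assms(3) by simp
  have Y: "Y \<in> pos_inv" using pos_inv_cle assms by blast
  have "1 + s *\<^sub>R (X - 1) \<preceq> 1 + s *\<^sub>R (Y - 1)"
    using cle_scaleR[OF assms(2), of s] s by (simp add: cle_def algebra_simps)
  then have "cs_inv (1 + s *\<^sub>R (Y - 1)) \<preceq> cs_inv (1 + s *\<^sub>R (X - 1))"
    using cs_inv_antimono log_segment_pos_inv assms by blast
  then have "s *\<^sub>R log_kernel X s \<preceq> s *\<^sub>R log_kernel Y s"
    by (simp only: scaleR_log_kernel[OF assms(1,3)] scaleR_log_kernel[OF Y assms(3)] cle_def) simp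
  then have "(1/s) *\<^sub>R (s *\<^sub>R log_kernel X s) \<preceq> (1/s) *\<^sub>R (s *\<^sub>R log_kernel Y s)"
    by (rule cle_scaleR) (use s in simp)
  then show ?thesis using s by simp
qed

text \<open>Operator inequalities for the logarithm are only recorded after applying a positive
functional \<open>p\<close>, which reduces monotonicity of the integral to the real case.\<close>

context
  fixes p :: "'a::cstar_algebra \<Rightarrow> real"
  assumes p: "bounded_linear p" and p_pos: "\<And>A. cs_positive A \<Longrightarrow> p A \<ge> 0"
begin

lemma functional_mono: "A \<preceq> B \<Longrightarrow> p A \<le> p B"
  using p_pos[of "B - A"] by (simp add: cle_def bounded_linear.linear[OF p] linear_diff)

lemma functional_cs_log:
  assumes "X \<in> pos_inv"
  shows "p (cs_log X) = integral {0..1} (\<lambda>s. p (log_kernel X s))"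
    "(\<lambda>s. p (log_kernel X s)) integrable_on {0..1}"
  using integral_linear[OF integrable_log_kernel[OF assms order_refl] p]
    integrable_linear[OF integrable_log_kernel[OF assms order_refl] p]
  by (simp_all add: o_def cs_log_eq_integral assms)

lemma functional_cs_log_mono:
  assumes "X \<in> pos_inv" "X \<preceq> Y"
  shows "p (cs_log X) \<le> p (cs_log Y)"
proof -
  have Y: "Y \<in> pos_inv" using pos_inv_cle assms by blast
  show ?thesis unfolding functional_cs_log(1)[OF assms(1)] functional_cs_log(1)[OF Y]
    by (intro integral_le functional_cs_log functional_mono log_kernel_mono assms Y)
qed

lemma functional_cs_log_one_plus_le:
  assumes "cs_positive P"
  shows "p (cs_log (1 + P)) \<le> p P"
proof -
  have X: "1 + P \<in> pos_inv" using pos_inv_add_pos pos_inv_one assms by blast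
  have "log_kernel (1 + P) s \<preceq> P" if s: "s \<in> {0..1}" for s
  proof -
    let ?R = "cs_inv (1 + s *\<^sub>R P)"
    have Z: "1 + s *\<^sub>R P \<in> pos_inv" using log_segment_pos_inv[OF X s] by simp
    have PR: "P * ?R = ?R * P" by (rule cs_inv_commute[OF Z]) (simp add: algebra_simps)
    \<comment> \<open>The gap between P and the kernel is sPRP, manifestly positive; integrating
      gives log(1 + P) \<le> P under the functional.\<close>
    have "P - P * ?R = P * ((1 + s *\<^sub>R P) * ?R - ?R)"
      by (simp only: pos_invD(4)[OF Z] right_diff_distrib mult_1_right)
    also have "\<dots> = s *\<^sub>R (P * ?R * P)" by (simp add: distrib_right PR[symmetric] mult.assoc)
    also have "cs_positive \<dots>"
      using pos_conj_self_adj[of ?R P] pos_inv_cs_inv[OF Z] pos_invD(1) pos_self_adj[OF assms] s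
      by (intro pos_scaleR) auto
    finally show ?thesis by (simp add: cle_def log_kernel_def)
  qed
  then have "integral {0..1} (\<lambda>s. p (log_kernel (1 + P) s)) \<le> integral {0..1} (\<lambda>s::real. p P)"
    by (intro integral_le functional_cs_log[OF X] functional_mono) auto
  then show ?thesis by (simp add: functional_cs_log[OF X])
qed

end

text \<open>The kernel of 1 + P is PR with R = 1 - sPR. Substituting this twice leaves P - sP^2 +
  s^2 P^3 R; the first two terms integrate to the Taylor polynomial, and norm R \<le> 2 because 1 +
  P \<ge> 1/2.\<close>

lemma cs_log_second_order:
  fixes P :: "'a::cstar_algebra"
  assumes "self_adj P" "norm P \<le> 1/2"
  shows "1 + P \<in> pos_inv" "norm (cs_log (1 + P) - (P - (1/2) *\<^sub>R (P * P))) \<le> 2 * norm P ^ 3"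
proof -
  have "of_real 1 - of_real (norm P) \<preceq> 1 + P"
    using minus_norm_cle[OF assms(1)] by (simp add: cle_def algebra_simps)
  moreover have "of_real (1/2) \<preceq> of_real 1 - (of_real (norm P) :: 'a)"
    using of_real_cle[of "1/2" "1 - norm P"] assms(2) by simp
  ultimately have b: "of_real (1/2) \<preceq> 1 + P" by (rule cle_trans[rotated])
  then show X: "1 + P \<in> pos_inv" by (auto simp: pos_inv_iff intro!: exI[of _ "1/2"])
  let ?f = "\<lambda>s::real. P - s *\<^sub>R (P * P)"
  have df: "((\<lambda>s. s *\<^sub>R P - (s\<^sup>2/2) *\<^sub>R (P * P)) has_vector_derivative ?f s) (at s within {0..1})" for s :: real
    by (auto intro!: derivative_eq_intros simp: power2_eq_square)
  have "(?f has_integral (1 *\<^sub>R P - (1\<^sup>2/2) *\<^sub>R (P * P)) - (0 *\<^sub>R P - (0\<^sup>2/2) *\<^sub>R (P * P))) {0..1}"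
    by (rule fundamental_theorem_of_calculus) (use df in auto)
  then have f: "integral {0..1} ?f = P - (1/2) *\<^sub>R (P * P)" "?f integrable_on {0..1}"
    by (auto simp: has_integral_iff)
  have "cs_log (1 + P) - (P - (1/2) *\<^sub>R (P * P)) = integral {0..1} (\<lambda>s. log_kernel (1 + P) s - ?f s)"
    by (simp only: cs_log_eq_integral[OF X] f(1)[symmetric]
        integral_diff[OF integrable_log_kernel[OF X order_refl] f(2)])
  also have "norm \<dots> \<le> 2 * norm P ^ 3 * (1 - 0)"
  proof (rule integral_bound)
    show "continuous_on {0..1} (\<lambda>s. log_kernel (1 + P) s - ?f s)"
      by (intro continuous_intros continuous_log_kernel[OF X])
    fix s :: real assume s: "s \<in> {0..1}"
    let ?R = "cs_inv (1 + s *\<^sub>R P)"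
    have Z: "1 + s *\<^sub>R P \<in> pos_inv" using log_segment_pos_inv[OF X s] by simp
    have R: "?R = 1 - s *\<^sub>R (P * ?R)" using pos_invD(4)[OF Z] by (simp add: algebra_simps)
    have "log_kernel (1 + P) s = P * ?R" by (simp add: log_kernel_def)
    also have "\<dots> = P * (1 - s *\<^sub>R (P * (1 - s *\<^sub>R (P * ?R))))" using R by metis
    finally have e: "log_kernel (1 + P) s - ?f s = (s * s) *\<^sub>R (P * P * P * ?R)"
      by (simp add: algebra_simps)
    have nR: "norm ?R \<le> 2"
      using norm_segment_inv_le[OF _ _ b s] by simp
    have "norm (P * P * P * ?R) \<le> norm P * norm P * norm P * norm ?R"
      by (metis (no_types, lifting) mult_right_mono norm_ge_zero norm_mult_ineq order_trans)
    also have "\<dots> \<le> norm P * norm P * norm P * 2" using nR by (intro mult_left_mono) auto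
    finally have n: "norm (P * P * P * ?R) \<le> 2 * norm P ^ 3" by (simp add: power3_eq_cube)
    have "norm (log_kernel (1 + P) s - ?f s) = (s * s) * norm (P * P * P * ?R)"
      unfolding e using s by simp
    also have "\<dots> \<le> 1 * norm (P * P * P * ?R)" using s by (intro mult_right_mono) (auto simp: mult_le_one)
    finally show "norm (log_kernel (1 + P) s - ?f s) \<le> 2 * norm P ^ 3" using n by linarith
  qed simp
  finally show "norm (cs_log (1 + P) - (P - (1/2) *\<^sub>R (P * P))) \<le> 2 * norm P ^ 3" by simp
qed

subsection \<open>Faithful traces and the relative entropy\<close>

locale traced =
  fixes \<tau> :: "'a::cstar_algebra \<Rightarrow> complex"
  assumes faithful: "faithful_trace \<tau>"
begin

definition tr :: "'a \<Rightarrow> real" where "tr x = Re (\<tau> x)"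

lemma tau_add: "\<tau> (x + y) = \<tau> x + \<tau> y"
  and tau_cscale: "\<tau> (cscale c x) = c * \<tau> x"
  and tau_commute: "\<tau> (x * y) = \<tau> (y * x)"
  and tau_pos: "cs_positive x \<Longrightarrow> \<tau> x = of_real (tr x)"
  and tr_pos: "cs_positive x \<Longrightarrow> tr x \<ge> 0"
  and tr_pos_zero: "cs_positive x \<Longrightarrow> tr x = 0 \<Longrightarrow> x = 0"
proof -
  have t: "is_trace \<tau>" and f: "\<And>A. cs_positive A \<Longrightarrow> \<tau> A = 0 \<Longrightarrow> A = 0"
    using faithful unfolding faithful_trace_def by auto
  show "\<tau> (x + y) = \<tau> x + \<tau> y" "\<tau> (cscale c x) = c * \<tau> x" "\<tau> (x * y) = \<tau> (y * x)"
    using t unfolding is_trace_def by auto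
  show tp: "\<tau> x = of_real (tr x)" if "cs_positive x"
    using t that unfolding is_trace_def tr_def by (simp add: complex_eq_iff)
  show "tr x \<ge> 0" if "cs_positive x" using t that unfolding is_trace_def tr_def by simp
  show "x = 0" if "cs_positive x" "tr x = 0" using f[OF that(1)] tp[OF that(1)] that(2) by simp
qed

lemma tau_scaleR: "\<tau> (r *\<^sub>R x) = of_real r * \<tau> x"
  using tau_cscale[of "of_real r" x] by (simp add: cscale_of_real)

lemma tr_add: "tr (x + y) = tr x + tr y"
  and tr_scaleR: "tr (r *\<^sub>R x) = r * tr x"
  and tr_commute: "tr (x * y) = tr (y * x)"
  by (simp_all add: tr_def tau_add tau_scaleR tau_commute[of x])

lemma tr_minus: "tr (- x) = - tr x"
  using tr_scaleR[of "-1" x] by simp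

lemma tr_diff: "tr (x - y) = tr x - tr y"
  using tr_add[of x "- y"] by (simp add: tr_minus)

lemma tr_zero: "tr 0 = 0"
  using tr_scaleR[of 0 0] by simp

lemma tr_of_real: "tr (of_real r) = r * tr 1"
  by (simp add: of_real_def tr_scaleR)

lemmas tr_linear = tr_add tr_scaleR tr_minus tr_diff tr_zero tr_of_real

lemma tau_self_adj:
  assumes "self_adj x"
  shows "\<tau> x = of_real (tr x)"
proof -
  have e: "\<tau> (of_real (norm x) - x) + \<tau> x = \<tau> (of_real (norm x))" by (simp flip: tau_add)
  have "Im (\<tau> (of_real (norm x) - x)) = 0" "Im (\<tau> (of_real (norm x))) = 0"
    using tau_pos[OF pos_norm_minus[OF assms]] tau_pos[OF pos_of_real[OF norm_ge_zero]]
    by (metis Im_complex_of_real)+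
  then have "Im (\<tau> x) = 0" using arg_cong[OF e, of Im] by simp
  then show ?thesis by (simp add: tr_def complex_eq_iff)
qed

lemma tau_parts: "\<tau> x = Complex (tr (re_part x)) (tr (im_part x))"
  by (subst re_im_part)
     (simp add: tau_add tau_cscale tau_self_adj self_adj_re_part self_adj_im_part complex_eq_iff)

lemma tr_re_part: "tr x = tr (re_part x)"
  by (simp add: tr_def[of x] tau_parts)

lemma tr_mono: "A \<preceq> B \<Longrightarrow> tr A \<le> tr B"
  using tr_pos[of "B - A"] by (simp add: cle_def tr_diff)

lemma tr_one_pos: "tr 1 > 0"
  using tr_pos[OF pos_one] tr_pos_zero[OF pos_one] by (cases "tr 1 = 0") auto

lemma tr_pos_inv: "A \<in> pos_inv \<Longrightarrow> tr A > 0"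
proof -
  assume "A \<in> pos_inv"
  then obtain d where d: "d > 0" "of_real d \<preceq> A" using pos_inv_iff by blast
  have "d * tr 1 \<le> tr A" using tr_mono[OF d(2)] by (simp add: tr_of_real)
  then show ?thesis using d(1) tr_one_pos by (smt (verit) mult_pos_pos)
qed

lemma tr_square_zero: "self_adj H \<Longrightarrow> tr (H * H) = 0 \<Longrightarrow> H = 0"
  using tr_pos_zero[OF pos_square] norm_square_self_adj[of H] by fastforce

lemma tr_self_adj_bound:
  assumes "self_adj K"
  shows "\<bar>tr K\<bar> \<le> norm K * tr 1"
  using tr_mono[OF cle_norm[OF assms]] tr_mono[OF minus_norm_cle[OF assms]]
  by (simp add: tr_of_real tr_minus abs_le_iff)

lemma tr_bound: "\<bar>tr x\<bar> \<le> norm x * tr 1"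
proof -
  have "norm (re_part x) \<le> norm x"
    using norm_triangle_ineq[of x "adj x"] by (simp add: re_part_def norm_adj)
  then have "norm (re_part x) * tr 1 \<le> norm x * tr 1" using tr_one_pos by (intro mult_right_mono) auto
  then show ?thesis
    using tr_self_adj_bound[OF self_adj_re_part, of x] by (simp add: tr_re_part[symmetric])
qed

lemma bounded_linear_tr: "bounded_linear tr"
  by (rule bounded_linear_intro[where K = "tr 1"]) (simp_all add: tr_linear tr_bound)

lemma tr_mult_bound:
  assumes "cs_positive M" "self_adj Y"
  shows "\<bar>tr (M * Y)\<bar> \<le> norm Y * tr M"
proof -
  obtain k where k: "self_adj k" "k * k = M" using pos_root[OF assms(1)] by metis
  have e: "tr (M * Y) = tr (k * Y * k)" using tr_commute[of k "k * Y"] by (simp add: k(2)[symmetric] mult.assoc)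
  have e2: "k * of_real (norm Y) * k = norm Y *\<^sub>R M"
    by (simp add: k(2)[symmetric] of_real_def)
  have "tr (k * Y * k) \<le> tr (k * of_real (norm Y) * k)"
    by (intro tr_mono cle_conj cle_norm assms k)
  moreover have "tr (k * (- of_real (norm Y)) * k) \<le> tr (k * Y * k)"
    by (intro tr_mono cle_conj minus_norm_cle assms k)
  ultimately show ?thesis unfolding e by (simp add: e2 tr_linear abs_le_iff)
qed

text \<open>The (real) value of the relative entropy, with \<open>\<tau> (X L)\<close> symmetrised to
\<open>\<tau> (X\<^sup>1\<^sup>/\<^sup>2 L X\<^sup>1\<^sup>/\<^sup>2)\<close>.\<close>

definition sbs :: "'a \<Rightarrow> 'a \<Rightarrow> real" where
  "sbs X A = tr (cs_sqrt X * cs_log (cs_sqrt X * cs_inv A * cs_sqrt X) * cs_sqrt X)"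

lemma sbs_arg_pos_inv: "X \<in> pos_inv \<Longrightarrow> A \<in> pos_inv \<Longrightarrow> cs_sqrt X * cs_inv A * cs_sqrt X \<in> pos_inv"
  by (intro pos_inv_conj(1) pos_inv_cs_inv pos_inv_cs_sqrt(1))

lemma S_BS_eq_sbs:
  assumes "X \<in> pos_inv" "A \<in> pos_inv"
  shows "S_BS \<tau> X A = of_real (sbs X A)"
proof -
  let ?x = "cs_sqrt X" and ?L = "cs_log (cs_sqrt X * cs_inv A * cs_sqrt X)"
  note x = pos_inv_cs_sqrt[OF assms(1)]
  have "\<tau> (X * ?L) = \<tau> (?x * (?x * ?L))" by (simp add: x(3) flip: mult.assoc)
  also have "\<dots> = \<tau> (?x * ?L * ?x)" by (rule tau_commute)
  also have "\<dots> = of_real (tr (?x * ?L * ?x))"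
    by (rule tau_self_adj)
       (simp only: adj_mult x(2) cs_log(1)[OF sbs_arg_pos_inv[OF assms]], simp only: mult.assoc)
  finally show ?thesis by (simp add: S_BS_def sbs_def)
qed

lemma sbs_functional:
  fixes x A :: 'a
  assumes "self_adj x"
  shows "bounded_linear (\<lambda>L. tr (x * L * x))" "cs_positive A \<Longrightarrow> tr (x * A * x) \<ge> 0"
proof -
  have "bounded_linear (\<lambda>L. x * L * x)"
    by (rule bounded_linear_compose[OF bounded_linear_mult_left bounded_linear_mult_right])
  then show "bounded_linear (\<lambda>L. tr (x * L * x))" by (rule bounded_linear_compose[OF bounded_linear_tr])
  show "cs_positive A \<Longrightarrow> tr (x * A * x) \<ge> 0" by (intro tr_pos pos_conj_self_adj assms)
qed

text \<open>Scalars leave the logarithm as an additive constant, so the entropy on the whole cone is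
  determined by its values on densities together with the traces.\<close>

lemma sbs_scale:
  assumes "X \<in> pos_inv" "A \<in> pos_inv" "s > 0" "r > 0"
  shows "sbs (s *\<^sub>R X) (r *\<^sub>R A) = s * (sbs X A + ln (s / r) * tr X)"
proof -
  let ?x = "cs_sqrt X" and ?W = "cs_sqrt X * cs_inv A * cs_sqrt X"
  note x = pos_inv_cs_sqrt[OF assms(1)]
  have sx: "cs_sqrt (s *\<^sub>R X) = sqrt s *\<^sub>R ?x"
    by (rule cs_sqrt_unique) (use x assms pos_invD(1)[OF x(1)] in \<open>simp_all add: pos_scaleR\<close>)
  have "cs_sqrt (s *\<^sub>R X) * cs_inv (r *\<^sub>R A) * cs_sqrt (s *\<^sub>R X) = (s / r) *\<^sub>R ?W"
    using assms by (simp add: sx cs_inv_scaleR)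
  then have "cs_log (cs_sqrt (s *\<^sub>R X) * cs_inv (r *\<^sub>R A) * cs_sqrt (s *\<^sub>R X)) = of_real (ln (s/r)) + cs_log ?W"
    using cs_log_scaleR[OF sbs_arg_pos_inv[OF assms(1,2)], of "s/r"] assms by simp
  then have "sbs (s *\<^sub>R X) (r *\<^sub>R A)
      = tr ((sqrt s *\<^sub>R ?x) * (of_real (ln (s/r)) + cs_log ?W) * (sqrt s *\<^sub>R ?x))"
    unfolding sbs_def by (simp only: sx)
  also have "(sqrt s *\<^sub>R ?x) * (of_real (ln (s/r)) + cs_log ?W) * (sqrt s *\<^sub>R ?x)
      = (sqrt s * sqrt s) *\<^sub>R (?x * cs_log ?W * ?x + ln (s/r) *\<^sub>R X)"
    by (simp add: distrib_left distrib_right scaleR_add_right of_real_def x(3)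
        del: real_sqrt_mult_self)
  finally have "sbs (s *\<^sub>R X) (r *\<^sub>R A) = tr (s *\<^sub>R (?x * cs_log ?W * ?x + ln (s/r) *\<^sub>R X))"
    using assms(3) by simp
  then show ?thesis by (simp add: tr_linear sbs_def)
qed

lemma sbs_antimono:
  assumes "X \<in> pos_inv" "A \<in> pos_inv" "A \<preceq> B"
  shows "sbs X B \<le> sbs X A"
proof -
  note x = pos_inv_cs_sqrt[OF assms(1)]
  have B: "B \<in> pos_inv" using pos_inv_cle assms by blast
  have "cs_sqrt X * cs_inv B * cs_sqrt X \<preceq> cs_sqrt X * cs_inv A * cs_sqrt X"
    by (intro cle_conj cs_inv_antimono assms x)
  then show ?thesis unfolding sbs_def
    by (intro functional_cs_log_mono[OF sbs_functional[OF x(2)]] sbs_arg_pos_inv[OF assms(1) B])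
qed

text \<open>If \<open>A \<preceq> B\<close> fails, then \<open>K = B\<^sup>-\<^sup>1 - A\<^sup>-\<^sup>1 - \<delta>\<close> has a nonzero positive part \<open>f\<close> for some
\<open>\<delta> > 0\<close>, and \<open>X = f\<^sup>2 + \<epsilon>\<close> detects this. The error from regularising \<open>f\<^sup>2\<close> is controlled by
\<open>tr (x P x) = h tr B\<close> with \<open>P = h (x B\<^sup>-\<^sup>1 x)\<^sup>-\<^sup>1\<close> and \<open>x\<^sup>2 = X\<close>.\<close>

lemma cle_if_sbs_antimono:
  assumes A: "A \<in> pos_inv" and B: "B \<in> pos_inv"
    and S: "\<And>X. X \<in> pos_inv \<Longrightarrow> sbs X B \<le> sbs X A"
  shows "A \<preceq> B"
proof (rule ccontr)
  assume nle: "\<not> A \<preceq> B"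
  define iA iB G where "iA = cs_inv A" and "iB = cs_inv B" and "G = iB - iA"
  have i: "iA \<in> pos_inv" "iB \<in> pos_inv" using pos_inv_cs_inv A B by (auto simp: iA_def iB_def)
  have ninv: "\<not> cs_positive (- G)"
  proof
    assume "cs_positive (- G)"
    then have "iB \<preceq> iA" by (simp add: G_def cle_def)
    then have "cs_inv iA \<preceq> cs_inv iB" by (rule cs_inv_antimono[OF i(2)])
    then show False using nle by (simp add: iA_def iB_def cs_inv_cs_inv A B)
  qed
  \<comment> \<open>The positive cone is closed, so failure of G \<le> 0 persists with some margin
    \<delta>.\<close>
  have "\<exists>n. \<not> cs_positive (of_real (1 / real (Suc n)) - G)"
  proof (rule ccontr)
    assume "\<nexists>n. \<not> cs_positive (of_real (1 / real (Suc n)) - G)"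
    then have all: "cs_positive (of_real (1 / real (Suc n)) - G)" for n by blast
    have "(\<lambda>n. of_real (1 / real (Suc n)) - G) \<longlonglongrightarrow> of_real 0 - G"
      by (intro tendsto_intros LIMSEQ_Suc[OF lim_1_over_n])
    then have "cs_positive (of_real 0 - G)" by (rule pos_limit) (rule all)
    then show False using ninv by simp
  qed
  then obtain n where n: "\<not> cs_positive (of_real (1 / real (Suc n)) - G)" ..
  define \<delta> where "\<delta> = 1 / real (Suc n)"
  have \<delta>: "\<delta> > 0" "\<not> cs_positive (of_real \<delta> - G)" using n unfolding \<delta>_def by simp_all
  define K where "K = G - of_real \<delta>"
  have sK: "self_adj K" by (simp add: K_def G_def adj_diff adj_of_real pos_invD(3) i)
  obtain f where f: "self_adj f" "f * f = K * f" "f * K = K * f" "cs_positive (f * K * f)"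
    and f0: "f = 0 \<Longrightarrow> cs_positive (- K)" by (rule pos_part[OF sK]) blast
  have fne: "f \<noteq> 0" using f0 \<delta>(2) by (auto simp: K_def)
  define a where "a = norm iA"
  have "iA \<noteq> 0" using pos_invD(4)[OF i(1)] by auto
  then have a: "a > 0" "iA \<preceq> of_real a"
    using cle_norm[OF pos_invD(3)[OF i(1)]] by (simp_all add: a_def)
  \<comment> \<open>Chosen so that \<kappa> W \<le> \<delta> X, using W \<le> a X; the margin
    \<delta> thereby becomes a multiplicative gain 1 + \<kappa> inside the logarithm.\<close>
  define \<kappa> where "\<kappa> = \<delta> / a"
  have \<kappa>: "\<kappa> > 0" using a \<delta> by (simp add: \<kappa>_def)
  define c where "c = ln (1 + \<kappa>) * tr (f * f)"
  have "tr (f * f) > 0" using tr_square_zero[OF f(1)] tr_pos[OF pos_square[OF f(1)]] fne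
    by (metis less_eq_real_def)
  then have c: "c > 0" using \<kappa> by (simp add: c_def)
  \<comment> \<open>The gain c is independent of \<epsilon> while the regularisation error is linear
    in it, so a small \<epsilon> gives the contradiction.\<close>
  have main: "c \<le> \<epsilon> * (norm K * tr B)" if \<epsilon>: "\<epsilon> > 0" for \<epsilon>
  proof -
    define X where "X = f * f + of_real \<epsilon>"
    have X: "X \<in> pos_inv" unfolding X_def
      using pos_inv_add_pos[OF pos_inv_of_real[OF \<epsilon>] pos_square[OF f(1)]] by (simp add: add.commute)
    define x where "x = cs_sqrt X"
    have x: "x \<in> pos_inv" "self_adj x" "x * x = X" using pos_inv_cs_sqrt[OF X] by (simp_all add: x_def)
    have Kff: "K * (f * f) = (f * f) * K" by (metis f(3) mult.assoc)
    have KX: "K * X = X * K" by (simp add: X_def distrib_left distrib_right Kff) (simp add: of_real_def)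
    have Kx: "K * x = x * K" unfolding x_def by (rule cs_sqrt(3)[OF pos_invD(1)[OF X] KX])
    define W V where "W = x * iA * x" and "V = x * iB * x"
    have WV: "W \<in> pos_inv" "V \<in> pos_inv" unfolding W_def V_def by (intro pos_inv_conj(1) i x)+
    \<comment> \<open>The smallest scalar guaranteed by the norm to make \<epsilon> K + h positive;
      K itself has no definite sign.\<close>
    define h where "h = \<epsilon> * norm K"
    have h: "h \<ge> 0" using \<epsilon> by (simp add: h_def)
    have "V - W = x * K * x + \<delta> *\<^sub>R X"
      by (simp add: V_def W_def K_def G_def algebra_simps of_real_def flip: x(3))
    also have "x * K * x = f * K * f + \<epsilon> *\<^sub>R K"
    proof -
      have "x * K * x = K * X" by (simp add: Kx[symmetric] x(3)[symmetric] mult.assoc)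
      also have "\<dots> = f * K * f + \<epsilon> *\<^sub>R K"
        by (simp add: X_def distrib_left f(3) mult.assoc) (simp add: of_real_def)
      finally show ?thesis .
    qed
    finally have VW: "V - W = f * K * f + \<epsilon> *\<^sub>R K + \<delta> *\<^sub>R X" .
    have p1: "cs_positive (\<epsilon> *\<^sub>R K + of_real h)"
    proof -
      have "cs_positive (\<epsilon> *\<^sub>R (K + of_real (norm K)))"
        using minus_norm_cle[OF sK] \<epsilon> by (intro pos_scaleR) (simp_all add: cle_def)
      then show ?thesis by (simp add: h_def algebra_simps of_real_def)
    qed
    have p2: "cs_positive (\<delta> *\<^sub>R X - \<kappa> *\<^sub>R W)"
    proof -
      have "W \<preceq> x * of_real a * x" unfolding W_def by (intro cle_conj a x)
      also have "x * of_real a * x = a *\<^sub>R X" by (simp add: of_real_def x(3))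
      finally have "\<kappa> *\<^sub>R W \<preceq> \<kappa> *\<^sub>R (a *\<^sub>R X)" using \<kappa> by (intro cle_scaleR) auto
      then show ?thesis using a by (simp add: cle_def \<kappa>_def)
    qed
    have "(V + of_real h) - (1 + \<kappa>) *\<^sub>R W = (V - W) + of_real h - \<kappa> *\<^sub>R W" by (simp add: algebra_simps)
    also have "\<dots> = f * K * f + (\<epsilon> *\<^sub>R K + of_real h) + (\<delta> *\<^sub>R X - \<kappa> *\<^sub>R W)"
      by (simp add: VW)
    finally have e: "(V + of_real h) - (1 + \<kappa>) *\<^sub>R W
        = f * K * f + (\<epsilon> *\<^sub>R K + of_real h) + (\<delta> *\<^sub>R X - \<kappa> *\<^sub>R W)" .
    have le: "(1 + \<kappa>) *\<^sub>R W \<preceq> V + of_real h"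
      unfolding cle_def e by (rule pos_add[OF pos_add[OF f(4) p1] p2])
    let ?p = "\<lambda>L. tr (x * L * x)"
    note p = sbs_functional[OF x(2)]
    have sA: "sbs X A = ?p (cs_log W)" and sB: "sbs X B = ?p (cs_log V)"
      by (simp_all add: sbs_def W_def V_def x_def iA_def iB_def)
    have "?p (cs_log ((1 + \<kappa>) *\<^sub>R W)) \<le> ?p (cs_log (V + of_real h))"
      by (rule functional_cs_log_mono[OF p _ le]) (use WV \<kappa> in \<open>auto intro: pos_inv_scaleR\<close>)
    moreover have "?p (cs_log ((1 + \<kappa>) *\<^sub>R W)) = ln (1 + \<kappa>) * tr X + sbs X A"
      using cs_log_scaleR[OF WV(1), of "1 + \<kappa>"] \<kappa>
      by (simp add: sA distrib_left distrib_right tr_linear of_real_def x(3))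
    moreover have "?p (cs_log (V + of_real h)) \<le> sbs X B + h * tr B"
    proof -
      define P where "P = h *\<^sub>R cs_inv V"
      have P: "cs_positive P" unfolding P_def
        using pos_scaleR pos_inv_cs_inv[OF WV(2)] pos_invD(1) h by blast
      have "V + of_real h = V * (1 + P)"
        by (simp add: P_def distrib_left pos_invD(4)[OF WV(2)] of_real_def)
      moreover have "cs_log (V * (1 + P)) = cs_log V + cs_log (1 + P)"
        by (rule cs_log_mult)
           (simp_all add: WV pos_inv_add_pos pos_inv_one P, simp add: P_def algebra_simps pos_invD(4,5)[OF WV(2)])
      ultimately have "?p (cs_log (V + of_real h)) = sbs X B + ?p (cs_log (1 + P))"
        by (simp add: sB distrib_left distrib_right tr_linear)
      also have "?p (cs_log (1 + P)) \<le> ?p P"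
        by (rule functional_cs_log_one_plus_le[OF p P])
      also have "x * P * x = h *\<^sub>R B"
      proof -
        have "cs_inv V = cs_inv x * B * cs_inv x"
          using pos_inv_conj(2)[OF i(2) x(1)] by (simp add: V_def iB_def cs_inv_cs_inv[OF B])
        then show ?thesis
          by (simp add: P_def mult.assoc pos_inv_assoc[OF x(1)] pos_invD(5)[OF x(1)])
      qed
      finally show ?thesis by (simp add: tr_linear)
    qed
    ultimately have "ln (1 + \<kappa>) * tr X \<le> h * tr B" using S[OF X] by linarith
    moreover have "ln (1 + \<kappa>) * tr (f * f) \<le> ln (1 + \<kappa>) * tr X"
      using \<kappa> \<epsilon> tr_one_pos by (intro mult_left_mono) (simp_all add: X_def tr_linear)
    ultimately show ?thesis by (simp add: c_def h_def mult.assoc)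
  qed
  define d where "d = norm K * tr B"
  have d: "d \<ge> 0" using tr_pos_inv[OF B] by (simp add: d_def)
  have "c \<le> c / (2 * (d + 1)) * d" using main[of "c / (2 * (d + 1))"] c d by (simp add: d_def)
  also have "\<dots> \<le> c / 2" using c d by (simp add: divide_simps)
  finally show False using c by simp
qed

text \<open>With a the root of A, A + tH = a(1 + tQ)a for Q = a^-1 H a^-1. The entropy is then -tr(a
  log(1 + tQ) a), and the expansion of the logarithm yields the linear term -t tr H, the stated
  quadratic term and an error of order t^3.\<close>

lemma sbs_second_order:
  assumes A: "A \<in> pos_inv" and H: "self_adj H"
  shows "((\<lambda>t. (sbs A (A + t *\<^sub>R H) + t * tr H) / t\<^sup>2) \<longlongrightarrow> tr (H * cs_inv A * H) / 2) (at_right 0)"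
proof -
  define a b where "a = cs_sqrt A" and "b = cs_inv a"
  have a: "a \<in> pos_inv" "self_adj a" "a * a = A" "cs_inv A = b * b"
    using pos_inv_cs_sqrt[OF A] by (simp_all add: a_def b_def)
  have b: "b \<in> pos_inv" "self_adj b" "cs_inv b = a"
    using pos_inv_cs_inv[OF a(1)] pos_invD(3) cs_inv_cs_inv[OF a(1)] by (auto simp: b_def)
  have ab: "a * b = 1" "b * a = 1" "a * (b * x) = x" "b * (a * x) = x" for x
    using pos_invD[OF a(1)] pos_inv_assoc[OF a(1)] by (simp_all add: b_def)
  define Q where "Q = b * H * b"
  have sQ: "self_adj Q" by (simp add: Q_def adj_mult b(2) H mult.assoc)
  define C where "C = tr 1 * (norm a * norm a) * (2 * norm Q ^ 3)"
  have C: "C \<ge> 0" using tr_one_pos by (simp add: C_def)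
  define r where "r = 1 / (2 * (norm Q + 1))"
  have r: "r > 0" by (simp add: r_def add_nonneg_pos)
  have est: "\<bar>(sbs A (A + t *\<^sub>R H) + t * tr H) / t\<^sup>2 - tr (H * cs_inv A * H) / 2\<bar> \<le> C * t"
    if t: "0 < t" "t < r" for t
  proof -
    define P where "P = t *\<^sub>R Q"
    have sP: "self_adj P" by (simp add: P_def adj_scaleR sQ)
    have "t * norm Q \<le> r * norm Q" using t by (intro mult_right_mono) auto
    also have "\<dots> \<le> 1/2" using norm_ge_zero[of Q] unfolding r_def
      by (simp add: add_nonneg_pos pos_divide_le_eq[of "2 * norm Q + 2"])
    finally have nP: "norm P \<le> 1/2" using t by (simp add: P_def)
    note L = cs_log_second_order[OF sP nP]
    have "b * (A + t *\<^sub>R H) * b = 1 + P"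
      by (simp add: distrib_left distrib_right P_def Q_def mult.assoc ab flip: a(3))
    then have AH: "a * (1 + P) * a = A + t *\<^sub>R H"
      by (metis ab(1,2) mult.assoc mult_1_left mult_1_right)
    then have "cs_inv (A + t *\<^sub>R H) = b * cs_inv (1 + P) * b"
      using pos_inv_conj(2)[OF L(1) a(1)] by (simp add: b_def)
    then have "a * cs_inv (A + t *\<^sub>R H) * a = cs_inv (1 + P)" by (simp add: mult.assoc ab)
    then have s: "sbs A (A + t *\<^sub>R H) = - tr (a * cs_log (1 + P) * a)"
      using cs_log_cs_inv[OF L(1)] by (simp add: sbs_def tr_linear flip: a_def)
    define E where "E = cs_log (1 + P) - (P - (1/2) *\<^sub>R (P * P))"
    have "tr (a * cs_log (1 + P) * a) = tr (a * E * a) + tr (a * P * a) - tr (a * (P * P) * a) / 2"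
      by (simp add: E_def algebra_simps tr_linear)
    moreover have "a * P * a = t *\<^sub>R H" by (simp add: P_def Q_def mult.assoc ab)
    moreover have "a * (P * P) * a = t\<^sup>2 *\<^sub>R (H * cs_inv A * H)"
      by (simp add: P_def Q_def mult.assoc ab a(4) power2_eq_square)
    ultimately have u: "sbs A (A + t *\<^sub>R H) + t * tr H = t\<^sup>2 * (tr (H * cs_inv A * H) / 2) - tr (a * E * a)"
      by (simp add: s tr_linear)
    have e: "(sbs A (A + t *\<^sub>R H) + t * tr H) / t\<^sup>2 - tr (H * cs_inv A * H) / 2 = - tr (a * E * a) / t\<^sup>2"
      unfolding u using t by (simp add: diff_divide_distrib)
    have "norm (a * E * a) \<le> norm a * norm E * norm a"
      by (metis (no_types, lifting) mult_right_mono norm_ge_zero norm_mult_ineq order_trans)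
    also have "\<dots> \<le> norm a * (2 * norm P ^ 3) * norm a"
      using L(2) by (intro mult_right_mono mult_left_mono) (auto simp: E_def)
    finally have "norm (a * E * a) \<le> (norm a * norm a) * (2 * norm P ^ 3)" by (simp add: mult_ac)
    then have "tr 1 * norm (a * E * a) \<le> tr 1 * ((norm a * norm a) * (2 * norm P ^ 3))"
      using tr_one_pos by (intro mult_left_mono) auto
    then have "\<bar>tr (a * E * a)\<bar> \<le> C * t ^ 3"
      using tr_bound[of "a * E * a"] t by (simp add: C_def P_def power_mult_distrib mult_ac)
    then have "\<bar>tr (a * E * a)\<bar> / t\<^sup>2 \<le> C * t ^ 3 / t\<^sup>2" using t by (intro divide_right_mono) auto
    also have "\<dots> = C * t" using t by (simp add: power2_eq_square power3_eq_cube)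
    finally show ?thesis unfolding e by simp
  qed
  have "((\<lambda>t. (sbs A (A + t *\<^sub>R H) + t * tr H) / t\<^sup>2 - tr (H * cs_inv A * H) / 2) \<longlongrightarrow> 0) (at_right 0)"
  proof (rule Lim_null_comparison)
    show "\<forall>\<^sub>F t in at_right 0. norm ((sbs A (A + t *\<^sub>R H) + t * tr H) / t\<^sup>2 - tr (H * cs_inv A * H) / 2) \<le> C * t"
      using est r by (auto simp: eventually_at_right_field)
    have "((\<lambda>t. C * t) \<longlongrightarrow> C * 0) (at_right (0::real))" by (intro tendsto_intros)
    then show "((\<lambda>t. C * t) \<longlongrightarrow> 0) (at_right (0::real))" by simp
  qed
  then show ?thesis by (simp add: LIM_zero_iff)
qed

end

subsection \<open>The trace distance and midpoints of order intervals\<close>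

context traced
begin

text \<open>On self-adjoint elements this is tr |X - Y|: the value is attained by adding to X the
  positive part of Y - X.\<close>

definition tdist :: "'a \<Rightarrow> 'a \<Rightarrow> real" where
  "tdist X Y = Inf {2 * tr M - tr X - tr Y | M. X \<preceq> M \<and> Y \<preceq> M}"

lemma tdist_bounded: "bdd_below {2 * tr M - tr X - tr Y | M. X \<preceq> M \<and> Y \<preceq> M}"
proof (rule bdd_belowI[of _ 0])
  fix r assume "r \<in> {2 * tr M - tr X - tr Y | M. X \<preceq> M \<and> Y \<preceq> M}"
  then obtain M where "r = 2 * tr M - tr X - tr Y" "X \<preceq> M" "Y \<preceq> M" by blast
  then show "0 \<le> r" using tr_mono[of X M] tr_mono[of Y M] by linarith
qed

lemma tdist_nonempty:
  assumes "self_adj X" "self_adj Y"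
  shows "{2 * tr M - tr X - tr Y | M. X \<preceq> M \<and> Y \<preceq> M} \<noteq> {}"
proof -
  let ?M = "of_real (max (norm X) (norm Y)) :: 'a"
  have "X \<preceq> ?M" "Y \<preceq> ?M"
    by (intro cle_trans[OF cle_norm[OF assms(1)] of_real_cle] max.cobounded1
        cle_trans[OF cle_norm[OF assms(2)] of_real_cle] max.cobounded2)+
  then show ?thesis by blast
qed

lemma tdist_le: "X \<preceq> M \<Longrightarrow> Y \<preceq> M \<Longrightarrow> tdist X Y \<le> 2 * tr M - tr X - tr Y"
  unfolding tdist_def by (rule cInf_lower[OF _ tdist_bounded]) blast

lemma tdist_ge:
  assumes "self_adj X" "self_adj Y" "\<And>M. X \<preceq> M \<Longrightarrow> Y \<preceq> M \<Longrightarrow> c \<le> 2 * tr M - tr X - tr Y"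
  shows "c \<le> tdist X Y"
  unfolding tdist_def by (rule cInf_greatest[OF tdist_nonempty[OF assms(1,2)]]) (use assms(3) in blast)

text \<open>For any upper bound M, H = (M - Y) - (M - X) is a difference of positive elements, so
  tr(H^2) is at most norm H times their total trace; faithfulness does the rest.\<close>

lemma tdist_zero:
  assumes "self_adj X" "self_adj Y" "tdist X Y \<le> 0"
  shows "X = Y"
proof -
  define H where "H = X - Y"
  have sH: "self_adj H" by (simp add: H_def adj_diff assms)
  have b: "tr (H * H) \<le> norm H * e" if e: "e > 0" for e
  proof -
    have "Inf {2 * tr M - tr X - tr Y | M. X \<preceq> M \<and> Y \<preceq> M} < e" using assms(3) e unfolding tdist_def by simp
    then obtain M where M: "X \<preceq> M" "Y \<preceq> M" "2 * tr M - tr X - tr Y < e"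
      using cInf_lessD[OF tdist_nonempty[OF assms(1,2)]] by blast
    have "tr (H * H) = tr ((M - Y) * H) - tr ((M - X) * H)"
      by (simp add: H_def algebra_simps tr_linear)
    also have "\<dots> \<le> norm H * tr (M - Y) + norm H * tr (M - X)"
      using tr_mult_bound[OF _ sH, of "M - Y"] tr_mult_bound[OF _ sH, of "M - X"] M by (simp add: cle_def)
    also have "\<dots> = norm H * (2 * tr M - tr X - tr Y)" by (simp add: tr_linear algebra_simps)
    also have "\<dots> \<le> norm H * e" using M(3) by (intro mult_left_mono) auto
    finally show ?thesis .
  qed
  have "tr (H * H) \<le> 0 + d" if "d > 0" for d
  proof -
    have "tr (H * H) \<le> norm H * (d / (norm H + 1))" by (rule b) (use that in \<open>simp add: add_nonneg_pos\<close>)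
    also have "\<dots> \<le> d" using that by (simp add: divide_simps add_nonneg_pos)
    finally show ?thesis by simp
  qed
  then have "tr (H * H) \<le> 0" by (rule field_le_epsilon)
  then have "H = 0" using tr_square_zero[OF sH] tr_pos[OF pos_square[OF sH]] by simp
  then show ?thesis by (simp add: H_def)
qed

text \<open>An upper bound M of X and Y becomes the upper bound M + s - X - Y of the reflected pair,
  with the same excess trace.\<close>

lemma tdist_reflect:
  assumes "self_adj s" "self_adj X" "self_adj Y"
  shows "tdist (s - X) (s - Y) = tdist X Y"
proof -
  have le: "tdist (s - X) (s - Y) \<le> tdist X Y" if "self_adj X" "self_adj Y" for X Y
  proof (rule tdist_ge[OF that])
    fix M assume M: "X \<preceq> M" "Y \<preceq> M"
    have "tdist (s - X) (s - Y) \<le> 2 * tr (M + (s - X - Y)) - tr (s - X) - tr (s - Y)"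
      by (rule tdist_le) (use M in \<open>simp_all add: cle_def algebra_simps\<close>)
    then show "tdist (s - X) (s - Y) \<le> 2 * tr M - tr X - tr Y" by (simp add: tr_linear)
  qed
  show ?thesis using le[OF assms(2,3)] le[of "s - X" "s - Y"] assms by (simp add: adj_diff)
qed

text \<open>Averaging an upper bound M of s - X and X with X gives an upper bound of s/2 and X with
  half the excess. This is the expansion by 2 in the Mazur-Ulam iteration.\<close>

lemma tdist_double:
  assumes "self_adj s" "self_adj X"
  shows "2 * tdist X ((1/2) *\<^sub>R s) \<le> tdist (s - X) X"
proof (rule tdist_ge)
  fix M assume M: "s - X \<preceq> M" "X \<preceq> M"
  have "(1/2) *\<^sub>R (X + X) \<preceq> (1/2) *\<^sub>R (M + X)" "(1/2) *\<^sub>R (s - X + X) \<preceq> (1/2) *\<^sub>R (M + X)"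
    by (intro cle_scaleR cle_add M cle_refl; simp)+
  then have "tdist X ((1/2) *\<^sub>R s) \<le> 2 * tr ((1/2) *\<^sub>R (M + X)) - tr X - tr ((1/2) *\<^sub>R s)"
    by (intro tdist_le) (simp_all flip: scaleR_2)
  then show "2 * tdist X ((1/2) *\<^sub>R s) \<le> 2 * tr M - tr (s - X) - tr X" by (simp add: tr_linear field_simps)
qed (simp_all add: adj_diff assms)

section \<open>Order intervals and their isometries\<close>

definition interval :: "'a \<Rightarrow> 'a \<Rightarrow> 'a set" where
  "interval A B = {X. A \<preceq> X \<and> X \<preceq> B}"

definition tisometry :: "'a set \<Rightarrow> ('a \<Rightarrow> 'a) \<Rightarrow> bool" where
  "tisometry I g \<longleftrightarrow> bij_betw g I I \<and> (\<forall>x\<in>I. \<forall>y\<in>I. tdist (g x) (g y) = tdist x y)"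

lemma cle_self_adj: "A \<preceq> X \<Longrightarrow> self_adj A \<Longrightarrow> self_adj X"
  unfolding cle_def using pos_self_adj[of "X - A"] by (simp add: adj_diff)

lemma interval_self_adj: "self_adj A \<Longrightarrow> X \<in> interval A B \<Longrightarrow> self_adj X"
  unfolding interval_def using cle_self_adj by blast

lemma interval_reflect: "X \<in> interval A B \<Longrightarrow> A + B - X \<in> interval A B"
  by (simp add: interval_def cle_def algebra_simps)

lemma interval_midpoint:
  assumes "A \<preceq> B"
  shows "(1/2) *\<^sub>R (A + B) \<in> interval A B"
proof -
  have "(1/2) *\<^sub>R (A + A) \<preceq> (1/2) *\<^sub>R (A + B)" "(1/2) *\<^sub>R (A + B) \<preceq> (1/2) *\<^sub>R (B + B)"
    by (intro cle_scaleR cle_add cle_refl assms; simp)+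
  then show ?thesis by (simp add: interval_def flip: scaleR_2)
qed

lemma tisometry_inv:
  assumes "tisometry I g"
  shows "tisometry I (inv_into I g)"
proof -
  have g: "bij_betw g I I" and i: "\<And>x y. x \<in> I \<Longrightarrow> y \<in> I \<Longrightarrow> tdist (g x) (g y) = tdist x y"
    using assms unfolding tisometry_def by auto
  have "tdist (inv_into I g x) (inv_into I g y) = tdist x y" if "x \<in> I" "y \<in> I" for x y
  proof -
    have "inv_into I g x \<in> I" "inv_into I g y \<in> I"
      using bij_betw_inv_into[OF g] that bij_betwE by blast+
    then show ?thesis
      using i[of "inv_into I g x" "inv_into I g y"] that by (simp add: bij_betw_inv_into_right[OF g])
  qed
  then show ?thesis unfolding tisometry_def using bij_betw_inv_into[OF g] by blast
qed

lemma tisometry_comp: "tisometry I f \<Longrightarrow> tisometry I g \<Longrightarrow> tisometry I (f \<circ> g)"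
  unfolding tisometry_def
proof safe
  fix x y
  assume f: "bij_betw f I I" "\<forall>x\<in>I. \<forall>y\<in>I. tdist (f x) (f y) = tdist x y"
    and g: "bij_betw g I I" "\<forall>x\<in>I. \<forall>y\<in>I. tdist (g x) (g y) = tdist x y"
  show "bij_betw (f \<circ> g) I I" by (rule bij_betw_trans[OF g(1) f(1)])
  assume "x \<in> I" "y \<in> I"
  then show "tdist ((f \<circ> g) x) ((f \<circ> g) y) = tdist x y"
    using f(2) g(2) bij_betwE[OF g(1)] by simp
qed

lemma tisometry_reflect:
  assumes "self_adj A" "self_adj B"
  shows "tisometry (interval A B) (\<lambda>X. A + B - X)"
proof -
  have "bij_betw (\<lambda>X. A + B - X) (interval A B) (interval A B)"
    by (rule bij_betw_byWitness[where f' = "\<lambda>X. A + B - X"]) (auto intro: interval_reflect)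
  then show ?thesis unfolding tisometry_def
    using tdist_reflect[of "A + B"] interval_self_adj[OF assms(1)] assms by (simp add: adj_add)
qed

text \<open>The reflection argument of Mazur--Ulam and Vaisala: if \<open>g\<close> moves the midpoint \<open>z\<close> by \<open>r\<close>, then
\<open>\<rho> g\<^sup>-\<^sup>1 \<rho> g\<close>, with \<open>\<rho>\<close> the reflection in \<open>z\<close>, moves it by at least \<open>2 r\<close>.\<close>

lemma tisometry_fixes_midpoint:
  assumes sA: "self_adj A" and AB: "A \<preceq> B" and g: "tisometry (interval A B) g"
  shows "g ((1/2) *\<^sub>R (A + B)) = (1/2) *\<^sub>R (A + B)"
proof -
  define z where "z = (1/2) *\<^sub>R (A + B)"
  define \<rho> where "\<rho> = (\<lambda>X. A + B - X)"
  define I where "I = interval A B"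
  \<comment> \<open>An upper bound for the diameter of the interval, with B as common upper bound;
    it starts the iteration.\<close>
  define c where "c = 2 * tr B - 2 * tr A"
  have sB: "self_adj B" using cle_self_adj AB sA by blast
  have z: "z \<in> I" unfolding z_def I_def by (rule interval_midpoint[OF AB])
  have \<rho>z: "\<rho> z = z" unfolding \<rho>_def z_def
    using scaleR_half_double[of "A + B"] by (metis add_diff_cancel_right' scaleR_right_distrib)
  have sI: "self_adj X" if "X \<in> I" for X using interval_self_adj sA that by (auto simp: I_def)
  have \<rho>: "tisometry I \<rho>" unfolding I_def \<rho>_def by (rule tisometry_reflect[OF sA sB])
  have in_I: "f X \<in> I" if "tisometry I f" "X \<in> I" for f X
    using that bij_betwE unfolding tisometry_def by blast
  have iso: "tdist (f X) (f Y) = tdist X Y" if "tisometry I f" "X \<in> I" "Y \<in> I" for f X Y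
    using that unfolding tisometry_def by blast
  \<comment> \<open>The bound must cover all isometries at once, because the step for g applies the
    hypothesis to another isometry built from g.\<close>
  have "\<forall>g. tisometry I g \<longrightarrow> tdist (g z) z \<le> c / 2 ^ n" for n
  proof (induction n)
    case 0
    show ?case
    proof (intro allI impI)
      fix g assume "tisometry I g"
      then have "g z \<in> I" using in_I z by blast
      then have i: "A \<preceq> g z" "g z \<preceq> B" "A \<preceq> z" "z \<preceq> B" using z by (auto simp: I_def interval_def)
      have "tdist (g z) z \<le> 2 * tr B - tr (g z) - tr z" using tdist_le i by blast
      then show "tdist (g z) z \<le> c / 2 ^ 0" using tr_mono[OF i(1)] tr_mono[OF i(3)] by (simp add: c_def)
    qed
  next
    case (Suc n)
    show ?case
    proof (intro allI impI)
      fix g assume g: "tisometry I g"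
      define k where "k = inv_into I g"
      have k: "tisometry I k" unfolding k_def by (rule tisometry_inv[OF g])
      have gk: "g (k x) = x" if "x \<in> I" for x
        unfolding k_def using bij_betw_inv_into_right[of g I I x] g that by (simp add: tisometry_def)
      have gz: "g z \<in> I" "\<rho> (g z) \<in> I" using in_I[OF g z] in_I[OF \<rho>] by blast+
      have kI: "k (\<rho> (g z)) \<in> I" using in_I[OF k gz(2)] .
      have "tisometry I (\<rho> \<circ> (k \<circ> (\<rho> \<circ> g)))" by (intro tisometry_comp \<rho> k g)
      then have "tdist (\<rho> (k (\<rho> (g z)))) z \<le> c / 2 ^ n" using Suc.IH by fastforce
      also have "tdist (\<rho> (k (\<rho> (g z)))) z = tdist (k (\<rho> (g z))) z"
        using iso[OF \<rho> kI z] \<rho>z by simp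
      also have "\<dots> = tdist (\<rho> (g z)) (g z)" using iso[OF g kI z] gk[OF gz(2)] by simp
      finally have "tdist (A + B - g z) (g z) \<le> c / 2 ^ n" by (simp add: \<rho>_def)
      then have "2 * tdist (g z) z \<le> c / 2 ^ n"
        using tdist_double[of "A + B" "g z"] sA sB sI[OF gz(1)] by (simp add: adj_add z_def)
      then show "tdist (g z) z \<le> c / 2 ^ Suc n" by simp
    qed
  qed
  then have b: "tdist (g z) z \<le> c / 2 ^ n" for n using g by (simp add: I_def)
  have "(\<lambda>n. c / 2 ^ n) \<longlonglongrightarrow> 0"
    using tendsto_mult_right[OF LIMSEQ_power_zero[of "1/2 :: real"], of c] by (simp add: power_divide)
  then have "tdist (g z) z \<le> 0" by (rule LIMSEQ_le_const) (use b in blast)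
  moreover have "self_adj (g z)" "self_adj z" using sI in_I g z unfolding I_def by blast+
  ultimately show ?thesis using tdist_zero unfolding z_def by blast
qed

end

locale traced_pair = A: traced \<tau> + B: traced \<omega>
  for \<tau> :: "'a::cstar_algebra \<Rightarrow> complex" and \<omega> :: "'b::cstar_algebra \<Rightarrow> complex"
begin

text \<open>Reflecting in the target, pulling back by F and reflecting in the source is a
  self-isometry of the source interval, so it fixes the midpoint z. Hence F z is fixed by the target
  reflection, which characterises the target midpoint.\<close>

lemma midpoint_preserved:
  assumes sA: "self_adj A" and AB: "A \<preceq> B" and sC: "self_adj C" and CD: "C \<preceq> D"
    and F: "bij_betw F (A.interval A B) (B.interval C D)"
    and iso: "\<And>x y. x \<in> A.interval A B \<Longrightarrow> y \<in> A.interval A B \<Longrightarrow> B.tdist (F x) (F y) = A.tdist x y"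
  shows "F ((1/2) *\<^sub>R (A + B)) = (1/2) *\<^sub>R (C + D)"
proof -
  define I I' where "I = A.interval A B" and "I' = B.interval C D"
  define z where "z = (1/2) *\<^sub>R (A + B)"
  define G where "G = inv_into I F"
  define h where "h = (\<lambda>X. A + B - X) \<circ> (G \<circ> ((\<lambda>X. C + D - X) \<circ> F))"
  have sB: "self_adj B" and sD: "self_adj D" using A.cle_self_adj[OF AB sA] B.cle_self_adj[OF CD sC] .
  note F' = F[folded I_def I'_def]
  have G: "bij_betw G I' I" unfolding G_def by (rule bij_betw_inv_into[OF F'])
  have FG: "F (G y) = y" if "y \<in> I'" for y unfolding G_def by (rule bij_betw_inv_into_right[OF F' that])
  have z: "z \<in> I" unfolding z_def I_def by (rule A.interval_midpoint[OF AB])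
  have r: "A.tisometry I (\<lambda>X. A + B - X)" "B.tisometry I' (\<lambda>X. C + D - X)"
    unfolding I_def I'_def by (rule A.tisometry_reflect[OF sA sB] B.tisometry_reflect[OF sC sD])+
  have Gi: "A.tdist (G x) (G y) = B.tdist x y" if "x \<in> I'" "y \<in> I'" for x y
  proof -
    have "G x \<in> I" "G y \<in> I" using G that bij_betwE by blast+
    then show ?thesis using iso[of "G x" "G y"] FG that by (simp add: I_def)
  qed
  have FI: "F x \<in> I'" if "x \<in> I" for x using F' that bij_betwE by blast
  have RI: "C + D - x \<in> I'" if "x \<in> I'" for x using that B.interval_reflect by (simp add: I'_def)
  have "A.tisometry I (G \<circ> ((\<lambda>X. C + D - X) \<circ> F))"
  proof -
    have "bij_betw (G \<circ> ((\<lambda>X. C + D - X) \<circ> F)) I I"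
      using r(2) by (intro bij_betw_trans[OF bij_betw_trans[OF F'] G]) (simp add: B.tisometry_def)
    moreover have "A.tdist (G (C + D - F x)) (G (C + D - F y)) = A.tdist x y" if "x \<in> I" "y \<in> I" for x y
    proof -
      have "A.tdist (G (C + D - F x)) (G (C + D - F y)) = B.tdist (C + D - F x) (C + D - F y)"
        by (intro Gi RI FI that)
      also have "\<dots> = B.tdist (F x) (F y)" using r(2) FI that by (simp add: B.tisometry_def)
      also have "\<dots> = A.tdist x y" using iso that by (simp add: I_def)
      finally show ?thesis .
    qed
    ultimately show ?thesis by (simp add: A.tisometry_def)
  qed
  then have "A.tisometry I h" unfolding h_def by (rule A.tisometry_comp[OF r(1)])
  then have "h z = z" unfolding I_def z_def by (rule A.tisometry_fixes_midpoint[OF sA AB])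
  then have "G (C + D - F z) = A + B - z" by (simp add: h_def algebra_simps)
  also have "\<dots> = z" unfolding z_def
    using scaleR_half_double[of "A + B"] by (metis add_diff_cancel_right' scaleR_right_distrib)
  finally have "C + D - F z = F z" using FG[OF RI[OF FI[OF z]]] by simp
  then have "C + D = F z + F z" by (simp add: algebra_simps)
  then show ?thesis by (simp add: z_def flip: scaleR_2)
qed

end

subsection \<open>Entropy preserving maps are in the standard form\<close>

context traced
begin

lemma density_setD: "A \<in> density_set \<tau> \<Longrightarrow> A \<in> pos_inv" "A \<in> density_set \<tau> \<Longrightarrow> tr A = 1"
  by (simp_all add: density_set_def tr_def)

lemma density_set_normalize: "A \<in> pos_inv \<Longrightarrow> (1 / tr A) *\<^sub>R A \<in> density_set \<tau>"
  using tr_pos_inv[of A] tau_self_adj[OF pos_invD(3), of A]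
  by (simp add: density_set_def pos_inv_scaleR tau_scaleR)

text \<open>Two rounds of the resolvent identity expand the inverse of E + tG to first order. The
  remainder carries one factor of that inverse, whose norm is at most 1/\<delta> for all small t >
  0.\<close>

lemma tr_inverse_derivative:
  assumes E: "E \<in> pos_inv" and G: "self_adj G" and "self_adj H"
  shows "((\<lambda>t. (tr (H * cs_inv E * H) - tr (H * cs_inv (E + t *\<^sub>R G) * H)) / t)
      \<longlongrightarrow> tr (H * cs_inv E * G * cs_inv E * H)) (at_right 0)"
proof -
  obtain \<delta> where \<delta>: "\<delta> > 0" and ev: "\<forall>\<^sub>F t in at_right 0. of_real \<delta> \<preceq> E + t *\<^sub>R G"
    using pos_inv_perturb[OF E G] by blast
  let ?e = "cs_inv E"
  define C where "C = norm (H * ?e * G * ?e * G) * (1 / \<delta>) * norm H * tr 1"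
  have est: "norm ((tr (H * ?e * H) - tr (H * cs_inv (E + t *\<^sub>R G) * H)) / t - tr (H * ?e * G * ?e * H)) \<le> C * t"
    if t: "t > 0" and le: "of_real \<delta> \<preceq> E + t *\<^sub>R G" for t
  proof -
    let ?F = "E + t *\<^sub>R G"
    have F: "?F \<in> pos_inv" using le \<delta> pos_inv_iff by blast
    define f where "f = cs_inv ?F"
    have "?e * ?F * f = ?e" by (simp add: f_def mult.assoc pos_invD(4)[OF F])
    then have ef: "?e = f + t *\<^sub>R (?e * G * f)"
      by (simp add: distrib_left distrib_right pos_invD(5)[OF E])
    have "f = ?e - t *\<^sub>R (?e * G * (?e - t *\<^sub>R (?e * G * f)))" using ef by (metis add_diff_cancel_right')
    then have "H * f * H = H * (?e - t *\<^sub>R (?e * G * (?e - t *\<^sub>R (?e * G * f)))) * H" by simp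
    also have "\<dots> = H * ?e * H - t *\<^sub>R (H * ?e * G * ?e * H) + (t * t) *\<^sub>R (H * ?e * G * ?e * G * f * H)"
      by (simp add: algebra_simps)
    finally have "tr (H * f * H) = tr (H * ?e * H) - t * tr (H * ?e * G * ?e * H)
        + (t * t) * tr (H * ?e * G * ?e * G * f * H)" by (simp add: tr_linear)
    then have e: "(tr (H * ?e * H) - tr (H * f * H)) / t - tr (H * ?e * G * ?e * H)
        = - t * tr (H * ?e * G * ?e * G * f * H)"
      using t by (simp add: field_simps)
    have "norm (H * ?e * G * ?e * G * f * H) \<le> norm (H * ?e * G * ?e * G) * norm f * norm H"
      by (metis (no_types, lifting) mult_right_mono norm_ge_zero norm_mult_ineq order_trans)
    also have "\<dots> \<le> norm (H * ?e * G * ?e * G) * (1 / \<delta>) * norm H"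
      unfolding f_def using norm_cs_inv_le[OF le \<delta>] by (intro mult_right_mono mult_left_mono) auto
    finally have "norm (H * ?e * G * ?e * G * f * H) * tr 1 \<le> C"
      unfolding C_def using tr_one_pos by (intro mult_right_mono) auto
    then have "\<bar>tr (H * ?e * G * ?e * G * f * H)\<bar> \<le> C" using tr_bound order_trans by blast
    then have "t * \<bar>tr (H * ?e * G * ?e * G * f * H)\<bar> \<le> t * C" using t by (intro mult_left_mono) auto
    then show ?thesis using e t by (simp add: f_def abs_mult mult.commute)
  qed
  have "((\<lambda>t. (tr (H * ?e * H) - tr (H * cs_inv (E + t *\<^sub>R G) * H)) / t - tr (H * ?e * G * ?e * H))
      \<longlongrightarrow> 0) (at_right 0)"
  proof (rule Lim_null_comparison)
    show "\<forall>\<^sub>F t in at_right 0. norm ((tr (H * ?e * H) - tr (H * cs_inv (E + t *\<^sub>R G) * H)) / t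
        - tr (H * ?e * G * ?e * H)) \<le> C * t"
      using ev eventually_at_right_less[of 0] by eventually_elim (rule est)
    have "((\<lambda>t. C * t) \<longlongrightarrow> C * 0) (at_right (0::real))" by (intro tendsto_intros)
    then show "((\<lambda>t. C * t) \<longlongrightarrow> 0) (at_right (0::real))" by simp
  qed
  then show ?thesis by (simp add: LIM_zero_iff)
qed

end

text \<open>\<open>\<Phi>\<close> is the positively homogeneous extension of \<open>\<phi>\<close>, \<open>T\<close> its extension to the self-adjoint
part and \<open>L\<close> the complexification of \<open>T\<close>.\<close>

locale bs_map = traced_pair \<tau> \<omega>
  for \<tau> :: "'a::cstar_algebra \<Rightarrow> complex" and \<omega> :: "'b::cstar_algebra \<Rightarrow> complex" +
  fixes \<phi> :: "'a \<Rightarrow> 'b"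
  assumes image: "\<phi> ` density_set \<tau> = density_set \<omega>"
    and preserves: "\<And>A B. A \<in> density_set \<tau> \<Longrightarrow> B \<in> density_set \<tau> \<Longrightarrow>
      S_BS \<omega> (\<phi> A) (\<phi> B) = S_BS \<tau> A B"
begin

section \<open>The homogeneous extension as an order isomorphism of cones\<close>

definition \<Phi> :: "'a \<Rightarrow> 'b" where
  "\<Phi> A = A.tr A *\<^sub>R \<phi> ((1 / A.tr A) *\<^sub>R A)"

lemma Phi_density: "A \<in> density_set \<tau> \<Longrightarrow> \<Phi> A = \<phi> A"
  using A.density_setD by (simp add: \<Phi>_def)

lemma normalized_image: "A \<in> pos_inv \<Longrightarrow> \<phi> ((1 / A.tr A) *\<^sub>R A) \<in> density_set \<omega>"
  using A.density_set_normalize image by blast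

lemma Phi_pos_inv: "A \<in> pos_inv \<Longrightarrow> \<Phi> A \<in> pos_inv"
  unfolding \<Phi>_def using normalized_image B.density_setD(1) A.tr_pos_inv pos_inv_scaleR by blast

lemma tr_Phi: "A \<in> pos_inv \<Longrightarrow> B.tr (\<Phi> A) = A.tr A"
  using B.density_setD(2)[OF normalized_image] by (simp add: \<Phi>_def B.tr_linear)

lemma Phi_scaleR: "r > 0 \<Longrightarrow> \<Phi> (r *\<^sub>R A) = r *\<^sub>R \<Phi> A"
  by (simp add: \<Phi>_def A.tr_linear)

lemma Phi_surj:
  assumes "Y \<in> pos_inv"
  obtains A where "A \<in> pos_inv" "\<Phi> A = Y"
proof -
  have t: "B.tr Y > 0" by (rule B.tr_pos_inv[OF assms])
  have "(1 / B.tr Y) *\<^sub>R Y \<in> \<phi> ` density_set \<tau>"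
    unfolding image by (rule B.density_set_normalize[OF assms])
  then obtain A where A: "A \<in> density_set \<tau>" "\<phi> A = (1 / B.tr Y) *\<^sub>R Y" by force
  show ?thesis
  proof (rule that)
    show "B.tr Y *\<^sub>R A \<in> pos_inv" using pos_inv_scaleR A.density_setD(1) A(1) t by blast
    show "\<Phi> (B.tr Y *\<^sub>R A) = Y" using t by (simp add: Phi_scaleR Phi_density A)
  qed
qed

lemma sbs_Phi:
  assumes X: "X \<in> pos_inv" and A: "A \<in> pos_inv"
  shows "B.sbs (\<Phi> X) (\<Phi> A) = A.sbs X A"
proof -
  define x a where "x = (1 / A.tr X) *\<^sub>R X" and "a = (1 / A.tr A) *\<^sub>R A"
  have t: "A.tr X > 0" "A.tr A > 0" using A.tr_pos_inv X A by auto
  have d: "x \<in> density_set \<tau>" "a \<in> density_set \<tau>"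
    unfolding x_def a_def using A.density_set_normalize X A by auto
  then have d': "\<phi> x \<in> density_set \<omega>" "\<phi> a \<in> density_set \<omega>" using image by auto
  note p = A.density_setD(1)[OF d(1)] A.density_setD(1)[OF d(2)]
    B.density_setD(1)[OF d'(1)] B.density_setD(1)[OF d'(2)]
  have "of_real (B.sbs (\<phi> x) (\<phi> a)) = (of_real (A.sbs x a) :: complex)"
    using preserves[OF d] A.S_BS_eq_sbs[OF p(1,2)] B.S_BS_eq_sbs[OF p(3,4)] by simp
  then have e: "B.sbs (\<phi> x) (\<phi> a) = A.sbs x a" by simp
  have "A.sbs X A = A.sbs (A.tr X *\<^sub>R x) (A.tr A *\<^sub>R a)" using t by (simp add: x_def a_def)
  also have "\<dots> = A.tr X * (A.sbs x a + ln (A.tr X / A.tr A))"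
    using A.sbs_scale[OF p(1,2) t] A.density_setD(2)[OF d(1)] by simp
  also have "\<dots> = B.sbs (A.tr X *\<^sub>R \<phi> x) (A.tr A *\<^sub>R \<phi> a)"
    using B.sbs_scale[OF p(3,4) t] B.density_setD(2)[OF d'(1)] e by simp
  finally show ?thesis by (simp add: \<Phi>_def x_def a_def)
qed

lemma Phi_cle_iff:
  assumes A: "A \<in> pos_inv" and B: "B \<in> pos_inv"
  shows "\<Phi> A \<preceq> \<Phi> B \<longleftrightarrow> A \<preceq> B"
proof
  assume le: "\<Phi> A \<preceq> \<Phi> B"
  show "A \<preceq> B"
  proof (rule A.cle_if_sbs_antimono[OF A B])
    fix X :: 'a assume X: "X \<in> pos_inv"
    show "A.sbs X B \<le> A.sbs X A"
      using B.sbs_antimono[OF Phi_pos_inv[OF X] Phi_pos_inv[OF A] le] by (simp add: sbs_Phi X A B)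
  qed
next
  assume le: "A \<preceq> B"
  show "\<Phi> A \<preceq> \<Phi> B"
  proof (rule B.cle_if_sbs_antimono[OF Phi_pos_inv[OF A] Phi_pos_inv[OF B]])
    fix Y :: 'b assume "Y \<in> pos_inv"
    then obtain X where X: "X \<in> pos_inv" "\<Phi> X = Y" using Phi_surj by blast
    show "B.sbs Y (\<Phi> B) \<le> B.sbs Y (\<Phi> A)"
      using A.sbs_antimono[OF X(1) A le] by (simp add: sbs_Phi X(1) A B flip: X(2))
  qed
qed

text \<open>Only surjectivity is assumed of \<phi>; injectivity comes from order reflection and
  antisymmetry.\<close>

lemma Phi_inj: "A \<in> pos_inv \<Longrightarrow> B \<in> pos_inv \<Longrightarrow> \<Phi> A = \<Phi> B \<Longrightarrow> A = B"
  using Phi_cle_iff cle_antisym cle_refl by metis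

lemma tdist_Phi:
  assumes X: "X \<in> pos_inv" and Y: "Y \<in> pos_inv"
  shows "B.tdist (\<Phi> X) (\<Phi> Y) = A.tdist X Y"
proof -
  have "{2 * B.tr M - B.tr (\<Phi> X) - B.tr (\<Phi> Y) | M. \<Phi> X \<preceq> M \<and> \<Phi> Y \<preceq> M}
      = {2 * A.tr M - A.tr X - A.tr Y | M. X \<preceq> M \<and> Y \<preceq> M}"
  proof (intro subset_antisym subsetI)
    fix r assume "r \<in> {2 * B.tr M - B.tr (\<Phi> X) - B.tr (\<Phi> Y) | M. \<Phi> X \<preceq> M \<and> \<Phi> Y \<preceq> M}"
    then obtain M where M: "r = 2 * B.tr M - B.tr (\<Phi> X) - B.tr (\<Phi> Y)" "\<Phi> X \<preceq> M" "\<Phi> Y \<preceq> M" by blast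
    \<comment> \<open>Anything above a positive invertible element lies in the cone, so the infimum
      over all upper bounds transports through \<Phi>.\<close>
    have "M \<in> pos_inv" by (rule pos_inv_cle[OF Phi_pos_inv[OF X] M(2)])
    then obtain N where N: "N \<in> pos_inv" "\<Phi> N = M" using Phi_surj by blast
    then have "X \<preceq> N" "Y \<preceq> N" using M Phi_cle_iff X Y by auto
    moreover have "r = 2 * A.tr N - A.tr X - A.tr Y" using M(1) N tr_Phi X Y by auto
    ultimately show "r \<in> {2 * A.tr M - A.tr X - A.tr Y | M. X \<preceq> M \<and> Y \<preceq> M}" by blast
  next
    fix r assume "r \<in> {2 * A.tr M - A.tr X - A.tr Y | M. X \<preceq> M \<and> Y \<preceq> M}"
    then obtain M where M: "r = 2 * A.tr M - A.tr X - A.tr Y" "X \<preceq> M" "Y \<preceq> M" by blast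
    have N: "M \<in> pos_inv" by (rule pos_inv_cle[OF X M(2)])
    have "\<Phi> X \<preceq> \<Phi> M" "\<Phi> Y \<preceq> \<Phi> M" using M Phi_cle_iff X Y N by auto
    moreover have "r = 2 * B.tr (\<Phi> M) - B.tr (\<Phi> X) - B.tr (\<Phi> Y)" using M(1) N tr_Phi X Y by auto
    ultimately show "r \<in> {2 * B.tr M - B.tr (\<Phi> X) - B.tr (\<Phi> Y) | M. \<Phi> X \<preceq> M \<and> \<Phi> Y \<preceq> M}" by blast
  qed
  then show ?thesis by (simp add: A.tdist_def B.tdist_def)
qed

text \<open>For comparable elements \<Phi> maps the order interval isometrically onto the one
  between the images, so midpoints correspond; homogeneity removes the factor 1/2.\<close>

lemma Phi_add_cle:
  assumes A: "A \<in> pos_inv" and AB: "A \<preceq> B"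
  shows "\<Phi> (A + B) = \<Phi> A + \<Phi> B"
proof -
  have B: "B \<in> pos_inv" by (rule pos_inv_cle[OF A AB])
  have p: "X \<in> pos_inv" if "X \<in> A.interval A B" for X
    using that pos_inv_cle[OF A] by (auto simp: A.interval_def)
  have "bij_betw \<Phi> (A.interval A B) (B.interval (\<Phi> A) (\<Phi> B))"
    unfolding bij_betw_def
  proof
    show "inj_on \<Phi> (A.interval A B)" by (rule inj_onI) (use Phi_inj p in blast)
    show "\<Phi> ` A.interval A B = B.interval (\<Phi> A) (\<Phi> B)"
    proof (intro subset_antisym subsetI)
      fix Y assume "Y \<in> \<Phi> ` A.interval A B"
      then obtain X where X: "X \<in> A.interval A B" "Y = \<Phi> X" by blast
      then show "Y \<in> B.interval (\<Phi> A) (\<Phi> B)"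
        using Phi_cle_iff[OF A p[OF X(1)]] Phi_cle_iff[OF p[OF X(1)] B]
        by (simp add: A.interval_def B.interval_def)
    next
      fix Y assume Y: "Y \<in> B.interval (\<Phi> A) (\<Phi> B)"
      then have "Y \<in> pos_inv" using pos_inv_cle[OF Phi_pos_inv[OF A]] by (auto simp: B.interval_def)
      then obtain X where X: "X \<in> pos_inv" "\<Phi> X = Y" using Phi_surj by blast
      then have "X \<in> A.interval A B"
        using Y Phi_cle_iff[OF A X(1)] Phi_cle_iff[OF X(1) B]
        by (simp add: A.interval_def B.interval_def)
      then show "Y \<in> \<Phi> ` A.interval A B" using X(2) by blast
    qed
  qed
  then have "\<Phi> ((1/2) *\<^sub>R (A + B)) = (1/2) *\<^sub>R (\<Phi> A + \<Phi> B)"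
    by (rule midpoint_preserved[OF pos_invD(3)[OF A] AB pos_invD(3)[OF Phi_pos_inv[OF A]]
          Phi_cle_iff[OF A B, THEN iffD2, OF AB]])
       (intro tdist_Phi p)
  then show ?thesis by (simp only: Phi_scaleR[of "1/2"] zero_less_divide_1_iff zero_less_numeral) simp
qed

text \<open>Adding a large multiple sB makes both groupings of A + B + sB comparable: (A + B) with
  sB, and A with (1 + s)B. Evaluating both and cancelling gives additivity for arbitrary
  pairs.\<close>

lemma Phi_add:
  assumes A: "A \<in> pos_inv" and B: "B \<in> pos_inv"
  shows "\<Phi> (A + B) = \<Phi> A + \<Phi> B"
proof -
  have AB: "A + B \<in> pos_inv" by (rule pos_inv_add[OF A B])
  obtain s where s: "s > 0" "A + B \<preceq> s *\<^sub>R B"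
    using pos_inv_dominates[OF B pos_invD(3)[OF AB]] by blast
  have "A \<preceq> A + B" using pos_invD(1)[OF B] by (simp add: cle_def)
  also note s(2)
  also have "s *\<^sub>R B \<preceq> (1 + s) *\<^sub>R B" using pos_invD(1)[OF B] by (simp add: cle_def algebra_simps)
  finally have 1: "A \<preceq> (1 + s) *\<^sub>R B" .
  have "\<Phi> (A + B) + s *\<^sub>R \<Phi> B = \<Phi> (A + B + s *\<^sub>R B)"
    using Phi_add_cle[OF AB s(2)] Phi_scaleR[OF s(1)] by simp
  also have "\<dots> = \<Phi> (A + (1 + s) *\<^sub>R B)" by (simp add: algebra_simps)
  also have "\<dots> = \<Phi> A + (1 + s) *\<^sub>R \<Phi> B"
    using Phi_add_cle[OF A 1] Phi_scaleR[of "1 + s"] s(1) by simp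
  finally show ?thesis by (simp add: algebra_simps)
qed

section \<open>The real linear extension to self-adjoint elements\<close>

definition T :: "'a \<Rightarrow> 'b" where
  "T X = \<Phi> (X + of_real (norm X + 1)) - \<Phi> (of_real (norm X + 1))"

text \<open>Independence of the shift: adding both shifts to X and splitting in two ways equates the
  two differences.\<close>

lemma T_eq:
  assumes X: "self_adj X" and c: "c > 0" "X + of_real c \<in> pos_inv"
  shows "T X = \<Phi> (X + of_real c) - \<Phi> (of_real c)"
proof -
  define k where "k = norm X + 1"
  have k: "k > 0" "X + of_real k \<in> pos_inv"
    using pos_inv_add_norm[OF X, of k] by (simp_all add: k_def add_nonneg_pos)
  have "\<Phi> (X + of_real c) + \<Phi> (of_real k) = \<Phi> (X + of_real c + of_real k)"
    by (rule Phi_add[symmetric, OF c(2) pos_inv_of_real[OF k(1)]])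
  also have "\<dots> = \<Phi> (X + of_real k + of_real c)" by (simp add: algebra_simps)
  also have "\<dots> = \<Phi> (X + of_real k) + \<Phi> (of_real c)"
    by (rule Phi_add[OF k(2) pos_inv_of_real[OF c(1)]])
  finally show ?thesis by (simp add: T_def k_def algebra_simps)
qed

lemma T_pos_inv: "A \<in> pos_inv \<Longrightarrow> T A = \<Phi> A"
proof -
  assume A: "A \<in> pos_inv"
  have "A + of_real 1 \<in> pos_inv" using pos_inv_add[OF A pos_inv_one] by simp
  then have "T A = \<Phi> (A + of_real 1) - \<Phi> (of_real 1)"
    by (rule T_eq[OF pos_invD(3)[OF A] zero_less_one])
  then show ?thesis using Phi_add[OF A pos_inv_one] by simp
qed

lemma T_shift: "self_adj X \<Longrightarrow> c > norm X \<Longrightarrow> T X = \<Phi> (X + of_real c) - \<Phi> (of_real c)"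
  using T_eq pos_inv_add_norm norm_ge_zero[of X] by (meson le_less_trans)

lemma T_self_adj: "self_adj X \<Longrightarrow> self_adj (T X)"
proof -
  assume X: "self_adj X"
  have c: "norm X + 1 > norm X" "norm X + 1 > 0" by (simp_all add: add_nonneg_pos)
  show ?thesis unfolding T_def adj_diff
    using pos_invD(3)[OF Phi_pos_inv[OF pos_inv_add_norm[OF X c(1)]]]
      pos_invD(3)[OF Phi_pos_inv[OF pos_inv_of_real[OF c(2)]]] by (simp only:)
qed

lemma T_add:
  assumes X: "self_adj X" and Y: "self_adj Y"
  shows "T (X + Y) = T X + T Y"
proof -
  define a b where "a = norm X + 1" and "b = norm Y + 1"
  have ab: "a > 0" "b > 0" "a > norm X" "b > norm Y" by (simp_all add: a_def b_def add_nonneg_pos)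
  have p: "X + of_real a \<in> pos_inv" "Y + of_real b \<in> pos_inv"
    using pos_inv_add_norm X Y ab by blast+
  have e: "X + Y + of_real (a + b) = (X + of_real a) + (Y + of_real b)" by (simp add: algebra_simps)
  have "T (X + Y) = \<Phi> (X + Y + of_real (a + b)) - \<Phi> (of_real (a + b))"
    by (rule T_eq, simp add: adj_add X Y, use ab in simp, simp only: e pos_inv_add[OF p])
  also have "\<dots> = (\<Phi> (X + of_real a) + \<Phi> (Y + of_real b)) - (\<Phi> (of_real a) + \<Phi> (of_real b))"
    unfolding e using Phi_add[OF p] Phi_add[OF pos_inv_of_real[OF ab(1)] pos_inv_of_real[OF ab(2)]] by simp
  finally show ?thesis using T_shift[OF X ab(3)] T_shift[OF Y ab(4)] by simp
qed

lemma T_zero: "T 0 = 0"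
  using T_add[of 0 0] by (simp add: adj_zero)

lemma T_minus: "self_adj X \<Longrightarrow> T (- X) = - T X"
  using T_add[of X "- X"] by (simp add: adj_minus T_zero eq_neg_iff_add_eq_0 add.commute)

lemma T_diff: "self_adj X \<Longrightarrow> self_adj Y \<Longrightarrow> T (X - Y) = T X - T Y"
  using T_add[of X "- Y"] by (simp add: adj_minus T_minus)

lemma T_scaleR:
  assumes X: "self_adj X"
  shows "T (r *\<^sub>R X) = r *\<^sub>R T X"
proof -
  have pos: "T (r *\<^sub>R X) = r *\<^sub>R T X" if r: "r > 0" for r
  proof -
    define c where "c = norm X + 1"
    have c: "c > 0" "c > norm X" by (simp_all add: c_def add_nonneg_pos)
    have "T (r *\<^sub>R X) = \<Phi> (r *\<^sub>R X + of_real (r * c)) - \<Phi> (of_real (r * c))"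
      by (rule T_shift) (use r c X in \<open>simp_all add: adj_scaleR\<close>)
    also have "r *\<^sub>R X + of_real (r * c) = r *\<^sub>R (X + of_real c)"
      by (simp add: scaleR_add_right of_real_def)
    also have "of_real (r * c) = r *\<^sub>R (of_real c :: 'a)" by (simp add: of_real_def)
    finally show ?thesis using T_shift[OF X c(2)] by (simp add: Phi_scaleR r scaleR_diff_right)
  qed
  consider "r > 0" | "r = 0" | "- r > 0" by linarith
  then show ?thesis
  proof cases
    case 3
    have "T (r *\<^sub>R X) = T (- ((- r) *\<^sub>R X))" by simp
    also have "\<dots> = - T ((- r) *\<^sub>R X)" by (rule T_minus) (simp add: adj_simps X)
    also have "T ((- r) *\<^sub>R X) = (- r) *\<^sub>R T X" by (rule pos[OF 3])
    finally show ?thesis by simp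
  qed (simp_all add: pos T_zero)
qed

lemma tr_T: "self_adj X \<Longrightarrow> B.tr (T X) = A.tr X"
proof -
  assume X: "self_adj X"
  have c: "norm X + 1 > norm X" "norm X + 1 > 0" by (simp_all add: add_nonneg_pos)
  show ?thesis unfolding T_def B.tr_diff
    by (simp only: tr_Phi[OF pos_inv_add_norm[OF X c(1)]] tr_Phi[OF pos_inv_of_real[OF c(2)]] A.tr_add add_diff_cancel_right')
qed

lemma T_inj: "self_adj X \<Longrightarrow> T X = 0 \<Longrightarrow> X = 0"
proof -
  assume X: "self_adj X" and z: "T X = 0"
  have c: "norm X + 1 > norm X" "norm X + 1 > 0" by (simp_all add: add_nonneg_pos)
  have "\<Phi> (X + of_real (norm X + 1)) = \<Phi> (of_real (norm X + 1))" using z unfolding T_def by simp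
  then have "X + of_real (norm X + 1) = of_real (norm X + 1)"
    by (rule Phi_inj[OF pos_inv_add_norm[OF X c(1)] pos_inv_of_real[OF c(2)]])
  then show "X = 0" by (simp only: add_cancel_left_left)
qed

lemma T_surj:
  assumes Y: "self_adj Y"
  obtains X where "self_adj X" "T X = Y"
proof -
  have D: "\<Phi> 1 \<in> pos_inv" by (rule Phi_pos_inv[OF pos_inv_one])
  \<comment> \<open>A multiple of \<Phi> 1 shifts Y into the cone, where \<Phi> is onto; linearity
    undoes the shift on the source side by the same multiple of 1.\<close>
  obtain s where s: "s > 0" "- Y \<preceq> s *\<^sub>R \<Phi> 1"
    using pos_inv_dominates[OF D, of "- Y"] Y by (auto simp: adj_minus)
  have "Y + (s + 1) *\<^sub>R \<Phi> 1 = (Y + s *\<^sub>R \<Phi> 1) + \<Phi> 1" by (simp add: algebra_simps)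
  moreover have "\<dots> \<in> pos_inv"
    using pos_inv_add_pos[OF D, of "Y + s *\<^sub>R \<Phi> 1"] s(2) by (simp add: cle_def add.commute)
  ultimately obtain Z where Z: "Z \<in> pos_inv" "\<Phi> Z = Y + (s + 1) *\<^sub>R \<Phi> 1" using Phi_surj by metis
  have sZ: "self_adj Z" "self_adj ((s + 1) *\<^sub>R 1 :: 'a)" using pos_invD(3)[OF Z(1)] by (simp_all add: adj_simps)
  have "T (Z - (s + 1) *\<^sub>R 1) = T Z - (s + 1) *\<^sub>R T 1"
    using T_diff[OF sZ] T_scaleR[of 1 "s + 1"] by (simp add: adj_one)
  then have "T (Z - (s + 1) *\<^sub>R 1) = Y" by (simp add: T_pos_inv Z pos_inv_one)
  then show ?thesis using that[of "Z - (s + 1) *\<^sub>R 1"] sZ by (simp add: adj_diff)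
qed

section \<open>Derivatives of the entropy and the centrality of e\<close>

definition D :: 'b where "D = \<Phi> 1"
definition e :: 'b where "e = cs_inv D"

lemma D_pos_inv: "D \<in> pos_inv"
  unfolding D_def by (rule Phi_pos_inv[OF pos_inv_one])

lemma e_pos_inv: "e \<in> pos_inv"
  unfolding e_def by (rule pos_inv_cs_inv[OF D_pos_inv])

lemma T_one: "T 1 = D"
  by (simp add: T_pos_inv pos_inv_one D_def)

lemma self_adj_e: "self_adj e"
  using pos_invD(3)[OF e_pos_inv] .

lemma eD: "e * D = 1" "D * e = 1" "e * (D * x) = x" "D * (e * x) = x"
  using pos_invD(4,5)[OF D_pos_inv] pos_inv_assoc[OF D_pos_inv] by (simp_all add: e_def)

text \<open>\<Phi> is affine along A + tH, with direction T H, and the linear terms agree because T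
  preserves the trace. The quadratic coefficients are therefore limits of the same function.\<close>

lemma second_order_preserved:
  assumes A: "A \<in> pos_inv" and H: "self_adj H"
  shows "A.tr (H * cs_inv A * H) = B.tr (T H * cs_inv (\<Phi> A) * T H)"
proof -
  obtain \<delta> where \<delta>: "\<delta> > 0" and ev: "\<forall>\<^sub>F t in at_right 0. of_real \<delta> \<preceq> A + t *\<^sub>R H"
    using pos_inv_perturb[OF A H] by blast
  have "\<forall>\<^sub>F t in at_right 0. (A.sbs A (A + t *\<^sub>R H) + t * A.tr H) / t\<^sup>2
      = (B.sbs (\<Phi> A) (\<Phi> A + t *\<^sub>R T H) + t * B.tr (T H)) / t\<^sup>2"
    using ev
  proof eventually_elim
    fix t assume "of_real \<delta> \<preceq> A + t *\<^sub>R H"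
    then have p: "A + t *\<^sub>R H \<in> pos_inv" using \<delta> pos_inv_iff by blast
    have "\<Phi> (A + t *\<^sub>R H) = T (A + t *\<^sub>R H)" by (simp add: T_pos_inv p)
    also have "\<dots> = \<Phi> A + t *\<^sub>R T H"
      using T_add[of A "t *\<^sub>R H"] pos_invD(3)[OF A] H by (simp add: adj_scaleR T_scaleR T_pos_inv[OF A])
    finally show "(A.sbs A (A + t *\<^sub>R H) + t * A.tr H) / t\<^sup>2
        = (B.sbs (\<Phi> A) (\<Phi> A + t *\<^sub>R T H) + t * B.tr (T H)) / t\<^sup>2"
      using sbs_Phi[OF A p] tr_T[OF H] by simp
  qed
  then have "((\<lambda>t. (B.sbs (\<Phi> A) (\<Phi> A + t *\<^sub>R T H) + t * B.tr (T H)) / t\<^sup>2)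
      \<longlongrightarrow> A.tr (H * cs_inv A * H) / 2) (at_right 0)"
    by (rule tendsto_cong[THEN iffD1]) (rule A.sbs_second_order[OF A H])
  moreover have "((\<lambda>t. (B.sbs (\<Phi> A) (\<Phi> A + t *\<^sub>R T H) + t * B.tr (T H)) / t\<^sup>2)
      \<longlongrightarrow> B.tr (T H * cs_inv (\<Phi> A) * T H) / 2) (at_right 0)"
    by (rule B.sbs_second_order[OF Phi_pos_inv[OF A] T_self_adj[OF H]])
  ultimately have "A.tr (H * cs_inv A * H) / 2 = B.tr (T H * cs_inv (\<Phi> A) * T H) / 2"
    by (rule tendsto_unique[rotated]) simp
  then show ?thesis by simp
qed

text \<open>The quadratic identity holds at every base point 1 + tG with small t > 0, so it may be
  differentiated at 1 in direction G; the image base point is D, which is where the factors e come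
  from.\<close>

lemma third_order_preserved:
  assumes H: "self_adj H" and G: "self_adj G"
  shows "A.tr (H * G * H) = B.tr (T H * e * T G * e * T H)"
proof -
  obtain \<delta> where \<delta>: "\<delta> > 0" and ev: "\<forall>\<^sub>F t in at_right 0. of_real \<delta> \<preceq> 1 + t *\<^sub>R G"
    using pos_inv_perturb[OF pos_inv_one G] by blast
  have inv1: "cs_inv (1::'a) = 1" by (rule cs_inv_eqI) simp_all
  have "\<forall>\<^sub>F t in at_right 0. (A.tr (H * cs_inv 1 * H) - A.tr (H * cs_inv (1 + t *\<^sub>R G) * H)) / t
      = (B.tr (T H * cs_inv D * T H) - B.tr (T H * cs_inv (D + t *\<^sub>R T G) * T H)) / t"
    using ev
  proof eventually_elim
    fix t assume "of_real \<delta> \<preceq> 1 + t *\<^sub>R G"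
    then have p: "1 + t *\<^sub>R G \<in> pos_inv" using \<delta> pos_inv_iff by blast
    have "\<Phi> (1 + t *\<^sub>R G) = T (1 + t *\<^sub>R G)" by (simp add: T_pos_inv p)
    also have "\<dots> = D + t *\<^sub>R T G"
      using T_add[of 1 "t *\<^sub>R G"] G by (simp add: adj_simps T_scaleR T_one)
    finally show "(A.tr (H * cs_inv 1 * H) - A.tr (H * cs_inv (1 + t *\<^sub>R G) * H)) / t
        = (B.tr (T H * cs_inv D * T H) - B.tr (T H * cs_inv (D + t *\<^sub>R T G) * T H)) / t"
      using second_order_preserved[OF pos_inv_one H] second_order_preserved[OF p H]
      by (simp add: D_def)
  qed
  then have "((\<lambda>t. (B.tr (T H * cs_inv D * T H) - B.tr (T H * cs_inv (D + t *\<^sub>R T G) * T H)) / t)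
      \<longlongrightarrow> A.tr (H * cs_inv 1 * G * cs_inv 1 * H)) (at_right 0)"
    by (rule tendsto_cong[THEN iffD1]) (rule A.tr_inverse_derivative[OF pos_inv_one G H])
  moreover have "((\<lambda>t. (B.tr (T H * cs_inv D * T H) - B.tr (T H * cs_inv (D + t *\<^sub>R T G) * T H)) / t)
      \<longlongrightarrow> B.tr (T H * cs_inv D * T G * cs_inv D * T H)) (at_right 0)"
    by (rule B.tr_inverse_derivative[OF D_pos_inv T_self_adj[OF G] T_self_adj[OF H]])
  ultimately have "A.tr (H * cs_inv 1 * G * cs_inv 1 * H) = B.tr (T H * cs_inv D * T G * cs_inv D * T H)"
    by (rule tendsto_unique[rotated]) simp
  then show ?thesis by (simp add: inv1 e_def)
qed

lemma third_order_polarized: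
  assumes H: "self_adj H" and G: "self_adj G" and K: "self_adj K"
  shows "A.tr (H * G * K + K * G * H) = B.tr (T H * e * T G * e * T K + T K * e * T G * e * T H)"
proof -
  have HK: "self_adj (H + K)" by (simp add: adj_add H K)
  have "A.tr ((H + K) * G * (H + K)) = A.tr (H * G * H) + A.tr (K * G * K) + A.tr (H * G * K + K * G * H)"
    by (simp add: algebra_simps A.tr_linear)
  moreover have "B.tr (T (H + K) * e * T G * e * T (H + K))
      = B.tr (T H * e * T G * e * T H) + B.tr (T K * e * T G * e * T K)
        + B.tr (T H * e * T G * e * T K + T K * e * T G * e * T H)"
    by (simp add: T_add H K algebra_simps B.tr_linear)
  ultimately show ?thesis
    using third_order_preserved[OF HK G] third_order_preserved[OF H G] third_order_preserved[OF K G] by linarith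
qed

text \<open>By the trace property the polarised cubic form is invariant under all permutations of its
arguments. Putting \<open>1\<close> in one slot gives \<open>[e, [e, h]] = 0\<close>, and then \<open>[e, h] = 0\<close>.\<close>

lemma e_commute_self_adj:
  assumes h: "self_adj h"
  shows "e * h = h * e"
proof -
  have sym: "B.tr (h * e * g * e * k + k * e * g * e * h) = B.tr (h * e * k * e * g + g * e * k * e * h)"
    if g: "self_adj g" and k: "self_adj k" for g k
  proof -
    obtain H where H: "self_adj H" "T H = h" using T_surj[OF h] by blast
    obtain G where G: "self_adj G" "T G = g" using T_surj[OF g] by blast
    obtain K where K: "self_adj K" "T K = k" using T_surj[OF k] by blast
    have "A.tr (H * G * K) = A.tr (G * K * H)" "A.tr (K * G * H) = A.tr (H * K * G)"
      using A.tr_commute[of H "G * K"] A.tr_commute[of "K * G" H] by (simp_all add: mult.assoc)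
    then have "A.tr (H * G * K + K * G * H) = A.tr (H * K * G + G * K * H)" by (simp add: A.tr_linear)
    then show ?thesis
      using third_order_polarized[OF H(1) G(1) K(1)] third_order_polarized[OF H(1) K(1) G(1)]
      by (simp add: H G K)
  qed
  \<comment> \<open>This is -[e,[e,h]]; it appears when k = 1 is put into \<open>sym\<close> and g
    is moved to the front under the trace.\<close>
  define w where "w = 2 *\<^sub>R (e * h * e) - h * e * e - e * e * h"
  have sw: "self_adj w" by (simp add: w_def adj_simps self_adj_e h mult.assoc)
  have "B.tr (g * w) = 0" if g: "self_adj g" for g
  proof -
    have "B.tr (h * e * g * e + e * g * e * h) = B.tr (h * e * e * g + g * e * e * h)"
      using sym[OF g adj_one] by simp
    moreover have "B.tr (h * e * g * e) = B.tr (g * (e * h * e))" "B.tr (e * g * e * h) = B.tr (g * (e * h * e))"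
      "B.tr (h * e * e * g) = B.tr (g * (h * e * e))"
      using B.tr_commute[of "h * e" "g * e"] B.tr_commute[of e "g * e * h"] B.tr_commute[of "h * e * e" g]
      by (simp_all add: mult.assoc)
    ultimately show ?thesis by (simp add: w_def B.tr_linear right_diff_distrib mult.assoc)
  qed
  then have w: "w = 0" using B.tr_square_zero[OF sw] sw by blast
  define c where "c = e * h - h * e"
  have ac: "adj c = - c" by (simp add: c_def adj_simps self_adj_e h)
  \<comment> \<open>Moving one e around the trace turns tr(c^2) into tr([c,e] h) = tr(wh) = 0. As c
    is skew-adjoint, -c^2 is positive and faithfulness gives c = 0.\<close>
  have "B.tr (c * c) = B.tr (c * e * h) - B.tr (c * h * e)" by (simp add: c_def algebra_simps B.tr_linear)
  also have "B.tr (c * h * e) = B.tr (e * c * h)" using B.tr_commute[of "c * h" e] by (simp add: mult.assoc)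
  also have "B.tr (c * e * h) - B.tr (e * c * h) = B.tr (w * h)"
    by (simp add: w_def c_def algebra_simps B.tr_linear scaleR_2)
  finally have "B.tr (adj c * c) = 0" by (simp add: w ac B.tr_linear)
  then have "adj c * c = 0" by (intro B.tr_pos_zero) (auto simp: cs_positive_def)
  then have "c = 0" using cstar_identity[of c] by simp
  then show ?thesis by (simp add: c_def)
qed

lemma e_central: "e * x = x * e"
proof -
  have "e * re_part x = re_part x * e" "e * im_part x = im_part x * e"
    using e_commute_self_adj self_adj_re_part self_adj_im_part by blast+
  then have "e * (re_part x + cscale \<i> (im_part x)) = (re_part x + cscale \<i> (im_part x)) * e"
    by (simp add: distrib_left distrib_right cscale_mult_left cscale_mult_right)
  then show ?thesis by (simp flip: re_im_part)
qed

lemma e_left: "x * (e * y) = e * (x * y)"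
  by (metis e_central mult.assoc)

lemma D_central: "D * x = x * D"
proof -
  have "D * x = D * (x * e) * D" by (simp add: mult.assoc eD)
  also have "\<dots> = x * D" by (simp add: eD flip: e_central)
  finally show ?thesis .
qed

text \<open>The cubic identity with 1 in the middle slot, simplified by eDe = e and centrality. It
  translates source pairings into e-weighted target pairings.\<close>

lemma second_order_one:
  assumes H: "self_adj H" and G: "self_adj G"
  shows "A.tr (H * G) = B.tr (e * T H * T G)"
proof -
  have "2 * A.tr (H * G) = A.tr (H * 1 * G + G * 1 * H)"
    using A.tr_commute[of H G] by (simp add: A.tr_linear)
  also have "\<dots> = B.tr (T H * e * D * e * T G + T G * e * D * e * T H)"
    using third_order_polarized[OF H adj_one G] by (simp add: T_one)
  also have "\<dots> = B.tr (e * T H * T G) + B.tr (T G * e * T H)"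
    using e_left[of "T H" "T G"] by (simp add: B.tr_linear mult.assoc eD)
  also have "B.tr (T G * e * T H) = B.tr (e * T H * T G)"
    using B.tr_commute[of "T G" "e * T H"] by (simp add: mult.assoc)
  finally show ?thesis by simp
qed

text \<open>Test the difference of the two sides against every g = T G. The bilinear identity turns
  one pairing into tr(H H G), the cubic identity turns the other into tr(H G H), and these
  agree.\<close>

lemma T_square:
  assumes H: "self_adj H"
  shows "e * T (H * H) = (e * T H) * (e * T H)"
proof -
  define w where "w = (e * T H) * (e * T H) - e * T (H * H)"
  have sH: "self_adj (H * H)" by (simp add: adj_mult H)
  have sw: "self_adj w"
    by (simp add: w_def adj_simps self_adj_e T_self_adj H sH e_left[of "T H"] mult.assoc flip: e_central)
  have "B.tr (w * g) = 0" if g: "self_adj g" for g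
  proof -
    obtain G where G: "self_adj G" "T G = g" using T_surj[OF g] by blast
    have "B.tr (e * T (H * H) * g) = A.tr (H * H * G)" using second_order_one[OF sH G(1)] G(2) by simp
    also have "\<dots> = A.tr (H * G * H)" using A.tr_commute[of H "H * G"] by (simp add: mult.assoc)
    also have "\<dots> = B.tr (T H * e * g * e * T H)" using third_order_preserved[OF H G(1)] G(2) by simp
    also have "\<dots> = B.tr ((e * T H) * (T H * e * g))"
      using B.tr_commute[of "T H * e * g" "e * T H"] by (simp add: mult.assoc)
    also have "(e * T H) * (T H * e * g) = (e * T H) * (e * T H) * g" by (simp add: e_left[of "T H"] mult.assoc)
    finally show ?thesis by (simp add: w_def left_diff_distrib B.tr_linear)
  qed
  then have "w = 0" using B.tr_square_zero[OF sw] sw by blast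
  then show ?thesis by (simp add: w_def)
qed

section \<open>Complexification\<close>

definition L :: "'a \<Rightarrow> 'b" where
  "L x = T (re_part x) + cscale \<i> (T (im_part x))"

lemma L_add: "L (x + y) = L x + L y"
  by (simp add: L_def re_part_add im_part_add T_add self_adj_re_part self_adj_im_part cscale_add_right)

lemma L_self_adj: "self_adj x \<Longrightarrow> L x = T x"
  by (simp add: L_def re_part_self_adj im_part_self_adj T_zero cscale_0_right)

lemma L_parts: "self_adj a \<Longrightarrow> self_adj b \<Longrightarrow> L (a + cscale \<i> b) = T a + cscale \<i> (T b)"
  using parts_unique[OF refl, of a b] by (simp add: L_def)

lemma L_scaleR: "L (r *\<^sub>R x) = r *\<^sub>R L x"
proof -
  have "r *\<^sub>R x = r *\<^sub>R re_part x + cscale \<i> (r *\<^sub>R im_part x)"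
    by (subst re_im_part[of x]) (simp add: scaleR_add_right cscale_scaleR)
  then have "L (r *\<^sub>R x) = T (r *\<^sub>R re_part x) + cscale \<i> (T (r *\<^sub>R im_part x))"
    using L_parts[of "r *\<^sub>R re_part x" "r *\<^sub>R im_part x"]
    by (simp add: adj_scaleR self_adj_re_part self_adj_im_part)
  then show ?thesis
    by (simp add: T_scaleR self_adj_re_part self_adj_im_part L_def scaleR_add_right cscale_scaleR)
qed

lemma L_ii: "L (cscale \<i> x) = cscale \<i> (L x)"
proof -
  have "cscale \<i> x = - im_part x + cscale \<i> (re_part x)"
    by (subst re_im_part[of x]) (simp add: cscale_add_right cscale_ii)
  then have "L (cscale \<i> x) = T (- im_part x) + cscale \<i> (T (re_part x))"
    using L_parts[of "- im_part x" "re_part x"] by (simp add: adj_minus self_adj_re_part self_adj_im_part)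
  then show ?thesis by (simp add: L_def T_minus self_adj_im_part cscale_add_right cscale_ii)
qed

lemma L_cscale: "L (cscale c x) = cscale c (L x)"
  using cscale_split[of c x] cscale_split[of c "L x"] by (simp add: L_add L_ii L_scaleR)

lemma L_adj: "L (adj x) = adj (L x)"
proof -
  have "adj x = re_part x + cscale \<i> (- im_part x)"
    by (subst re_im_part[of x])
       (simp add: adj_add adj_cscale self_adj_re_part self_adj_im_part cscale_neg cscale_minus)
  then have "L (adj x) = T (re_part x) + cscale \<i> (T (- im_part x))"
    using L_parts[of "re_part x" "- im_part x"] by (simp add: adj_minus self_adj_re_part self_adj_im_part)
  then show ?thesis
    by (simp add: L_def T_minus T_self_adj self_adj_re_part self_adj_im_part adj_add adj_cscale
        cscale_neg cscale_minus)
qed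

lemma L_bij: "bij L"
proof (rule bijI)
  show "inj L"
  proof (rule injI)
    fix x y assume "L x = L y"
    then have z: "L (x - y) = 0" using L_add[of "x - y" y] by simp
    have sT: "self_adj (T (re_part (x - y)))" "self_adj (T (im_part (x - y)))"
      by (simp_all add: T_self_adj self_adj_re_part self_adj_im_part)
    have "re_part (0::'b) = T (re_part (x - y))" "im_part (0::'b) = T (im_part (x - y))"
      using parts_unique[OF _ sT] z by (simp_all add: L_def)
    then have "T (re_part (x - y)) = 0" "T (im_part (x - y)) = 0"
      by (simp_all add: re_part_self_adj im_part_self_adj adj_zero)
    then have "re_part (x - y) = 0" "im_part (x - y) = 0"
      using T_inj self_adj_re_part self_adj_im_part by blast+
    then show "x = y" using re_im_part[of "x - y"] by (simp add: cscale_0_right)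
  qed
  show "surj L"
    unfolding surj_def
  proof
    fix y :: 'b
    obtain a where a: "self_adj a" "T a = re_part y" using T_surj[OF self_adj_re_part] by blast
    obtain b where b: "self_adj b" "T b = im_part y" using T_surj[OF self_adj_im_part] by blast
    have "L (a + cscale \<i> b) = y" using L_parts[OF a(1) b(1)] a(2) b(2) re_im_part[of y] by simp
    then show "\<exists>x. y = L x" by metis
  qed
qed

lemma omega_L: "\<omega> (L x) = \<tau> x"
proof -
  have "\<omega> (T a) = \<tau> a" if "self_adj a" for a
    using that by (simp add: B.tau_self_adj T_self_adj A.tau_self_adj tr_T)
  then have "\<omega> (L x) = \<tau> (re_part x + cscale \<i> (im_part x))"
    by (simp add: L_def A.tau_add B.tau_add A.tau_cscale B.tau_cscale self_adj_re_part self_adj_im_part)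
  then show ?thesis by (simp flip: re_im_part)
qed

section \<open>The Jordan isomorphism\<close>

definition J :: "'a \<Rightarrow> 'b" where "J x = e * L x"

lemma J_add: "J (x + y) = J x + J y"
  by (simp add: J_def L_add distrib_left)

lemma J_cscale: "J (cscale c x) = cscale c (J x)"
  by (simp add: J_def L_cscale cscale_mult_right)

lemma J_jordan_self_adj:
  assumes H: "self_adj H" and K: "self_adj K"
  shows "J (H * K + K * H) = J H * J K + J K * J H"
proof -
  have sq: "J (x * x) = J x * J x" if "self_adj x" for x
    using T_square[OF that] that by (simp add: J_def L_self_adj adj_mult)
  have "J ((H + K) * (H + K)) = J (H * H) + J (K * K) + J (H * K + K * H)"
    by (simp add: algebra_simps flip: J_add)
  moreover have "J ((H + K) * (H + K)) = J H * J H + J K * J K + (J H * J K + J K * J H)"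
    using sq[of "H + K"] H K by (simp add: adj_add J_add algebra_simps)
  ultimately show ?thesis by (simp add: sq H K)
qed

text \<open>Both sides are complex bilinear, so the self-adjoint case, itself the linearisation of
  preservation of squares, suffices.\<close>

lemma J_jordan: "J (X * Y + Y * X) = J X * J Y + J Y * J X"
proof -
  define a b c d where "a = re_part X" and "b = im_part X" and "c = re_part Y" and "d = im_part Y"
  have sa: "self_adj a" "self_adj b" "self_adj c" "self_adj d"
    by (simp_all add: a_def b_def c_def d_def self_adj_re_part self_adj_im_part)
  have X: "X = a + cscale \<i> b" and Y: "Y = c + cscale \<i> d"
    unfolding a_def b_def c_def d_def by (rule re_im_part)+
  define p q r s where "p = a * c + c * a" and "q = a * d + d * a"
    and "r = b * c + c * b" and "s = b * d + d * b"
  have "X * Y + Y * X = p + cscale \<i> q + cscale \<i> r + cscale \<i> (cscale \<i> s)"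
    unfolding X Y p_def q_def r_def s_def
    by (simp add: algebra_simps cscale_mult_left cscale_mult_right cscale_add_right)
  then have "J (X * Y + Y * X) = J p + cscale \<i> (J q) + cscale \<i> (J r) + cscale \<i> (cscale \<i> (J s))"
    by (simp only: J_add J_cscale)
  also have "\<dots> = (J a * J c + J c * J a) + cscale \<i> (J a * J d + J d * J a)
      + cscale \<i> (J b * J c + J c * J b) + cscale \<i> (cscale \<i> (J b * J d + J d * J b))"
    unfolding p_def q_def r_def s_def by (simp only: J_jordan_self_adj sa)
  also have "\<dots> = J X * J Y + J Y * J X"
    unfolding X Y
    by (simp add: J_add J_cscale algebra_simps cscale_mult_left cscale_mult_right cscale_add_right)
  finally show ?thesis .
qed

text \<open>The central factor is D = \<Phi> 1, the inverse of e, so D J = L; on densities L is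
  \<phi>, and L intertwines the traces.\<close>

lemma phi_standard_form: "standard_form \<tau> \<omega> \<phi>"
proof -
  have DJ: "D * J x = L x" for x by (simp add: J_def eD)
  have "jordan_star_iso J"
    unfolding jordan_star_iso_def
  proof (intro conjI allI)
    have "bij (\<lambda>y. e * y)"
      by (rule o_bij[of "\<lambda>y. D * y"]) (simp_all add: fun_eq_iff eD)
    then show "bij J" unfolding J_def using bij_comp[OF L_bij] by (simp add: o_def)
    show "J (adj X) = adj (J X)" for X
      by (simp add: J_def L_adj adj_mult self_adj_e e_central)
    show "J (X * Y + Y * X) = J X * J Y + J Y * J X" for X Y by (rule J_jordan)
  qed (simp_all only: J_add J_cscale)
  moreover have "\<phi> A = D * J A" if A: "A \<in> density_set \<tau>" for A
    using A.density_setD(1)[OF A] Phi_density[OF A] by (simp add: DJ L_self_adj pos_invD(3) T_pos_inv)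
  moreover have "\<omega> (D * J X) = \<tau> X" for X by (simp add: DJ omega_L)
  ultimately show ?thesis
    unfolding standard_form_def central_def using D_central D_pos_inv by blast
qed

end

subsection \<open>Maps in the standard form preserve the relative entropy\<close>

locale jordan_iso =
  fixes J :: "'a::cstar_algebra \<Rightarrow> 'b::cstar_algebra"
  assumes jordan: "jordan_star_iso J"
begin

lemma J_add: "J (x + y) = J x + J y"
  and J_cscale: "J (cscale c x) = cscale c (J x)"
  and J_mult: "J (x * y + y * x) = J x * J y + J y * J x"
  and J_adj: "J (adj x) = adj (J x)"
  and J_bij: "bij J"
  using jordan unfolding jordan_star_iso_def by auto

lemma J_scaleR: "J (r *\<^sub>R x) = r *\<^sub>R J x"
  using J_cscale[of "of_real r" x] by (simp add: cscale_of_real)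

lemma J_minus: "J (- x) = - J x"
  using J_scaleR[of "-1" x] by simp

lemma J_diff: "J (x - y) = J x - J y"
  using J_add[of x "- y"] by (simp add: J_minus)

lemma J_square: "J (x * x) = J x * J x"
proof -
  have "2 *\<^sub>R J (x * x) = 2 *\<^sub>R (J x * J x)"
    using J_mult[of x x] by (simp add: J_add scaleR_2)
  then show ?thesis by simp
qed

lemma J_one: "J 1 = 1"
proof -
  obtain y where y: "J y = 1" using J_bij by (metis bij_pointE)
  have "2 *\<^sub>R J 1 = 2 *\<^sub>R (1 :: 'b)" using J_mult[of 1 y] y by (simp add: J_add scaleR_2)
  then show ?thesis by simp
qed

lemma J_of_real: "J (of_real r) = of_real r"
  by (simp add: of_real_def J_scaleR J_one)

text \<open>The product xyx is a Jordan expression: with z = xy + yx, 2xyx = (xz + zx) - (x^2 y + y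
  x^2). Inverses, powers and the argument of the logarithm in the entropy are all reached through
  it.\<close>

lemma J_triple: "J (x * y * x) = J x * J y * J x"
proof -
  define z where "z = x * y + y * x"
  have "2 *\<^sub>R (x * y * x) + (x * x * y + y * (x * x)) = x * z + z * x"
    by (simp add: z_def algebra_simps scaleR_2)
  then have "2 *\<^sub>R J (x * y * x) + (J (x * x) * J y + J y * J (x * x)) = J x * J z + J z * J x"
    by (metis J_add J_mult J_scaleR)
  moreover have "J z = J x * J y + J y * J x" unfolding z_def by (rule J_mult)
  ultimately have "2 *\<^sub>R J (x * y * x) = 2 *\<^sub>R (J x * J y * J x)"
    by (simp add: J_square algebra_simps scaleR_2)
  then show ?thesis by simp
qed

lemma J_self_adj: "self_adj x \<Longrightarrow> self_adj (J x)"
  by (simp flip: J_adj)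

lemma J_pos: "cs_positive A \<Longrightarrow> cs_positive (J A)"
  by (metis J_self_adj J_square pos_root pos_square)

lemma J_cle: "A \<preceq> B \<Longrightarrow> J A \<preceq> J B"
  using J_pos[of "B - A"] by (simp add: cle_def J_diff)

lemma J_pos_inv: "A \<in> pos_inv \<Longrightarrow> J A \<in> pos_inv"
  unfolding pos_inv_iff using J_cle J_of_real by metis

lemma J_inv:
  assumes "A \<in> pos_inv"
  shows "J (cs_inv A) = cs_inv (J A)"
proof -
  note i = pos_inv_assoc[OF J_pos_inv[OF assms]] pos_invD(4,5)[OF J_pos_inv[OF assms]]
  have "J A * J (cs_inv A) * J A = J A"
    using J_triple[of A "cs_inv A"] pos_invD(4)[OF assms] by simp
  then have "cs_inv (J A) * (J A * J (cs_inv A) * J A) * cs_inv (J A) = cs_inv (J A)"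
    by (simp add: i)
  then show ?thesis by (simp add: mult.assoc i)
qed

lemma J_power: "J (x ^ n) = J x ^ n"
proof (induction n rule: induct_nat_012)
  case (ge2 n)
  have "J (x ^ Suc (Suc n)) = J (x * x ^ n * x)" by (simp add: power_commutes mult.assoc)
  also have "\<dots> = J x * J x ^ n * J x" by (simp only: J_triple ge2(1))
  also have "\<dots> = J x ^ Suc (Suc n)" by (simp add: power_commutes mult.assoc)
  finally show ?case .
qed (simp_all add: J_one)

lemma norm_J_self_adj:
  assumes "self_adj K"
  shows "norm (J K) \<le> norm K"
proof (rule norm_le_pos)
  show "self_adj (J K)" by (rule J_self_adj[OF assms])
  show "cs_positive (of_real (norm K) - J K)"
    using J_cle[OF cle_norm[OF assms]] by (simp add: cle_def J_of_real)
  show "cs_positive (of_real (norm K) + J K)"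
    using J_cle[OF minus_norm_cle[OF assms]] by (simp add: cle_def J_minus J_of_real add.commute)
qed

text \<open>Positivity bounds J on self-adjoint elements, and the constant 2 comes from splitting
  into real and imaginary parts. Boundedness is what lets J pass through the exponential
  series.\<close>

lemma bounded_linear_J: "bounded_linear J"
proof (rule bounded_linear_intro[where K = 2])
  fix x :: 'a
  have "norm (re_part x) \<le> norm x" "norm (im_part x) \<le> norm x"
    using norm_triangle_ineq[of x "adj x"] norm_triangle_ineq4[of "adj x" x]
    by (simp_all add: re_part_def im_part_def norm_adj norm_cscale)
  moreover have "J x = J (re_part x) + cscale \<i> (J (im_part x))"
    by (subst re_im_part[of x]) (simp add: J_add J_cscale)
  ultimately show "norm (J x) \<le> norm x * 2"
    using norm_triangle_ineq[of "J (re_part x)" "cscale \<i> (J (im_part x))"]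
      norm_J_self_adj[OF self_adj_re_part, of x] norm_J_self_adj[OF self_adj_im_part, of x]
    by (simp add: norm_cscale)
qed (simp_all add: J_add J_scaleR)

lemma J_exp: "J (exp x) = exp (J x)"
  unfolding exp_def
  by (simp add: bounded_linear.suminf[OF bounded_linear_J summable_exp_generic] J_scaleR J_power)

lemma J_log:
  assumes "W \<in> pos_inv"
  shows "cs_log (J W) = J (cs_log W)"
  by (rule cs_log_unique)
     (simp_all add: J_pos_inv J_self_adj cs_log assms flip: J_exp)

text \<open>Being central, C splits off the square roots and the inverse and cancels in the argument
  of the logarithm. What remains is the triple product of \<open>J a\<close>,
  \<open>J (cs_inv B)\<close> and \<open>J a\<close>, so the argument is the J-image of the original
  one.\<close>

lemma S_BS_standard_form:
  assumes \<tau>: "faithful_trace \<tau>" and \<omega>: "faithful_trace \<omega>"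
    and cen: "central C" and C: "C \<in> pos_inv" and tr: "\<And>X. \<omega> (C * J X) = \<tau> X"
    and A: "A \<in> pos_inv" and B: "B \<in> pos_inv"
  shows "S_BS \<omega> (C * J A) (C * J B) = S_BS \<tau> A B"
proof -
  interpret T: traced \<tau> by unfold_locales (rule \<tau>)
  interpret O: traced \<omega> by unfold_locales (rule \<omega>)
  define a c where "a = cs_sqrt A" and "c = cs_sqrt C"
  define W where "W = a * cs_inv B * a"
  have a: "a \<in> pos_inv" "a * a = A" using pos_inv_cs_sqrt[OF A] by (simp_all add: a_def)
  have c: "c \<in> pos_inv" "c * c = C" using pos_inv_cs_sqrt[OF C] by (simp_all add: c_def)
  have Cx: "x * C = C * x" for x using cen by (simp add: central_def)
  have cx: "x * c = c * x" for x unfolding c_def by (rule cs_sqrt(3)[OF pos_invD(1)[OF C] Cx])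
  have W: "W \<in> pos_inv" unfolding W_def by (intro pos_inv_conj(1) pos_inv_cs_inv a B)
  have sq: "cs_sqrt (C * J A) = c * J a"
  proof (rule cs_sqrt_unique)
    show "cs_positive (c * J a)" by (intro pos_commute_mult pos_invD(1) J_pos_inv c a cx[symmetric])
    have "c * J a * (c * J a) = c * (J a * c) * J a" by (simp only: mult.assoc)
    also have "\<dots> = c * c * (J a * J a)" by (simp only: cx[of "J a"] mult.assoc)
    also have "\<dots> = C * J A" by (simp add: c(2) a(2) flip: J_square)
    finally show "c * J a * (c * J a) = C * J A" .
  qed
  have inv: "cs_inv (C * J B) = J (cs_inv B) * cs_inv C"
    using cs_inv_mult(1)[OF pos_invD(2)[OF C] pos_invD(2)[OF J_pos_inv[OF B]]] by (simp add: J_inv B)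
  have iCx: "x * cs_inv C = cs_inv C * x" for x by (rule cs_inv_commute[OF C Cx])
  have "c * J a * (J (cs_inv B) * cs_inv C) * (c * J a)
      = c * J a * J (cs_inv B) * (cs_inv C * c) * J a" by (simp only: mult.assoc)
  also have "\<dots> = c * (J a * J (cs_inv B) * (c * cs_inv C)) * J a" by (simp only: iCx[of c] mult.assoc)
  also have "\<dots> = c * (c * cs_inv C * (J a * J (cs_inv B))) * J a"
  proof -
    have "x * (c * cs_inv C) = c * cs_inv C * x" for x by (metis cx iCx mult.assoc)
    then show ?thesis by (simp only:)
  qed
  also have "\<dots> = C * cs_inv C * (J a * J (cs_inv B) * J a)" by (simp only: c(2)[symmetric] mult.assoc)
  also have "\<dots> = J W" by (simp add: pos_invD(4)[OF C] W_def J_triple)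
  finally have arg: "cs_sqrt (C * J A) * cs_inv (C * J B) * cs_sqrt (C * J A) = J W"
    by (simp only: sq inv)
  define L where "L = cs_log W"
  have "S_BS \<omega> (C * J A) (C * J B) = \<omega> (C * J A * J L)"
    unfolding S_BS_def arg by (simp add: J_log[OF W] L_def)
  moreover have "\<omega> (C * J L * J A) = \<omega> (C * J A * J L)"
    using O.tau_commute[of "C * J L" "J A"] Cx[of "J A"] by (simp flip: mult.assoc)
  \<comment> \<open>J respects only the symmetrised product of A and L; the two summands on each
    side are equal by the trace property, which accounts for the factor 2.\<close>
  moreover have "\<omega> (C * J A * J L) + \<omega> (C * J L * J A) = \<tau> (A * L + L * A)"
    by (simp only: tr[symmetric] J_mult distrib_left mult.assoc O.tau_add)
  ultimately have "2 * S_BS \<omega> (C * J A) (C * J B) = 2 * \<tau> (A * L)"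
    using T.tau_commute[of L A] by (simp add: T.tau_add)
  then show ?thesis by (simp add: S_BS_def L_def W_def a_def)
qed

end

theorem theorem6:
  fixes \<tau> :: "'a::cstar_algebra \<Rightarrow> complex"
    and \<omega> :: "'b::cstar_algebra \<Rightarrow> complex"
    and \<phi> :: "'a \<Rightarrow> 'b"
  assumes "faithful_trace \<tau>" and "faithful_trace \<omega>"
    and "\<phi> ` density_set \<tau> = density_set \<omega>"
  shows "(\<forall>A \<in> density_set \<tau>. \<forall>B \<in> density_set \<tau>.
            S_BS \<omega> (\<phi> A) (\<phi> B) = S_BS \<tau> A B)
         \<longleftrightarrow> standard_form \<tau> \<omega> \<phi>"
proof
  assume p: "\<forall>A \<in> density_set \<tau>. \<forall>B \<in> density_set \<tau>. S_BS \<omega> (\<phi> A) (\<phi> B) = S_BS \<tau> A B"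
  interpret bs_map \<tau> \<omega> \<phi>
    by unfold_locales (use assms p in auto)
  show "standard_form \<tau> \<omega> \<phi>" by (rule phi_standard_form)
next
  assume "standard_form \<tau> \<omega> \<phi>"
  then obtain C J where s: "central C" "C \<in> pos_inv" "jordan_star_iso J"
    "\<And>A. A \<in> density_set \<tau> \<Longrightarrow> \<phi> A = C * J A" "\<And>X. \<omega> (C * J X) = \<tau> X"
    unfolding standard_form_def by blast
  interpret jordan_iso J by unfold_locales (rule s(3))
  show "\<forall>A \<in> density_set \<tau>. \<forall>B \<in> density_set \<tau>. S_BS \<omega> (\<phi> A) (\<phi> B) = S_BS \<tau> A B"
    using S_BS_standard_form[OF assms(1,2) s(1,2,5)] by (simp add: s(4) density_set_def)
qed

end
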